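(* Let $k$ be a field and let $R$ be a complete semilocal right noetherian $k$-algebra with Jacobson radical $\mathfrak{m}$ such that $\dim_k R/\mathfrak{m}<\infty$. Suppose that $R$ has (two-sided) ideals $I$ and $J_1\subsetneq J_2$ such that $J_2/J_1$ is free of rank $s$ as a left $R/I$-module and free of rank $t$ as a right $R/I$-module, where $s,t$ are integers. If $s<t$, then there is no weak adic filtration $\Gamma$ of $R$ such that the associated graded ring $\operatorname{gr}_\Gamma R$ is right noetherian.
   Context: All algebras are associative, unital, over a fixed field $k$. Saying that $J_2/J_1$ is a left and a right $R/I$-module (with the structures induced from the $R$-bimodule structure) includes $IJ_2\subseteq J_1$ and $J_2I\subseteq J_1$. "Complete" means complete (and separated) with respect to the $\mathfrak{m}$-adic topology. A filtration of a $k$-algebra $R$ means an ascending chain of $k$-subspaces $\Gamma=\{\Gamma_i\subseteq\Gamma_{i+1} : i\in\mathbb{Z}\}$ of $R$ such that: (1) $1\in\Gamma_0$ and $\Gamma_i\Gamma_j\subseteq\Gamma_{i+j}$ for all $i,j\in\mathbb{Z}$; (2) $\Gamma$ is finite: $\dim_k\Gamma_i/\Gamma_{i-1}<\infty$ for all $i\in\mathbb{Z}$; (3) $\Gamma$ is exhaustive and separated: $R=\bigcup_{i\in\mathbb{Z}}\Gamma_i$ and $\bigcap_{i\in\mathbb{Z}}\Gamma_i=0$. The associated graded ring is $\operatorname{gr}_\Gamma R=\bigoplus_{i\in\mathbb{Z}}\Gamma_i/\Gamma_{i-1}$. For a semilocal algebra $R$ with Jacobson radical $\mathfrak{m}$ and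 $\dim_k R/\mathfrak{m}<\infty$, a filtration $\Gamma$ of $R$ is a weak adic filtration if $\Gamma_n=R$ for all $n\ge 0$ and $\Gamma_{-1}\subseteq\mathfrak{m}$. *)

theory Defs
  imports "HOL-Algebra.Module" "HOL-Algebra.QuotRing" "HOL-Algebra.Ideal_Product"
begin

section \<open>Algebras over a field\<close>

text \<open>The library locale \<^locale>\<open>algebra\<close> is restricted to commutative algebras.\<close>

locale assoc_algebra = module K R + K?: field K + ring R
  for K :: "('k, 'c) ring_scheme" (structure) and R :: "('k, 'a, 'd) module_scheme" (structure) +
  assumes smult_mult_left:
      "\<lbrakk>a \<in> carrier K; x \<in> carrier R; y \<in> carrier R\<rbrakk> \<Longrightarrow>
        (a \<odot>\<^bsub>R\<^esub> x) \<otimes>\<^bsub>R\<^esub> y = a \<odot>\<^bsub>R\<^esub> (x \<otimes>\<^bsub>R\<^esub> y)"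
    and smult_mult_right:
      "\<lbrakk>a \<in> carrier K; x \<in> carrier R; y \<in> carrier R\<rbrakk> \<Longrightarrow>
        x \<otimes>\<^bsub>R\<^esub> (a \<odot>\<^bsub>R\<^esub> y) = a \<odot>\<^bsub>R\<^esub> (x \<otimes>\<^bsub>R\<^esub> y)"

definition finite_dimensional :: "('k, 'c) ring_scheme \<Rightarrow> ('k, 'v, 'd) module_scheme \<Rightarrow> bool"
  where "finite_dimensional K M \<longleftrightarrow>
    (\<exists>B. finite B \<and> B \<subseteq> carrier M \<and>
      (\<forall>x \<in> carrier M. \<exists>c \<in> B \<rightarrow> carrier K. x = (\<Oplus>\<^bsub>M\<^esub>b\<in>B. c b \<odot>\<^bsub>M\<^esub> b)))"


section \<open>Modules over noncommutative rings\<close>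

text \<open>The library locale \<^locale>\<open>module\<close> requires commutative scalars. For a right
  module, the scalar multiplication \<^term>\<open>a \<odot>\<^bsub>M\<^esub> x\<close> of the record stands for \<open>x a\<close>.\<close>

locale left_module = A?: ring A + M?: abelian_group M
  for A :: "('r, 'c) ring_scheme" (structure) and M :: "('r, 'v, 'd) module_scheme" (structure) +
  assumes lsmult_closed: "\<lbrakk>a \<in> carrier A; x \<in> carrier M\<rbrakk> \<Longrightarrow> a \<odot>\<^bsub>M\<^esub> x \<in> carrier M"
    and lsmult_l_distr: "\<lbrakk>a \<in> carrier A; b \<in> carrier A; x \<in> carrier M\<rbrakk> \<Longrightarrow>
      (a \<oplus>\<^bsub>A\<^esub> b) \<odot>\<^bsub>M\<^esub> x = a \<odot>\<^bsub>M\<^esub> x \<oplus>\<^bsub>M\<^esub> b \<odot>\<^bsub>M\<^esub> x"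
    and lsmult_r_distr: "\<lbrakk>a \<in> carrier A; x \<in> carrier M; y \<in> carrier M\<rbrakk> \<Longrightarrow>
      a \<odot>\<^bsub>M\<^esub> (x \<oplus>\<^bsub>M\<^esub> y) = a \<odot>\<^bsub>M\<^esub> x \<oplus>\<^bsub>M\<^esub> a \<odot>\<^bsub>M\<^esub> y"
    and lsmult_assoc: "\<lbrakk>a \<in> carrier A; b \<in> carrier A; x \<in> carrier M\<rbrakk> \<Longrightarrow>
      (a \<otimes>\<^bsub>A\<^esub> b) \<odot>\<^bsub>M\<^esub> x = a \<odot>\<^bsub>M\<^esub> (b \<odot>\<^bsub>M\<^esub> x)"
    and lsmult_one: "x \<in> carrier M \<Longrightarrow> \<one>\<^bsub>A\<^esub> \<odot>\<^bsub>M\<^esub> x = x"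

locale right_module = A?: ring A + M?: abelian_group M
  for A :: "('r, 'c) ring_scheme" (structure) and M :: "('r, 'v, 'd) module_scheme" (structure) +
  assumes rsmult_closed: "\<lbrakk>a \<in> carrier A; x \<in> carrier M\<rbrakk> \<Longrightarrow> a \<odot>\<^bsub>M\<^esub> x \<in> carrier M"
    and rsmult_l_distr: "\<lbrakk>a \<in> carrier A; b \<in> carrier A; x \<in> carrier M\<rbrakk> \<Longrightarrow>
      (a \<oplus>\<^bsub>A\<^esub> b) \<odot>\<^bsub>M\<^esub> x = a \<odot>\<^bsub>M\<^esub> x \<oplus>\<^bsub>M\<^esub> b \<odot>\<^bsub>M\<^esub> x"
    and rsmult_r_distr: "\<lbrakk>a \<in> carrier A; x \<in> carrier M; y \<in> carrier M\<rbrakk> \<Longrightarrow>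
      a \<odot>\<^bsub>M\<^esub> (x \<oplus>\<^bsub>M\<^esub> y) = a \<odot>\<^bsub>M\<^esub> x \<oplus>\<^bsub>M\<^esub> a \<odot>\<^bsub>M\<^esub> y"
    and rsmult_assoc: "\<lbrakk>a \<in> carrier A; b \<in> carrier A; x \<in> carrier M\<rbrakk> \<Longrightarrow>
      (a \<otimes>\<^bsub>A\<^esub> b) \<odot>\<^bsub>M\<^esub> x = b \<odot>\<^bsub>M\<^esub> (a \<odot>\<^bsub>M\<^esub> x)"
    and rsmult_one: "x \<in> carrier M \<Longrightarrow> \<one>\<^bsub>A\<^esub> \<odot>\<^bsub>M\<^esub> x = x"

text \<open>The family \<open>e 0, \<dots>, e (n - 1)\<close> is a basis. With the convention above, the same
  formula serves left and right modules.\<close>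

definition is_basis ::
    "('r, 'c) ring_scheme \<Rightarrow> ('r, 'v, 'd) module_scheme \<Rightarrow> nat \<Rightarrow> (nat \<Rightarrow> 'v) \<Rightarrow> bool"
  where "is_basis A M n e \<longleftrightarrow>
    e \<in> {..<n} \<rightarrow> carrier M \<and>
    (\<forall>x \<in> carrier M. \<exists>!c. c \<in> {..<n} \<rightarrow>\<^sub>E carrier A \<and> x = (\<Oplus>\<^bsub>M\<^esub>i\<in>{..<n}. c i \<odot>\<^bsub>M\<^esub> e i))"

definition free_left_module ::
    "('r, 'c) ring_scheme \<Rightarrow> ('r, 'v, 'd) module_scheme \<Rightarrow> nat \<Rightarrow> bool"
  where "free_left_module A M n \<longleftrightarrow> left_module A M \<and> (\<exists>e. is_basis A M n e)"

definition free_right_module ::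
    "('r, 'c) ring_scheme \<Rightarrow> ('r, 'v, 'd) module_scheme \<Rightarrow> nat \<Rightarrow> bool"
  where "free_right_module A M n \<longleftrightarrow> right_module A M \<and> (\<exists>e. is_basis A M n e)"


section \<open>Subquotients of a ring\<close>

text \<open>For additive subgroups \<open>W \<subseteq> V\<close> of \<open>R\<close>, the additive group \<open>V / W\<close> with a given
  scalar multiplication on cosets. The ring multiplication and unit of the record are junk.\<close>

definition subquotient ::
    "('a, 'b) ring_scheme \<Rightarrow> 'a set \<Rightarrow> 'a set \<Rightarrow> ('c \<Rightarrow> 'a set \<Rightarrow> 'a set) \<Rightarrow> ('c, 'a set) module"
  where "subquotient R V W act =
    \<lparr>carrier = (\<lambda>x. W +>\<^bsub>R\<^esub> x) ` V, mult = undefined, one = undefined,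
     zero = W, add = set_add R, smult = act\<rparr>"

definition quotient_space ::
    "('k, 'a, 'b) module_scheme \<Rightarrow> 'a set \<Rightarrow> 'a set \<Rightarrow> ('k, 'a set) module"
  where "quotient_space R V W = subquotient R V W (\<lambda>a X. \<Union>x\<in>X. W +>\<^bsub>R\<^esub> (a \<odot>\<^bsub>R\<^esub> x))"

text \<open>The actions \<open>(I + r) (W + x) = W + r x\<close> and \<open>(W + x) (I + r) = W + x r\<close> of
  \<open>R / I\<close> on \<open>V / W\<close>.\<close>

definition left_quotient :: "('a, 'b) ring_scheme \<Rightarrow> 'a set \<Rightarrow> 'a set \<Rightarrow> ('a set, 'a set) module"
  where "left_quotient R V W = subquotient R V W (\<lambda>A X. rcoset_mult R W A X)"

definition right_quotient :: "('a, 'b) ring_scheme \<Rightarrow> 'a set \<Rightarrow> 'a set \<Rightarrow> ('a set, 'a set) module"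
  where "right_quotient R V W = subquotient R V W (\<lambda>A X. rcoset_mult R W X A)"


section \<open>Right ideals, chain conditions, the Jacobson radical\<close>

definition right_ideal :: "'a set \<Rightarrow> ('a, 'b) ring_scheme \<Rightarrow> bool"
  where "right_ideal J A \<longleftrightarrow>
    additive_subgroup J A \<and> (\<forall>x \<in> J. \<forall>a \<in> carrier A. x \<otimes>\<^bsub>A\<^esub> a \<in> J)"

definition right_noetherian :: "('a, 'b) ring_scheme \<Rightarrow> bool"
  where "right_noetherian A \<longleftrightarrow>
    (\<forall>J :: nat \<Rightarrow> 'a set. (\<forall>n. right_ideal (J n) A \<and> J n \<subseteq> J (Suc n)) \<longrightarrow>
      (\<exists>N. \<forall>n \<ge> N. J n = J N))"

definition right_artinian :: "('a, 'b) ring_scheme \<Rightarrow> bool"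
  where "right_artinian A \<longleftrightarrow>
    (\<forall>J :: nat \<Rightarrow> 'a set. (\<forall>n. right_ideal (J n) A \<and> J (Suc n) \<subseteq> J n) \<longrightarrow>
      (\<exists>N. \<forall>n \<ge> N. J n = J N))"

definition maximal_right_ideal :: "'a set \<Rightarrow> ('a, 'b) ring_scheme \<Rightarrow> bool"
  where "maximal_right_ideal M A \<longleftrightarrow>
    right_ideal M A \<and> M \<noteq> carrier A \<and>
    (\<forall>J. right_ideal J A \<longrightarrow> M \<subseteq> J \<longrightarrow> J = M \<or> J = carrier A)"

definition jacobson_radical :: "('a, 'b) ring_scheme \<Rightarrow> 'a set"
  where "jacobson_radical A = carrier A \<inter> \<Inter>{M. maximal_right_ideal M A}"

text \<open>A one-sided artinian ring with zero Jacobson radical is semisimple, so the choice of side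
  in the next definition is immaterial.\<close>

definition semilocal :: "('a, 'b) ring_scheme \<Rightarrow> bool"
  where "semilocal A \<longleftrightarrow> right_artinian (A Quot jacobson_radical A)"


section \<open>Adic completeness\<close>

primrec ideal_power :: "('a, 'b) ring_scheme \<Rightarrow> 'a set \<Rightarrow> nat \<Rightarrow> 'a set"
  where
    "ideal_power A I 0 = carrier A"
  | "ideal_power A I (Suc n) = ideal_prod A (ideal_power A I n) I"

definition adic_Cauchy :: "('a, 'b) ring_scheme \<Rightarrow> 'a set \<Rightarrow> (nat \<Rightarrow> 'a) \<Rightarrow> bool"
  where "adic_Cauchy A I x \<longleftrightarrow>
    (\<forall>n. \<exists>N. \<forall>i \<ge> N. \<forall>j \<ge> N. x i \<ominus>\<^bsub>A\<^esub> x j \<in> ideal_power A I n)"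

definition adic_limit :: "('a, 'b) ring_scheme \<Rightarrow> 'a set \<Rightarrow> (nat \<Rightarrow> 'a) \<Rightarrow> 'a \<Rightarrow> bool"
  where "adic_limit A I x l \<longleftrightarrow>
    (\<forall>n. \<exists>N. \<forall>i \<ge> N. x i \<ominus>\<^bsub>A\<^esub> l \<in> ideal_power A I n)"

definition adically_complete :: "('a, 'b) ring_scheme \<Rightarrow> 'a set \<Rightarrow> bool"
  where "adically_complete A I \<longleftrightarrow>
    (\<Inter>n. ideal_power A I n) = {\<zero>\<^bsub>A\<^esub>} \<and>
    (\<forall>x \<in> UNIV \<rightarrow> carrier A. adic_Cauchy A I x \<longrightarrow> (\<exists>l \<in> carrier A. adic_limit A I x l))"


section \<open>Filtrations and associated graded rings\<close>

locale filtration = assoc_algebra K R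
  for K :: "('k, 'c) ring_scheme" (structure) and R :: "('k, 'a, 'd) module_scheme" (structure) +
  fixes \<Gamma> :: "int \<Rightarrow> 'a set"
  assumes filt_subspace: "submodule (\<Gamma> i) K R"
    and filt_mono: "\<Gamma> i \<subseteq> \<Gamma> (i + 1)"
    and filt_one: "\<one>\<^bsub>R\<^esub> \<in> \<Gamma> 0"
    and filt_mult: "\<lbrakk>x \<in> \<Gamma> i; y \<in> \<Gamma> j\<rbrakk> \<Longrightarrow> x \<otimes>\<^bsub>R\<^esub> y \<in> \<Gamma> (i + j)"
    and filt_finite: "finite_dimensional K (quotient_space R (\<Gamma> i) (\<Gamma> (i - 1)))"
    and filt_exhaustive: "(\<Union>i. \<Gamma> i) = carrier R"
    and filt_separated: "(\<Inter>i. \<Gamma> i) = {\<zero>\<^bsub>R\<^esub>}"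

locale weak_adic_filtration = filtration +
  assumes filt_nonneg: "n \<ge> 0 \<Longrightarrow> \<Gamma> n = carrier R"
    and filt_radical: "\<Gamma> (-1) \<subseteq> jacobson_radical R"

text \<open>The graded piece \<open>\<Gamma> i / \<Gamma> (i - 1)\<close>, used only as an additive group.\<close>

definition gr_piece :: "('a, 'b) ring_scheme \<Rightarrow> (int \<Rightarrow> 'a set) \<Rightarrow> int \<Rightarrow> (unit, 'a set) module"
  where "gr_piece R \<Gamma> i = subquotient R (\<Gamma> i) (\<Gamma> (i - 1)) (\<lambda>_ X. X)"

text \<open>Elements of the direct sum are finitely supported families of cosets. The product of
  the coset of \<open>x\<close> in degree \<open>i\<close> and the coset of \<open>y\<close> in degree \<open>n - i\<close> is the coset of
  \<open>x y\<close> in \<open>\<Gamma> n / \<Gamma> (n - 1)\<close>. In the formula for the product, the summation is restricted to a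
  finite set containing all nonzero terms, as \<^const>\<open>finsum\<close> over an infinite set is zero.\<close>

definition gr :: "('a, 'b) ring_scheme \<Rightarrow> (int \<Rightarrow> 'a set) \<Rightarrow> (int \<Rightarrow> 'a set) ring"
  where "gr R \<Gamma> =
    \<lparr>carrier = {f. (\<forall>i. f i \<in> carrier (gr_piece R \<Gamma> i)) \<and> finite {i. f i \<noteq> \<zero>\<^bsub>gr_piece R \<Gamma> i\<^esub>}},
     mult = (\<lambda>f g n. \<Oplus>\<^bsub>gr_piece R \<Gamma> n\<^esub>
       i \<in> {i. f i \<noteq> \<zero>\<^bsub>gr_piece R \<Gamma> i\<^esub> \<and> g (n - i) \<noteq> \<zero>\<^bsub>gr_piece R \<Gamma> (n - i)\<^esub>}.
         rcoset_mult R (\<Gamma> (n - 1)) (f i) (g (n - i))),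
     one = (\<lambda>i. if i = 0 then \<Gamma> (-1) +>\<^bsub>R\<^esub> \<one>\<^bsub>R\<^esub> else \<zero>\<^bsub>gr_piece R \<Gamma> i\<^esub>),
     zero = (\<lambda>i. \<zero>\<^bsub>gr_piece R \<Gamma> i\<^esub>),
     add = (\<lambda>f g i. f i \<oplus>\<^bsub>gr_piece R \<Gamma> i\<^esub> g i)\<rparr>"

end

theory Submission
  imports Complex_Main Defs
begin

text \<open>
  Let \<open>F\<^sub>n = \<Gamma>\<^sub>-\<^sub>n\<close>, a descending chain of two-sided ideals of finite codimension, let \<open>M = J2/J1\<close>, and let
  \<open>d(n) = dim R/(I + F\<^sub>n)\<close>. The images of \<open>J2 \<inter> F\<^sub>n\<close> filter \<open>M\<close>, and the two bases of \<open>M\<close> measure this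
  filtration differently. A left basis shows that \<open>M\<close> modulo the image of \<open>J2 \<inter> F\<^sub>n\<close> has dimension at most
  \<open>s d(n)\<close>, because that image contains \<open>F\<^sub>n M\<close> (\<open>left_rank_bound\<close>). A right basis shows that \<open>M/M F\<^sub>n\<close> has
  dimension \<open>t d(n)\<close> (\<open>right_rank_bound\<close> proves the inequality that is needed). If \<open>gr R\<close> is right
  noetherian, the filtration of \<open>M\<close> and the filtration by the \<open>M F\<^sub>n\<close> differ by a bounded shift only:
  \<open>J2 \<inter> F\<^sub>n\<^sub>+\<^sub>c \<subseteq> J2 F\<^sub>n\<close> for some \<open>c\<close> and all \<open>n\<close> (\<open>artin_rees\<close>). Therefore
  \<open>t d(n) \<le> s d(n + c)\<close>.

  As \<open>I + F\<^sub>1\<close> is contained in a maximal right ideal, \<open>d(1) > 0\<close>. So \<open>s < t\<close> would make \<open>d\<close>, and with it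
  \<open>dim R/F\<^sub>n\<close>, grow exponentially. But the Hilbert function of a right noetherian graded algebra grows
  subexponentially (\<open>subexponential_growth\<close>, following Stephenson and Zhang), a contradiction.

  Both consequences of the noetherian hypothesis on \<open>gr R\<close> rest on one lemma about sets of symbols that
  cannot be enlarged, \<open>gr_noetherian_maximal_symbols\<close>. The Artin--Rees inclusion moreover needs
  series of elements of \<open>F\<^sub>n\<close> to converge, whereas \<open>R\<close> is complete for the radical-adic topology. Each \<open>F\<^sub>n\<close>
  contains a power of the radical \<open>\<mm>\<close> by Nakayama's lemma, and each \<open>R/\<mm>\<^sup>j\<close> has finite dimension, so that
  \<open>R\<close> is linearly compact and the required limits exist (\<open>nested_cosets_meet\<close>).

  Dimensions of quotients \<open>U/W\<close> are counted by generators of \<open>U\<close> over \<open>W\<close> inside \<open>R\<close>; the dimension theory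
  that is needed is additivity and the behaviour under linear maps.
\<close>


section \<open>Relative dimension of subspaces\<close>

locale vector_space_over = module K V + K?: field K
  for K :: "('k, 'c) ring_scheme" and V :: "('k, 'v, 'd) module_scheme" (structure)
begin

abbreviation subspace :: "'v set \<Rightarrow> bool"
  where "subspace U \<equiv> submodule U K V"

abbreviation lspan :: "'v set \<Rightarrow> 'v set"
  where "lspan S \<equiv> (\<lambda>U. submodule U K V) hull S"

lemma subspaceI:
  assumes "U \<subseteq> carrier V" "\<zero> \<in> U" "\<And>x y. \<lbrakk>x \<in> U; y \<in> U\<rbrakk> \<Longrightarrow> x \<oplus> y \<in> U"
    and "\<And>c x. \<lbrakk>c \<in> carrier K; x \<in> U\<rbrakk> \<Longrightarrow> c \<odot> x \<in> U"
  shows "subspace U"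
proof (rule submoduleI)
  fix x assume x: "x \<in> U"
  then have "(\<ominus>\<^bsub>K\<^esub> \<one>\<^bsub>K\<^esub>) \<odot> x \<in> U" using assms(4) by auto
  moreover have "(\<ominus>\<^bsub>K\<^esub> \<one>\<^bsub>K\<^esub>) \<odot> x = \<ominus> x"
    using x assms(1) smult_l_minus[of "\<one>\<^bsub>K\<^esub>" x] by auto
  ultimately show "\<ominus> x \<in> U" by simp
qed (use assms in auto)

lemma subspace_mem: "subspace U \<Longrightarrow> x \<in> U \<Longrightarrow> x \<in> carrier V"
  using submoduleE(1) by blast

lemma subspace_zero: "subspace U \<Longrightarrow> \<zero> \<in> U"
  using submodule.axioms(1) subgroup.one_closed by fastforce

lemma subspace_minus: "\<lbrakk>subspace U; x \<in> U; y \<in> U\<rbrakk> \<Longrightarrow> x \<ominus> y \<in> U"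
  by (metis M.minus_eq submoduleE(3,5))

lemma subspace_add: "\<lbrakk>subspace U; x \<in> U; y \<in> U\<rbrakk> \<Longrightarrow> x \<oplus> y \<in> U"
  by (metis submoduleE(5))

lemma subspace_smult: "\<lbrakk>subspace U; c \<in> carrier K; x \<in> U\<rbrakk> \<Longrightarrow> c \<odot> x \<in> U"
  by (metis submoduleE(4))

lemma subspace_carrier: "subspace (carrier V)"
  by (rule carrier_is_submodule)

lemma subspace_Inter:
  assumes "\<And>U. U \<in> \<U> \<Longrightarrow> subspace U" and "\<U> \<noteq> {}"
  shows "subspace (\<Inter>\<U>)"
proof (rule subspaceI)
  show "\<Inter>\<U> \<subseteq> carrier V" using assms subspace_mem by blast
qed (use assms in \<open>auto intro: subspace_zero subspace_add subspace_smult\<close>)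

lemma subspace_Int: "subspace U \<Longrightarrow> subspace W \<Longrightarrow> subspace (U \<inter> W)"
  using subspace_Inter[of "{U, W}"] by auto

lemma subspace_lspan: "S \<subseteq> carrier V \<Longrightarrow> subspace (lspan S)"
  unfolding hull_def by (rule subspace_Inter) (use subspace_carrier in blast)+

lemma lspan_self: "subspace U \<Longrightarrow> lspan U = U"
  by (rule hull_same)

lemma lspan_minimal: "\<lbrakk>S \<subseteq> U; subspace U\<rbrakk> \<Longrightarrow> lspan S \<subseteq> U"
  by (rule hull_minimal)

lemma lspan_le: "\<lbrakk>S \<subseteq> lspan T; T \<subseteq> carrier V\<rbrakk> \<Longrightarrow> lspan S \<subseteq> lspan T"
  by (rule lspan_minimal[OF _ subspace_lspan])

lemma set_add_mem: "x \<in> U <+>\<^bsub>V\<^esub> W \<longleftrightarrow> (\<exists>u\<in>U. \<exists>w\<in>W. x = u \<oplus> w)"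
  by (auto simp: set_add_def')

lemma subspace_set_add:
  assumes U: "subspace U" and W: "subspace W"
  shows "subspace (U <+>\<^bsub>V\<^esub> W)"
proof (rule subspaceI)
  note [simp] = subspace_mem[OF U] subspace_mem[OF W]
  show "U <+>\<^bsub>V\<^esub> W \<subseteq> carrier V" by (auto simp: set_add_mem)
  show "\<zero> \<in> U <+>\<^bsub>V\<^esub> W"
    unfolding set_add_mem using subspace_zero[OF U] subspace_zero[OF W] by force
  fix x y assume "x \<in> U <+>\<^bsub>V\<^esub> W" "y \<in> U <+>\<^bsub>V\<^esub> W"
  then obtain u w u' w' where h: "u \<in> U" "w \<in> W" "x = u \<oplus> w" "u' \<in> U" "w' \<in> W" "y = u' \<oplus> w'"
    unfolding set_add_mem by blast
  then have "x \<oplus> y = (u \<oplus> u') \<oplus> (w \<oplus> w')" by (simp add: M.add.m_ac)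
  then show "x \<oplus> y \<in> U <+>\<^bsub>V\<^esub> W"
    unfolding set_add_mem using h subspace_add[OF U] subspace_add[OF W] by blast
next
  fix c x assume c: "c \<in> carrier K" and "x \<in> U <+>\<^bsub>V\<^esub> W"
  then obtain u w where h: "u \<in> U" "w \<in> W" "x = u \<oplus> w"
    unfolding set_add_mem by blast
  then have "c \<odot> x = c \<odot> u \<oplus> c \<odot> w"
    using c subspace_mem[OF U] subspace_mem[OF W] by (simp add: smult_r_distr)
  then show "c \<odot> x \<in> U <+>\<^bsub>V\<^esub> W"
    unfolding set_add_mem using h c subspace_smult[OF U] subspace_smult[OF W] by blast
qed

lemma set_add_upper1: "subspace U \<Longrightarrow> subspace W \<Longrightarrow> U \<subseteq> U <+>\<^bsub>V\<^esub> W"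
  unfolding set_add_mem subset_iff by (metis M.r_zero subspace_mem subspace_zero)

lemma set_add_upper2: "subspace U \<Longrightarrow> subspace W \<Longrightarrow> W \<subseteq> U <+>\<^bsub>V\<^esub> W"
  unfolding set_add_mem subset_iff by (metis M.l_zero subspace_mem subspace_zero)

lemma set_add_least: "\<lbrakk>subspace X; U \<subseteq> X; W \<subseteq> X\<rbrakk> \<Longrightarrow> U <+>\<^bsub>V\<^esub> W \<subseteq> X"
  unfolding set_add_mem subset_iff using subspace_add by blast

lemma subspace_line:
  assumes x: "x \<in> carrier V"
  shows "subspace ((\<lambda>c. c \<odot> x) ` carrier K)"
proof (rule subspaceI)
  show "\<zero> \<in> (\<lambda>c. c \<odot> x) ` carrier K"
    using smult_l_null[OF x] by (metis R.zero_closed imageI)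
qed (use x in \<open>auto simp: smult_l_distr[symmetric] smult_assoc1[symmetric]\<close>)

lemma lspan_insert:
  assumes U: "subspace U" and x: "x \<in> carrier V" and y: "y \<in> lspan (insert x U)"
  shows "\<exists>u\<in>U. \<exists>c\<in>carrier K. y = u \<oplus> c \<odot> x"
proof -
  let ?L = "(\<lambda>c. c \<odot> x) ` carrier K"
  have "x \<in> ?L" using x by (metis R.one_closed imageI smult_one)
  then have "insert x U \<subseteq> U <+>\<^bsub>V\<^esub> ?L"
    using set_add_upper1[OF U subspace_line[OF x]] set_add_upper2[OF U subspace_line[OF x]] by blast
  then have "y \<in> U <+>\<^bsub>V\<^esub> ?L"
    using y lspan_minimal[OF _ subspace_set_add[OF U subspace_line[OF x]]] by blast
  then show ?thesis unfolding set_add_mem by blast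
qed

text \<open>If \<open>U\<close> lies in \<open>U' + K x\<close>, then \<open>U \<inter> U'\<close> has codimension at most one in \<open>U\<close>, and any vector
  of \<open>U\<close> outside \<open>U'\<close> makes up for the difference: its \<open>x\<close>-coordinate is invertible. Steinitz
  exchange enters the dimension theory through this lemma alone.\<close>

lemma lspan_insert_exchange:
  assumes U: "subspace U" and U': "subspace U'" and x: "x \<in> carrier V"
    and sub: "U \<subseteq> lspan (insert x U')" and y: "y \<in> U" "y \<notin> U'"
  shows "U \<subseteq> lspan (insert y (U \<inter> U'))"
proof
  fix u assume u: "u \<in> U"
  obtain a c where a: "a \<in> U'" "c \<in> carrier K" "y = a \<oplus> c \<odot> x"
    using lspan_insert[OF U' x] sub y by blast
  obtain b d where b: "b \<in> U'" "d \<in> carrier K" "u = b \<oplus> d \<odot> x"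
    using lspan_insert[OF U' x] sub u by blast
  have c0: "c \<noteq> \<zero>\<^bsub>K\<^esub>"
    using a y x subspace_mem[OF U'] by (auto)
  define l where "l = d \<otimes>\<^bsub>K\<^esub> inv\<^bsub>K\<^esub> c"
  have l: "l \<in> carrier K" "l \<otimes>\<^bsub>K\<^esub> c = d"
    unfolding l_def using a b c0 by (auto simp: R.m_assoc field_Units)
  note car = x a b l subspace_mem[OF U' a(1)] subspace_mem[OF U' b(1)]
  have "u \<ominus> l \<odot> y = b \<ominus> l \<odot> a"
  proof -
    have 1: "l \<odot> y = l \<odot> a \<oplus> d \<odot> x"
      using car by (simp add: smult_r_distr smult_assoc1[symmetric])
    have "(b \<oplus> d \<odot> x) \<ominus> (l \<odot> a \<oplus> d \<odot> x) = b \<ominus> l \<odot> a \<oplus> (d \<odot> x \<ominus> d \<odot> x)"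
      using car by (simp add: M.minus_eq M.minus_add M.add.m_ac del: M.r_neg)
    then show ?thesis using 1 car by (simp add: M.r_neg M.minus_eq)
  qed
  then have "u \<ominus> l \<odot> y \<in> U \<inter> U'"
    using U U' a b l y u by (metis IntI subspace_minus subspace_smult)
  then have 1: "u \<ominus> l \<odot> y \<in> lspan (insert y (U \<inter> U'))"
    by (simp add: hull_inc)
  have sp: "subspace (lspan (insert y (U \<inter> U')))"
    by (rule subspace_lspan) (use U y subspace_mem in auto)
  have 2: "l \<odot> y \<in> lspan (insert y (U \<inter> U'))"
    using sp l by (simp add: subspace_smult hull_inc)
  have "u = (u \<ominus> l \<odot> y) \<oplus> l \<odot> y"
    using u y l subspace_mem[OF U] by (simp add: M.minus_eq M.add.m_assoc M.l_neg)
  then show "u \<in> lspan (insert y (U \<inter> U'))"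
    using subspace_add[OF sp 1 2] by simp
qed

text \<open>This says \<open>dim (W + U) / W \<le> n\<close>. Working with generators in the ambient space instead of bases
  of a quotient avoids all quotient records and all notions of linear independence.\<close>

definition generated_over :: "'v set \<Rightarrow> 'v set \<Rightarrow> nat \<Rightarrow> bool"
  where "generated_over W U n \<longleftrightarrow>
    (\<exists>B. finite B \<and> B \<subseteq> carrier V \<and> card B \<le> n \<and> U \<subseteq> lspan (W \<union> B))"

lemma generated_over_mono:
  "\<lbrakk>generated_over W U m; W \<subseteq> W'; U' \<subseteq> U; m \<le> n\<rbrakk> \<Longrightarrow> generated_over W' U' n"
  unfolding generated_over_def
  by (elim exE conjE, rule exI) (auto dest: hull_mono[OF Un_mono[OF _ order_refl], THEN subsetD])

lemma generated_over_0: "subspace W \<Longrightarrow> generated_over W U 0 \<longleftrightarrow> U \<subseteq> W"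
  unfolding generated_over_def
  by (auto simp: lspan_self intro!: exI[of _ "{}::'v set"])

lemma generated_over_insert:
  assumes "generated_over W U n" "y \<in> carrier V" "W \<subseteq> carrier V" "U' \<subseteq> lspan (insert y U)"
  shows "generated_over W U' (Suc n)"
proof -
  obtain B where B: "finite B" "B \<subseteq> carrier V" "card B \<le> n" "U \<subseteq> lspan (W \<union> B)"
    using assms unfolding generated_over_def by blast
  have "lspan (insert y U) \<subseteq> lspan (W \<union> insert y B)"
  proof (rule lspan_le)
    show "insert y U \<subseteq> lspan (W \<union> insert y B)"
      using B(4) hull_mono[of "W \<union> B" "W \<union> insert y B"] by (auto simp: hull_inc)
  qed (use assms B in auto)
  then show ?thesis
    unfolding generated_over_def using B assms
    by (intro exI[of _ "insert y B"]) (auto simp: card_insert_if)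
qed

lemma generated_over_trans:
  assumes "generated_over W V' p" "generated_over V' U q" "W \<subseteq> carrier V"
  shows "generated_over W U (p + q)"
proof -
  obtain B C where B: "finite B" "B \<subseteq> carrier V" "card B \<le> p" "V' \<subseteq> lspan (W \<union> B)"
    and C: "finite C" "C \<subseteq> carrier V" "card C \<le> q" "U \<subseteq> lspan (V' \<union> C)"
    using assms unfolding generated_over_def by blast
  have "lspan (V' \<union> C) \<subseteq> lspan (W \<union> (B \<union> C))"
  proof (rule lspan_le)
    show "V' \<union> C \<subseteq> lspan (W \<union> (B \<union> C))"
      using B(4) hull_mono[of "W \<union> B" "W \<union> (B \<union> C)"] by (auto simp: hull_inc)
  qed (use assms B C in auto)
  moreover have "card (B \<union> C) \<le> p + q" using card_Un_le[of B C] B(3) C(3) by linarith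
  ultimately show ?thesis
    unfolding generated_over_def using B C
    by (intro exI[of _ "B \<union> C"]) auto
qed

text \<open>Generators may be taken in \<open>U\<close> itself: removing one generator at a time, each is exchanged
  against a vector of \<open>U\<close> or is superfluous.\<close>

lemma generated_over_inside:
  assumes "generated_over W U n" and W: "subspace W" and "subspace U" and "W \<subseteq> U"
  shows "\<exists>B. finite B \<and> B \<subseteq> U \<and> card B \<le> n \<and> U \<subseteq> lspan (W \<union> B)"
proof -
  obtain B where B: "finite B" "B \<subseteq> carrier V" "card B \<le> n" "U \<subseteq> lspan (W \<union> B)"
    using assms unfolding generated_over_def by blast
  have "\<exists>C. finite C \<and> C \<subseteq> U \<and> card C \<le> card B \<and> U \<subseteq> lspan (W \<union> C)"
    using B(1,2,4) assms(3,4)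
  proof (induction B arbitrary: U rule: finite_induct)
    case empty
    then show ?case by (intro exI[of _ "{}"]) auto
  next
    case (insert x B)
    define U' where "U' = lspan (W \<union> B)"
    have U': "subspace U'"
      unfolding U'_def using insert.prems W subspace_mem by (intro subspace_lspan) auto
    have "W \<subseteq> U'" unfolding U'_def by (simp add: hull_inc subset_iff)
    then obtain C where C: "finite C" "C \<subseteq> U \<inter> U'" "card C \<le> card B" "U \<inter> U' \<subseteq> lspan (W \<union> C)"
      using insert.IH[of "U \<inter> U'"] insert.prems subspace_Int[OF insert.prems(3) U']
      unfolding U'_def by auto
    show ?case
    proof (cases "U \<subseteq> U'")
      case True
      then have "U \<inter> U' = U" by blast
      then show ?thesis using C insert.hyps by (intro exI[of _ C]) auto
    next
      case False
      then obtain y where y: "y \<in> U" "y \<notin> U'" by blast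
      have x: "x \<in> carrier V" using insert.prems by simp
      have "insert x (W \<union> B) \<subseteq> lspan (insert x U')"
        unfolding U'_def by (metis Un_upper1 Un_upper2 hull_subset insert_is_Un insert_mono order_trans)
      then have "U \<subseteq> lspan (insert x U')"
        using insert.prems(2) lspan_le[of "W \<union> insert x B" "insert x U'"] x U' subspace_mem by auto
      then have "U \<subseteq> lspan (insert y (U \<inter> U'))"
        using lspan_insert_exchange[OF insert.prems(3) U' x _ y] by blast
      also have "\<dots> \<subseteq> lspan (W \<union> insert y C)"
      proof (rule lspan_le)
        show "insert y (U \<inter> U') \<subseteq> lspan (W \<union> insert y C)"
          using C(4) hull_mono[of "W \<union> C" "W \<union> insert y C"] by (auto simp: hull_inc)
      qed (use insert.prems C y subspace_mem W in auto)
      finally show ?thesis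
        using C y insert.hyps by (intro exI[of _ "insert y C"]) (auto simp: card_insert_if)
    qed
  qed
  then show ?thesis using B(3) by (meson order_trans)
qed

text \<open>The inequality \<open>dim U/W \<ge> dim V'/W + dim U/V'\<close>, which makes dimension additive. Adding
  a generator raises the dimension of at most one of the two steps of \<open>W \<subseteq> V' \<subseteq> U\<close>: of the lower one if
  \<open>V'\<close> is not contained in the span \<open>U'\<close> of \<open>W\<close> and the other generators, of the upper one otherwise.\<close>

lemma generated_over_split:
  assumes "generated_over W U n" and W: "subspace W" and "subspace V'" "subspace U"
    and "W \<subseteq> V'" "V' \<subseteq> U"
  shows "\<exists>p q. p + q \<le> n \<and> generated_over W V' p \<and> generated_over V' U q"
proof -
  obtain B where B: "finite B" "B \<subseteq> carrier V" "card B \<le> n" "U \<subseteq> lspan (W \<union> B)"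
    using assms unfolding generated_over_def by blast
  have "\<exists>p q. p + q \<le> card B \<and> generated_over W V' p \<and> generated_over V' U q"
    using B(1,2,4) assms(3-6)
  proof (induction B arbitrary: V' U rule: finite_induct)
    case empty
    then have "V' \<subseteq> W" "U \<subseteq> V'" using W by (auto simp: lspan_self)
    then show ?case using generated_over_0 W empty by auto
  next
    case (insert x B)
    define U' where "U' = lspan (W \<union> B)"
    have U': "subspace U'"
      unfolding U'_def using insert.prems W subspace_mem by (intro subspace_lspan) auto
    have "W \<subseteq> U'" unfolding U'_def by (simp add: hull_inc subset_iff)
    then have "\<exists>p q. p + q \<le> card B \<and> generated_over W (V' \<inter> U') p \<and>
        generated_over (V' \<inter> U') (U \<inter> U') q"
      using insert.prems subspace_Int[OF insert.prems(3) U'] subspace_Int[OF insert.prems(4) U']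
      by (intro insert.IH) (auto simp: U'_def)
    then obtain p q where pq: "p + q \<le> card B" "generated_over W (V' \<inter> U') p"
      "generated_over (V' \<inter> U') (U \<inter> U') q"
      by blast
    have x: "x \<in> carrier V" using insert.prems by simp
    have "insert x (W \<union> B) \<subseteq> lspan (insert x U')"
      unfolding U'_def by (metis Un_upper1 Un_upper2 hull_subset insert_is_Un insert_mono order_trans)
    then have UU: "U \<subseteq> lspan (insert x U')"
      using insert.prems(2) lspan_le[of "W \<union> insert x B" "insert x U'"] x U' subspace_mem by auto
    have ins: "X \<subseteq> lspan (insert y (X \<inter> U'))" if "X \<subseteq> U" "subspace X" "y \<in> X" "y \<notin> U'" for X y
      using lspan_insert_exchange[OF that(2) U' x] UU that by blast
    have wc: "W \<subseteq> carrier V" using W subspace_mem by blast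
    show ?case
    proof (cases "V' \<subseteq> U'")
      case True
      then have V': "V' \<inter> U' = V'" by blast
      have "generated_over V' U (Suc q)"
      proof (cases "U \<subseteq> U'")
        case True
        then have "U \<inter> U' = U" by blast
        then show ?thesis using pq(3) V' generated_over_mono[of V' U q V' U] by simp
      next
        case False
        then obtain y where "y \<in> U" "y \<notin> U'" by blast
        then show ?thesis
          using generated_over_insert[of V' "U \<inter> U'" q y U] pq(3) V' ins[of U y]
            submoduleE(1)[of V'] subspace_mem[of U] insert.prems by simp
      qed
      then show ?thesis using pq V' insert.hyps
        by (intro exI[of _ p] exI[of _ "Suc q"]) auto
    next
      case False
      then obtain y where y: "y \<in> V'" "y \<notin> U'" by blast
      have "generated_over W V' (Suc p)"
        using generated_over_insert[OF pq(2) _ wc ins[OF insert.prems(6,3) y]] y(1) insert.prems(3)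
          subspace_mem by simp
      moreover have "generated_over V' U q"
      proof -
        obtain C where C: "finite C" "C \<subseteq> carrier V" "card C \<le> q" "U \<inter> U' \<subseteq> lspan ((V' \<inter> U') \<union> C)"
          using pq(3) unfolding generated_over_def by blast
        have "lspan (insert y (U \<inter> U')) \<subseteq> lspan (V' \<union> C)"
        proof (rule lspan_le)
          show "insert y (U \<inter> U') \<subseteq> lspan (V' \<union> C)"
            using C(4) hull_mono[of "(V' \<inter> U') \<union> C" "V' \<union> C"] y by (auto simp: hull_inc)
        qed (use C insert.prems subspace_mem in auto)
        then have "U \<subseteq> lspan (V' \<union> C)"
          using ins[OF order_refl insert.prems(4) _ y(2)] y(1) insert.prems(6) by (meson order_trans subsetD)
        then show ?thesis using C unfolding generated_over_def by blast
      qed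
      ultimately show ?thesis using pq insert.hyps
        by (intro exI[of _ "Suc p"] exI[of _ q]) auto
    qed
  qed
  then show ?thesis using B(3) by (meson order_trans)
qed

definition finite_over :: "'v set \<Rightarrow> 'v set \<Rightarrow> bool"
  where "finite_over W U \<longleftrightarrow> (\<exists>n. generated_over W U n)"

text \<open>The dimension of \<open>U/W\<close>. If \<open>finite_over W U\<close> fails, the value is arbitrary.\<close>

definition rdim :: "'v set \<Rightarrow> 'v set \<Rightarrow> nat"
  where "rdim W U = (LEAST n. generated_over W U n)"

lemma rdim_le: "generated_over W U n \<Longrightarrow> rdim W U \<le> n"
  unfolding rdim_def by (rule Least_le)

lemma generated_over_rdim: "finite_over W U \<Longrightarrow> generated_over W U (rdim W U)"
  unfolding rdim_def finite_over_def by (rule LeastI_ex)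

lemma rdim_additive:
  assumes "subspace W" "subspace V'" "subspace U" "W \<subseteq> V'" "V' \<subseteq> U" "finite_over W U"
  shows "finite_over W V'" "finite_over V' U" "rdim W U = rdim W V' + rdim V' U"
proof -
  obtain p q where pq: "p + q \<le> rdim W U" "generated_over W V' p" "generated_over V' U q"
    using generated_over_split[OF generated_over_rdim assms(1-5)] assms(6) by blast
  show f: "finite_over W V'" "finite_over V' U" using pq unfolding finite_over_def by blast+
  have "rdim W U \<le> rdim W V' + rdim V' U"
    using generated_over_trans[OF generated_over_rdim generated_over_rdim] f rdim_le assms(1) subspace_mem
    by blast
  then show "rdim W U = rdim W V' + rdim V' U"
    using pq rdim_le[OF pq(2)] rdim_le[OF pq(3)] by linarith
qed

lemma rdim_antimono:
  assumes "finite_over W U" "W \<subseteq> W'"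
  shows "finite_over W' U" "rdim W' U \<le> rdim W U"
  using generated_over_mono[OF generated_over_rdim[OF assms(1)] assms(2) order_refl order_refl]
  by (auto simp: finite_over_def intro: rdim_le)

text \<open>Descending chain condition above a subspace of finite codimension: the dimensions
  \<open>dim (C n) / W\<close> are natural numbers and cannot decrease forever.\<close>

lemma finite_over_decseq_stable:
  assumes W: "subspace W" and C: "\<And>n. subspace (C n)" "\<And>n. C (Suc n) \<subseteq> C n"
    and WC: "\<And>n. W \<subseteq> C n" and fin: "finite_over W (carrier V)"
  shows "\<exists>N. \<forall>n\<ge>N. C n = C N"
proof -
  have anti: "C n \<subseteq> C m" if "m \<le> n" for m n
    using lift_Suc_antimono_le[of C, OF C(2) that] .
  have finC: "finite_over W (C n)" for n
    using rdim_additive(1)[OF W C(1) subspace_carrier WC _ fin, of n] C(1) subspace_mem by blast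
  obtain N where N: "\<forall>n. rdim W (C N) \<le> rdim W (C n)"
    by (metis ex_has_least_nat[of "\<lambda>_. True" _ "\<lambda>n. rdim W (C n)"])
  have "C n = C N" if "n \<ge> N" for n
  proof -
    have "rdim W (C N) = rdim W (C n) + rdim (C n) (C N)" "finite_over (C n) (C N)"
      using rdim_additive[OF W C(1) C(1) WC anti[OF that] finC] by auto
    moreover from this have "rdim (C n) (C N) = 0" using N by (metis add_le_same_cancel1 le_zero_eq)
    ultimately have "C N \<subseteq> C n" using generated_over_rdim generated_over_0[OF C(1)] by metis
    then show ?thesis using anti[OF that] by blast
  qed
  then show ?thesis by blast
qed

definition linear :: "('v \<Rightarrow> 'v) \<Rightarrow> bool"
  where "linear f \<longleftrightarrow> f \<in> carrier V \<rightarrow> carrier V \<and>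
    (\<forall>x\<in>carrier V. \<forall>y\<in>carrier V. f (x \<oplus> y) = f x \<oplus> f y) \<and>
    (\<forall>c\<in>carrier K. \<forall>x\<in>carrier V. f (c \<odot> x) = c \<odot> f x)"

lemma linear_mem: "linear f \<Longrightarrow> x \<in> carrier V \<Longrightarrow> f x \<in> carrier V"
  unfolding linear_def by blast

lemma linear_add: "\<lbrakk>linear f; x \<in> carrier V; y \<in> carrier V\<rbrakk> \<Longrightarrow> f (x \<oplus> y) = f x \<oplus> f y"
  unfolding linear_def by blast

lemma linear_smult: "\<lbrakk>linear f; c \<in> carrier K; x \<in> carrier V\<rbrakk> \<Longrightarrow> f (c \<odot> x) = c \<odot> f x"
  unfolding linear_def by blast

lemma linear_zero:
  assumes "linear f" shows "f \<zero> = \<zero>"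
proof -
  have "f \<zero> = f (\<zero>\<^bsub>K\<^esub> \<odot> \<zero>)" by simp
  also have "\<dots> = \<zero>\<^bsub>K\<^esub> \<odot> f \<zero>" using linear_smult[OF assms R.zero_closed M.zero_closed] .
  also have "\<dots> = \<zero>" using linear_mem[OF assms M.zero_closed] by simp
  finally show ?thesis .
qed

lemma linear_vimage:
  assumes "linear f" "subspace U"
  shows "subspace {x \<in> carrier V. f x \<in> U}"
  by (rule subspaceI)
    (use assms in \<open>auto simp: linear_add linear_smult linear_zero subspace_zero subspace_add subspace_smult\<close>)

lemma linear_image:
  assumes "linear f" "subspace U"
  shows "subspace (f ` U)"
proof (rule subspaceI)
  have m: "x \<in> U \<Longrightarrow> x \<in> carrier V" for x using subspace_mem[OF assms(2)] .
  show "f ` U \<subseteq> carrier V" using linear_mem[OF assms(1)] m by blast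
  show "\<zero> \<in> f ` U" by (metis assms imageI linear_zero subspace_zero)
  fix x y assume "x \<in> f ` U" "y \<in> f ` U"
  then show "x \<oplus> y \<in> f ` U"
    using linear_add[OF assms(1)] m subspace_add[OF assms(2)] by (smt (verit) image_iff)
next
  have m: "x \<in> U \<Longrightarrow> x \<in> carrier V" for x using subspace_mem[OF assms(2)] .
  fix c x assume "c \<in> carrier K" "x \<in> f ` U"
  then show "c \<odot> x \<in> f ` U"
    using linear_smult[OF assms(1)] m subspace_smult[OF assms(2)] by (smt (verit) image_iff)
qed

lemma linear_image_lspan:
  assumes f: "linear f" and S: "S \<subseteq> carrier V"
  shows "f ` lspan S \<subseteq> lspan (f ` S)"
proof -
  have "subspace (lspan (f ` S))"
    using S linear_mem[OF f] by (intro subspace_lspan) blast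
  then have "lspan S \<subseteq> {x \<in> carrier V. f x \<in> lspan (f ` S)}"
    using S by (intro lspan_minimal linear_vimage[OF f]) (auto simp: hull_inc)
  then show ?thesis by blast
qed

text \<open>Upper bounds for dimensions come from here: if \<open>U'\<close> is spanned modulo \<open>W'\<close> by images of the
  \<open>U i\<close>, and the maps send \<open>W i\<close> into \<open>W'\<close>, then \<open>dim U'/W'\<close> is at most the sum of the \<open>dim U i/W i\<close>.\<close>

lemma generated_over_UN_image:
  assumes fin: "finite Y" and f: "\<And>i. i \<in> Y \<Longrightarrow> linear (f i)"
    and gen: "\<And>i. i \<in> Y \<Longrightarrow> generated_over (W i) (U i) (n i)"
    and WV: "\<And>i. i \<in> Y \<Longrightarrow> W i \<subseteq> carrier V"
    and fW: "\<And>i. i \<in> Y \<Longrightarrow> f i ` W i \<subseteq> W'" and W': "subspace W'"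
    and U': "U' \<subseteq> lspan (W' \<union> (\<Union>i\<in>Y. f i ` U i))"
  shows "generated_over W' U' (\<Sum>i\<in>Y. n i)"
proof -
  have "\<forall>i\<in>Y. \<exists>B. finite B \<and> B \<subseteq> carrier V \<and> card B \<le> n i \<and> U i \<subseteq> lspan (W i \<union> B)"
    using gen unfolding generated_over_def by blast
  then obtain B where B: "\<And>i. i \<in> Y \<Longrightarrow> finite (B i)" "\<And>i. i \<in> Y \<Longrightarrow> B i \<subseteq> carrier V"
    "\<And>i. i \<in> Y \<Longrightarrow> card (B i) \<le> n i" "\<And>i. i \<in> Y \<Longrightarrow> U i \<subseteq> lspan (W i \<union> B i)"
    by metis
  define C where "C = (\<Union>i\<in>Y. f i ` B i)"
  have CV: "C \<subseteq> carrier V" unfolding C_def using B(2) f linear_mem by blast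
  have WC: "W' \<union> C \<subseteq> carrier V" using CV W' subspace_mem by blast
  have "card C \<le> (\<Sum>i\<in>Y. card (f i ` B i))"
    unfolding C_def by (rule card_UN_le[OF fin])
  also have "\<dots> \<le> (\<Sum>i\<in>Y. n i)"
    by (rule sum_mono) (meson B(1,3) card_image_le order_trans)
  finally have card: "card C \<le> (\<Sum>i\<in>Y. n i)" .
  have "f i ` U i \<subseteq> lspan (W' \<union> C)" if i: "i \<in> Y" for i
  proof -
    have "f i ` U i \<subseteq> f i ` lspan (W i \<union> B i)" using B(4)[OF i] by blast
    also have "\<dots> \<subseteq> lspan (f i ` (W i \<union> B i))"
      by (rule linear_image_lspan[OF f[OF i]]) (use WV[OF i] B(2)[OF i] in auto)
    also have "\<dots> \<subseteq> lspan (W' \<union> C)"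
      by (rule hull_mono) (use fW[OF i] i in \<open>auto simp: C_def\<close>)
    finally show ?thesis .
  qed
  then have "lspan (W' \<union> (\<Union>i\<in>Y. f i ` U i)) \<subseteq> lspan (W' \<union> C)"
    by (intro lspan_le[OF _ WC]) (auto simp: hull_inc)
  then have "U' \<subseteq> lspan (W' \<union> C)" using U' by blast
  moreover have "finite C" unfolding C_def using fin B(1) by blast
  ultimately show ?thesis unfolding generated_over_def using card CV by blast
qed

text \<open>Lower bounds for dimensions come from here: \<open>(W' + f U)/W'\<close> is the quotient of \<open>U\<close> by
  the preimage of \<open>W'\<close>, and this preimage is contained in \<open>W\<close>. So generators of \<open>W' + f U\<close> over \<open>W'\<close>, lifted
  along \<open>f\<close>, generate \<open>U\<close> over \<open>W\<close>.\<close>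

lemma generated_over_vimage:
  assumes f: "linear f" and gen: "generated_over W' (W' <+>\<^bsub>V\<^esub> f ` U) n"
    and W: "subspace W" "W \<subseteq> U" and U: "subspace U" and W': "subspace W'"
    and inj: "\<And>x. \<lbrakk>x \<in> U; f x \<in> W'\<rbrakk> \<Longrightarrow> x \<in> W"
  shows "generated_over W U n"
proof -
  have "subspace (f ` U)" by (rule linear_image[OF f U])
  then have "subspace (W' <+>\<^bsub>V\<^esub> f ` U)" "W' \<subseteq> W' <+>\<^bsub>V\<^esub> f ` U"
    using subspace_set_add[OF W'] set_add_upper1[OF W'] by blast+
  then have "\<exists>B. finite B \<and> B \<subseteq> W' <+>\<^bsub>V\<^esub> f ` U \<and> card B \<le> n \<and> W' <+>\<^bsub>V\<^esub> f ` U \<subseteq> lspan (W' \<union> B)"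
    by (rule generated_over_inside[OF gen W'])
  then obtain B where B: "finite B" "B \<subseteq> W' <+>\<^bsub>V\<^esub> f ` U" "card B \<le> n" "W' <+>\<^bsub>V\<^esub> f ` U \<subseteq> lspan (W' \<union> B)"
    by blast
  have "\<forall>b\<in>B. \<exists>u. u \<in> U \<and> (\<exists>w\<in>W'. b = w \<oplus> f u)"
    using B(2) unfolding set_add_mem subset_iff by blast
  then obtain g where g: "\<And>b. b \<in> B \<Longrightarrow> g b \<in> U" "\<And>b. b \<in> B \<Longrightarrow> \<exists>w\<in>W'. b = w \<oplus> f (g b)"
    using bchoice[of B "\<lambda>b u. u \<in> U \<and> (\<exists>w\<in>W'. b = w \<oplus> f u)"] by blast
  define X where "X = lspan (W \<union> g ` B)"
  have X: "subspace X"
    unfolding X_def using W U g(1) subspace_mem by (intro subspace_lspan) blast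
  have XU: "X \<subseteq> U" unfolding X_def using W U g(1) by (intro lspan_minimal) auto
  have fX: "subspace (W' <+>\<^bsub>V\<^esub> f ` X)" by (rule subspace_set_add[OF W' linear_image[OF f X]])
  have "B \<subseteq> W' <+>\<^bsub>V\<^esub> f ` X"
  proof
    fix b assume b: "b \<in> B"
    then have "f (g b) \<in> f ` X" unfolding X_def by (simp add: hull_inc)
    then show "b \<in> W' <+>\<^bsub>V\<^esub> f ` X" unfolding set_add_mem using g(2)[OF b] by blast
  qed
  then have "lspan (W' \<union> B) \<subseteq> W' <+>\<^bsub>V\<^esub> f ` X"
    using set_add_upper1[OF W' linear_image[OF f X]] by (intro lspan_minimal fX) auto
  then have *: "f ` U \<subseteq> W' <+>\<^bsub>V\<^esub> f ` X"
    using B(4) set_add_upper2[OF W' \<open>subspace (f ` U)\<close>] by blast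
  have "U \<subseteq> X"
  proof
    fix u assume u: "u \<in> U"
    then have "f u \<in> W' <+>\<^bsub>V\<^esub> f ` X" using * by blast
    then obtain w x where wx: "w \<in> W'" "x \<in> X" "f u = w \<oplus> f x"
      unfolding set_add_mem by blast
    have c: "u \<in> carrier V" "x \<in> carrier V" "w \<in> carrier V"
      using u wx subspace_mem[OF X] subspace_mem[OF U] subspace_mem[OF W'] by simp_all
    have "f u = f (u \<ominus> x) \<oplus> f x"
      using linear_add[OF f, of "u \<ominus> x" x] c by (simp add: M.minus_eq M.add.m_assoc M.l_neg)
    then have "f (u \<ominus> x) = w"
      using wx(3) c linear_mem[OF f] by simp
    moreover have "u \<ominus> x \<in> U" using wx(2) XU u by (auto intro: subspace_minus[OF U])
    ultimately have "u \<ominus> x \<in> W"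
      using inj[of "u \<ominus> x"] wx(1) by simp
    then have "u \<ominus> x \<in> X" unfolding X_def by (simp add: hull_inc)
    moreover have "u = (u \<ominus> x) \<oplus> x"
      using c by (simp add: M.minus_eq M.add.m_assoc M.l_neg)
    ultimately show "u \<in> X" using subspace_add[OF X _ wx(2), of "u \<ominus> x"] by simp
  qed
  moreover have "card (g ` B) \<le> n" using B card_image_le le_trans by blast
  moreover have "finite (g ` B)" "g ` B \<subseteq> carrier V" using B(1) g(1) subspace_mem[OF U] by auto
  ultimately show ?thesis
    unfolding generated_over_def X_def by blast
qed

end


section \<open>Subquotients\<close>

text \<open>A sum of cosets is shown to lie in a subspace by closing the set of those cosets under addition,
  without computing the sum.\<close>

lemma (in abelian_monoid) finsum_mem:
  assumes "f \<in> A \<rightarrow> H" "\<zero> \<in> H" "\<And>x y. \<lbrakk>x \<in> H; y \<in> H\<rbrakk> \<Longrightarrow> x \<oplus> y \<in> H" "H \<subseteq> carrier G"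
  shows "finsum G f A \<in> H"
  using assms(1)
proof (induction A rule: infinite_finite_induct)
  case (insert x A)
  then have "f \<in> A \<rightarrow> carrier G" "f x \<in> carrier G" using assms(4) by auto
  then show ?case using insert assms(3) by (simp add: finsum_insert)
qed (use assms(2) in \<open>auto simp: finsum_infinite\<close>)

lemma (in abelian_group) subquotient_abelian_group:
  assumes V: "additive_subgroup V G" and W: "additive_subgroup W G" and WV: "W \<subseteq> V"
  shows "abelian_group (subquotient G V W act)"
proof -
  interpret W: abelian_subgroup W G
    by (rule abelian_subgroupI3[OF W]) (rule abelian_group_axioms)
  interpret V: additive_subgroup V G by fact
  have sum: "(W +> x) <+>\<^bsub>G\<^esub> (W +> y) = W +> (x \<oplus> y)" if "x \<in> V" "y \<in> V" for x y
    using that W.a_rcos_sum by simp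
  have zero: "W = W +> \<zero>" using a_coset_add_zero W.a_subset by simp
  let ?Q = "subquotient G V W act"
  have eqs: "carrier ?Q = (\<lambda>x. W +> x) ` V" "\<And>X Y. X \<oplus>\<^bsub>?Q\<^esub> Y = X <+>\<^bsub>G\<^esub> Y" "\<zero>\<^bsub>?Q\<^esub> = W"
    by (simp_all add: subquotient_def)
  show ?thesis
  proof (rule abelian_groupI)
    show "\<zero>\<^bsub>?Q\<^esub> \<in> carrier ?Q" unfolding eqs using zero V.zero_closed by blast
    fix X Y Z assume "X \<in> carrier ?Q" "Y \<in> carrier ?Q"
    then obtain x y where v: "x \<in> V" "y \<in> V" "X = W +> x" "Y = W +> y" unfolding eqs by blast
    then show "X \<oplus>\<^bsub>?Q\<^esub> Y \<in> carrier ?Q" by (simp add: eqs sum)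
    show "X \<oplus>\<^bsub>?Q\<^esub> Y = Y \<oplus>\<^bsub>?Q\<^esub> X" using v by (simp add: eqs sum a_comm)
    assume "Z \<in> carrier ?Q"
    then obtain z where z: "z \<in> V" "Z = W +> z" unfolding eqs by blast
    then show "X \<oplus>\<^bsub>?Q\<^esub> Y \<oplus>\<^bsub>?Q\<^esub> Z = X \<oplus>\<^bsub>?Q\<^esub> (Y \<oplus>\<^bsub>?Q\<^esub> Z)"
      using v by (simp add: eqs sum a_assoc)
  next
    fix X assume "X \<in> carrier ?Q"
    then obtain x where v: "x \<in> V" "X = W +> x" unfolding eqs by blast
    then show "\<zero>\<^bsub>?Q\<^esub> \<oplus>\<^bsub>?Q\<^esub> X = X"
      using sum[of \<zero> x] zero by (simp add: eqs)
    have "(W +> \<ominus> x) \<oplus>\<^bsub>?Q\<^esub> X = \<zero>\<^bsub>?Q\<^esub>"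
      using v sum[of "\<ominus> x" x] zero by (simp add: eqs l_neg)
    then show "\<exists>Y\<in>carrier ?Q. Y \<oplus>\<^bsub>?Q\<^esub> X = \<zero>\<^bsub>?Q\<^esub>"
      using v V.a_inv_closed unfolding eqs(1) by blast
  qed
qed

context vector_space_over
begin

lemma subspace_additive_subgroup: "subspace U \<Longrightarrow> additive_subgroup U V"
  by (simp add: additive_subgroup.intro submodule.axioms(1))

lemma coset_mem: "y \<in> W +> x \<longleftrightarrow> (\<exists>w\<in>W. y = w \<oplus> x)"
  by (auto simp: a_r_coset_def')

lemma coset_subset:
  assumes "subspace L" "W \<subseteq> L" "x \<in> L"
  shows "W +> x \<subseteq> L"
  using assms subspace_add[OF assms(1) subsetD[OF assms(2)] assms(3)] by (auto simp: coset_mem)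

lemma coset_eq:
  assumes W: "subspace W" and xy: "x \<in> carrier V" "y \<in> carrier V" and d: "x \<ominus> y \<in> W"
  shows "W +> x = W +> y"
proof -
  interpret W: abelian_subgroup W V
    by (rule abelian_subgroupI3[OF subspace_additive_subgroup[OF W]]) (rule M.abelian_group_axioms)
  have "x \<in> W +> y" using W.a_rcos_module_rev[OF xy(2,1)] d by (simp add: M.minus_eq)
  then show ?thesis using W.a_repr_independence'[OF _ xy(2)] by simp
qed

lemma coset_self: "subspace W \<Longrightarrow> x \<in> carrier V \<Longrightarrow> x \<in> W +> x"
  unfolding coset_mem by (intro bexI[of _ \<zero>]) (simp_all add: subspace_zero)

lemma finite_over_if_finite_dimensional:
  assumes fd: "finite_dimensional K (quotient_space V U W)"
    and W: "subspace W" and U: "subspace U" and WU: "W \<subseteq> U"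
  shows "finite_over W U"
proof -
  let ?Q = "quotient_space V U W"
  obtain B where fB: "finite B \<and> B \<subseteq> carrier ?Q \<and>
      (\<forall>X\<in>carrier ?Q. \<exists>c \<in> B \<rightarrow> carrier K. X = (\<Oplus>\<^bsub>?Q\<^esub>b\<in>B. c b \<odot>\<^bsub>?Q\<^esub> b))"
    using fd unfolding finite_dimensional_def ..
  note B = fB[THEN conjunct1] fB[THEN conjunct2, THEN conjunct1] fB[THEN conjunct2, THEN conjunct2, rule_format]
  interpret Q: abelian_group ?Q
    unfolding quotient_space_def
    by (rule M.subquotient_abelian_group) (use W U WU subspace_additive_subgroup in auto)
  have carQ: "carrier ?Q = (\<lambda>x. W +> x) ` U"
    and addQ: "add ?Q = set_add V" and zeroQ: "zero ?Q = W"
    and smQ: "smult ?Q = (\<lambda>a X. \<Union>x\<in>X. W +> (a \<odot> x))"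
    unfolding quotient_space_def subquotient_def by simp_all
  have "\<forall>b\<in>B. \<exists>u. u \<in> U \<and> b = W +> u" using B(2) unfolding carQ by blast
  from bchoice[OF this] obtain r where rr: "\<forall>b\<in>B. r b \<in> U \<and> b = W +> r b" ..
  have r: "r b \<in> U" "b = W +> r b" if "b \<in> B" for b
    by (rule rr[rule_format, OF that, THEN conjunct1], rule rr[rule_format, OF that, THEN conjunct2])
  define L where "L = lspan (W \<union> r ` B)"
  have L: "subspace L"
    unfolding L_def using subspace_mem[OF U] r(1) WU by (intro subspace_lspan) blast
  have WL: "W \<subseteq> L" unfolding L_def by (simp add: hull_inc subset_iff)
  define H where "H = {X \<in> carrier ?Q. X \<subseteq> L}"
  have "U \<subseteq> L"
  proof
    fix x assume x: "x \<in> U"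
    then have xc: "x \<in> carrier V" using subspace_mem[OF U] by simp
    have "W +> x \<in> carrier ?Q" unfolding carQ using x by blast
    from B(3)[OF this]
    obtain c where c: "c \<in> B \<rightarrow> carrier K" "W +> x = (\<Oplus>\<^bsub>?Q\<^esub>b\<in>B. c b \<odot>\<^bsub>?Q\<^esub> b)" ..
    have "(\<Oplus>\<^bsub>?Q\<^esub>b\<in>B. c b \<odot>\<^bsub>?Q\<^esub> b) \<in> H"
    proof (rule Q.finsum_mem)
      show "(\<lambda>b. c b \<odot>\<^bsub>?Q\<^esub> b) \<in> B \<rightarrow> H"
      proof
        fix b assume b: "b \<in> B"
        have cb: "c b \<in> carrier K" using c b by blast
        have rc: "r b \<in> carrier V" using subspace_mem[OF U] r(1) b by simp
        have "W +> (c b \<odot> y) = W +> (c b \<odot> r b)" if y: "y \<in> b" for y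
        proof -
          have "y \<in> W +> r b" using y r(2)[OF b] by simp
          then obtain w where w: "w \<in> W" "y = w \<oplus> r b" unfolding coset_mem ..
          have wc: "w \<in> carrier V" using w subspace_mem[OF W] by simp
          have "c b \<odot> y \<ominus> c b \<odot> r b = c b \<odot> w"
            using w wc cb rc by (simp add: smult_r_distr M.minus_eq M.a_assoc M.r_neg)
          then show ?thesis
            using coset_eq[OF W, of "c b \<odot> y" "c b \<odot> r b"] w wc cb rc subspace_smult[OF W cb w(1)] by simp
        qed
        moreover have "b \<noteq> {}" using r(2)[OF b] coset_self[OF W rc] by auto
        ultimately have eq: "c b \<odot>\<^bsub>?Q\<^esub> b = W +> (c b \<odot> r b)" unfolding smQ by blast
        have "r b \<in> L" unfolding L_def using b by (simp add: hull_inc)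
        then have "c b \<odot> r b \<in> L" "c b \<odot> r b \<in> U"
          using subspace_smult[OF L cb] subspace_smult[OF U cb] r(1)[OF b] by auto
        then show "c b \<odot>\<^bsub>?Q\<^esub> b \<in> H"
          unfolding H_def eq carQ using coset_subset[OF L WL] by blast
      qed
      show "\<zero>\<^bsub>?Q\<^esub> \<in> H" unfolding H_def using WL zeroQ Q.zero_closed by simp
      show "H \<subseteq> carrier ?Q" unfolding H_def by blast
      fix X Y assume "X \<in> H" "Y \<in> H"
      then show "X \<oplus>\<^bsub>?Q\<^esub> Y \<in> H"
        unfolding H_def using Q.a_closed set_add_least[OF L] by (auto simp: addQ)
    qed
    then have "W +> x \<subseteq> L" unfolding H_def c(2) by blast
    then show "x \<in> L" using coset_self[OF W xc] by blast
  qed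
  moreover have "r ` B \<subseteq> carrier V" using r(1) subspace_mem[OF U] by blast
  ultimately show ?thesis
    unfolding finite_over_def generated_over_def L_def using B(1) by blast
qed

text \<open>Valid for every scalar action \<open>act\<close>, and therefore for the left and the right module structure
  on \<open>U/W\<close> alike.\<close>

lemma finsum_cosets:
  assumes W: "subspace W" and U: "subspace U" and WU: "W \<subseteq> U" and Y: "finite Y" "\<And>i. i \<in> Y \<Longrightarrow> y i \<in> U"
  shows "(\<Oplus>\<^bsub>subquotient V U W act\<^esub>i\<in>Y. W +> y i) = W +> (\<Oplus>i\<in>Y. y i)"
proof -
  let ?Q = "subquotient V U W act"
  interpret Q: abelian_group ?Q
    by (rule M.subquotient_abelian_group) (use W U WU subspace_additive_subgroup in auto)
  interpret W: abelian_subgroup W V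
    by (rule abelian_subgroupI3[OF subspace_additive_subgroup[OF W]]) (rule M.abelian_group_axioms)
  have eqs: "carrier ?Q = (\<lambda>x. W +> x) ` U" "\<And>X Y. X \<oplus>\<^bsub>?Q\<^esub> Y = X <+>\<^bsub>V\<^esub> Y" "\<zero>\<^bsub>?Q\<^esub> = W"
    by (simp_all add: subquotient_def)
  show ?thesis
    using Y
  proof (induction Y rule: finite_induct)
    case empty
    have "W +> \<zero> = W" using M.a_coset_add_zero W.a_subset by simp
    then show ?case by (simp add: eqs(3) Q.finsum_empty M.finsum_empty)
  next
    case (insert i Y)
    have c: "y j \<in> carrier V" if "j \<in> insert i Y" for j using insert.prems[OF that] subspace_mem[OF U] by simp
    have Qc: "W +> y j \<in> carrier ?Q" if "j \<in> insert i Y" for j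
      using insert.prems[OF that] unfolding eqs(1) by simp
    have "(\<Oplus>\<^bsub>?Q\<^esub>j\<in>insert i Y. W +> y j) = (W +> y i) \<oplus>\<^bsub>?Q\<^esub> (\<Oplus>\<^bsub>?Q\<^esub>j\<in>Y. W +> y j)"
      by (rule Q.finsum_insert) (use insert.hyps Qc in auto)
    also have "\<dots> = (W +> y i) <+>\<^bsub>V\<^esub> (W +> (\<Oplus>j\<in>Y. y j))"
      using insert by (simp add: eqs(2))
    also have "\<dots> = W +> (y i \<oplus> (\<Oplus>j\<in>Y. y j))"
      by (rule W.a_rcos_sum) (use c in \<open>auto intro: M.finsum_closed\<close>)
    also have "y i \<oplus> (\<Oplus>j\<in>Y. y j) = (\<Oplus>j\<in>insert i Y. y j)"
      by (rule M.finsum_insert[symmetric]) (use insert.hyps c in auto)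
    finally show ?case .
  qed
qed

text \<open>Passing from a basis of \<open>U/W\<close> to generators of \<open>U\<close> over \<open>W\<close>. The action enters only through
  representatives \<open>f i r\<close> of the multiples of the \<open>i\<close>-th basis vector, so that \<open>f i r = r g\<^sub>i\<close> covers
  left modules and \<open>f i r = g\<^sub>i r\<close> right modules.\<close>

lemma basis_spans:
  assumes W: "subspace W" and U: "subspace U" and WU: "W \<subseteq> U"
    and basis: "is_basis A (subquotient V U W act) n e"
    and f: "\<And>i a. \<lbrakk>i < n; a \<in> carrier A\<rbrakk> \<Longrightarrow> \<exists>r\<in>S. act a (e i) = W +> f i r"
    and fU: "\<And>i r. \<lbrakk>i < n; r \<in> S\<rbrakk> \<Longrightarrow> f i r \<in> U"
  shows "U \<subseteq> lspan (W \<union> (\<Union>i<n. f i ` S))"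
proof
  let ?Q = "subquotient V U W act" and ?L = "lspan (W \<union> (\<Union>i<n. f i ` S))"
  interpret Q: abelian_group ?Q
    by (rule M.subquotient_abelian_group) (use W U WU subspace_additive_subgroup in auto)
  have eqs: "carrier ?Q = (\<lambda>x. W +> x) ` U" "\<And>X Y. X \<oplus>\<^bsub>?Q\<^esub> Y = X <+>\<^bsub>V\<^esub> Y" "\<zero>\<^bsub>?Q\<^esub> = W"
    "smult ?Q = act"
    by (simp_all add: subquotient_def)
  have "W \<union> (\<Union>i<n. f i ` S) \<subseteq> carrier V" using subspace_mem[OF U] WU fU by auto
  then have L: "subspace ?L" by (rule subspace_lspan)
  have WL: "W \<subseteq> ?L" by (simp add: hull_inc subset_iff)
  fix x assume x: "x \<in> U"
  then have "W +> x \<in> carrier ?Q" unfolding eqs by blast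
  then have "\<exists>!c. c \<in> {..<n} \<rightarrow>\<^sub>E carrier A \<and> W +> x = (\<Oplus>\<^bsub>?Q\<^esub>i\<in>{..<n}. c i \<odot>\<^bsub>?Q\<^esub> e i)"
    using basis unfolding is_basis_def by simp
  then obtain c where c: "c \<in> {..<n} \<rightarrow>\<^sub>E carrier A" "W +> x = (\<Oplus>\<^bsub>?Q\<^esub>i\<in>{..<n}. c i \<odot>\<^bsub>?Q\<^esub> e i)"
    by (elim ex1E conjE)
  let ?H = "{X \<in> carrier ?Q. X \<subseteq> ?L}"
  have "(\<Oplus>\<^bsub>?Q\<^esub>i\<in>{..<n}. c i \<odot>\<^bsub>?Q\<^esub> e i) \<in> ?H"
  proof (rule Q.finsum_mem)
    show "(\<lambda>i. c i \<odot>\<^bsub>?Q\<^esub> e i) \<in> {..<n} \<rightarrow> ?H"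
    proof
      fix i assume i: "i \<in> {..<n}"
      then obtain r where r: "r \<in> S" "act (c i) (e i) = W +> f i r" using f[of i "c i"] c(1) by auto
      have "f i r \<in> ?L" using i r(1) by (intro hull_inc) auto
      then have "W +> f i r \<subseteq> ?L" by (rule coset_subset[OF L WL])
      then show "c i \<odot>\<^bsub>?Q\<^esub> e i \<in> ?H" unfolding eqs(1,4) r(2) using fU[of i r] i r(1) by auto
    qed
    show "\<zero>\<^bsub>?Q\<^esub> \<in> ?H" using Q.zero_closed WL by (simp add: eqs(3))
    show "?H \<subseteq> carrier ?Q" by blast
    fix X Y assume "X \<in> ?H" "Y \<in> ?H"
    then show "X \<oplus>\<^bsub>?Q\<^esub> Y \<in> ?H" using Q.a_closed set_add_least[OF L] by (auto simp: eqs(2))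
  qed
  then have "W +> x \<subseteq> ?L" unfolding c(2) by simp
  then show "x \<in> ?L" using coset_self[OF W subspace_mem[OF U x]] by blast
qed

end


section \<open>Right ideals\<close>

locale algebra_over = vector_space_over K R + assoc_algebra K R
  for K :: "('k, 'c) ring_scheme" and R :: "('k, 'a, 'd) module_scheme" (structure)
begin

text \<open>Right ideals are subspaces because \<open>c x = x (c 1)\<close>.\<close>

lemma right_idealD:
  assumes "right_ideal J R"
  shows "subspace J" "\<And>x a. \<lbrakk>x \<in> J; a \<in> carrier R\<rbrakk> \<Longrightarrow> x \<otimes> a \<in> J"
proof -
  show *: "\<And>x a. \<lbrakk>x \<in> J; a \<in> carrier R\<rbrakk> \<Longrightarrow> x \<otimes> a \<in> J"
    using assms unfolding right_ideal_def by blast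
  interpret J: additive_subgroup J R using assms unfolding right_ideal_def by blast
  show "subspace J"
  proof (rule subspaceI)
    fix c x assume "c \<in> carrier K" "x \<in> J"
    moreover from this have "x \<otimes> (c \<odot> \<one>) = c \<odot> x" by (simp add: smult_mult_right)
    ultimately show "c \<odot> x \<in> J" using *[of x "c \<odot> \<one>"] by simp
  qed (use J.a_subset in auto)
qed

lemma right_idealI:
  "\<lbrakk>subspace J; \<And>x a. \<lbrakk>x \<in> J; a \<in> carrier R\<rbrakk> \<Longrightarrow> x \<otimes> a \<in> J\<rbrakk> \<Longrightarrow> right_ideal J R"
  unfolding right_ideal_def using subspace_additive_subgroup by blast

lemma linear_mult_left: "a \<in> carrier R \<Longrightarrow> linear (\<lambda>x. a \<otimes> x)"
  unfolding linear_def by (auto simp: r_distr smult_mult_right)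

lemma linear_mult_right: "a \<in> carrier R \<Longrightarrow> linear (\<lambda>x. x \<otimes> a)"
  unfolding linear_def by (auto simp: l_distr smult_mult_left)

text \<open>Well-definedness of the product of cosets, in a form that covers the two actions of \<open>R/I\<close> on
  \<open>J2/J1\<close> as well as the multiplication of the associated graded ring.\<close>

lemma rcoset_mult_cosets:
  assumes A: "subspace A" and B: "subspace B" and W: "subspace W"
    and x: "x \<in> carrier R" and y: "y \<in> carrier R"
    and left: "\<And>a v. \<lbrakk>a \<in> A; v \<in> B +> y\<rbrakk> \<Longrightarrow> a \<otimes> v \<in> W"
    and right: "\<And>b. b \<in> B \<Longrightarrow> x \<otimes> b \<in> W"
  shows "rcoset_mult R W (A +> x) (B +> y) = W +> (x \<otimes> y)"
proof -
  have eq: "W +> (u \<otimes> v) = W +> (x \<otimes> y)" if u: "u \<in> A +> x" and v: "v \<in> B +> y" for u v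
  proof -
    obtain a where a: "a \<in> A" "u = a \<oplus> x" using u unfolding coset_mem by blast
    obtain b where b: "b \<in> B" "v = b \<oplus> y" using v unfolding coset_mem by blast
    have car: "a \<in> carrier R" "b \<in> carrier R" using a b subspace_mem[OF A] subspace_mem[OF B] by auto
    have "u \<otimes> v = a \<otimes> v \<oplus> x \<otimes> v" unfolding a(2) using car b(2) x y by (intro l_distr) simp_all
    also have "x \<otimes> v = x \<otimes> b \<oplus> x \<otimes> y" unfolding b(2) using car x y by (intro r_distr)
    finally have "u \<otimes> v = (a \<otimes> v \<oplus> x \<otimes> b) \<oplus> x \<otimes> y" using car b(2) x y by (simp add: M.a_assoc)
    moreover have "(z \<oplus> x \<otimes> y) \<ominus> x \<otimes> y = z" if "z \<in> carrier R" for z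
      using x y that by (simp add: M.minus_eq M.a_assoc M.r_neg)
    moreover have "a \<otimes> v \<oplus> x \<otimes> b \<in> W"
      using left[OF a(1) v] right[OF b(1)] by (rule subspace_add[OF W])
    ultimately have "u \<otimes> v \<ominus> x \<otimes> y \<in> W" using subspace_mem[OF W] by simp
    then show ?thesis using coset_eq[OF W] car a(2) b(2) x y by simp
  qed
  have "x \<in> A +> x" "y \<in> B +> y" using coset_self[OF A x] coset_self[OF B y] .
  then show ?thesis unfolding rcoset_mult_def using eq by blast
qed

lemma right_ideal_set_add:
  assumes "right_ideal X R" "right_ideal Y R"
  shows "right_ideal (X <+>\<^bsub>R\<^esub> Y) R"
proof (rule right_idealI)
  show "subspace (X <+>\<^bsub>R\<^esub> Y)" by (intro subspace_set_add right_idealD(1) assms)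
  fix z a assume "z \<in> X <+>\<^bsub>R\<^esub> Y" "a \<in> carrier R"
  moreover from this obtain x y where "x \<in> X" "y \<in> Y" "z = x \<oplus> y" unfolding set_add_mem by blast
  moreover from this have "x \<in> carrier R" "y \<in> carrier R"
    using assms right_idealD(1) subspace_mem by blast+
  ultimately show "z \<otimes> a \<in> X <+>\<^bsub>R\<^esub> Y"
    unfolding set_add_mem using right_idealD(2)[OF assms(1)] right_idealD(2)[OF assms(2)]
    by (metis l_distr)
qed

lemma right_ideal_lspan:
  assumes S: "S \<subseteq> carrier R" and mult: "\<And>x a. \<lbrakk>x \<in> S; a \<in> carrier R\<rbrakk> \<Longrightarrow> x \<otimes> a \<in> lspan S"
  shows "right_ideal (lspan S) R"
proof (rule right_idealI)
  show sp: "subspace (lspan S)" by (rule subspace_lspan[OF S])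
  fix x a assume x: "x \<in> lspan S" and a: "a \<in> carrier R"
  have "lspan S \<subseteq> {x \<in> carrier R. x \<otimes> a \<in> lspan S}"
    using S mult a by (intro lspan_minimal linear_vimage linear_mult_right sp) auto
  then show "x \<otimes> a \<in> lspan S" using x by blast
qed

lemma right_ideal_image_mult:
  assumes "x \<in> carrier R" "right_ideal J R"
  shows "right_ideal ((\<otimes>) x ` J) R"
proof (rule right_idealI)
  show "subspace ((\<otimes>) x ` J)"
    by (rule linear_image[OF linear_mult_left right_idealD(1)]) (use assms in auto)
  fix y a assume "y \<in> (\<otimes>) x ` J" "a \<in> carrier R"
  then obtain j where j: "j \<in> J" "y = x \<otimes> j" "a \<in> carrier R" by blast
  then have "j \<in> carrier R" using assms right_idealD(1) subspace_mem by blast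
  then have "y \<otimes> a = x \<otimes> (j \<otimes> a)" using j assms(1) m_assoc by simp
  then show "y \<otimes> a \<in> (\<otimes>) x ` J" using right_idealD(2)[OF assms(2)] j by blast
qed

lemma right_ideal_carrier: "right_ideal (carrier R) R"
  by (rule right_idealI) (auto intro: subspace_carrier)

lemma right_ideal_jacobson: "right_ideal (jacobson_radical R) R"
proof -
  have "jacobson_radical R = \<Inter>(insert (carrier R) {M. maximal_right_ideal M R})"
    unfolding jacobson_radical_def by auto
  moreover have ri: "right_ideal J R" if "J \<in> insert (carrier R) {M. maximal_right_ideal M R}" for J
    using that right_ideal_carrier unfolding maximal_right_ideal_def by auto
  moreover have "subspace (\<Inter>(insert (carrier R) {M. maximal_right_ideal M R}))"
    by (rule subspace_Inter) (use ri right_idealD(1) in auto)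
  ultimately show ?thesis by (metis (no_types, lifting) InterD InterI right_idealD(2) right_idealI)
qed

text \<open>The Jacobson radical annihilates the simple right module \<open>X/Y\<close>: the annihilator of a nonzero
  element of a simple module is a maximal right ideal.\<close>

lemma jacobson_kills_simple:
  assumes X: "right_ideal X R" and Y: "right_ideal Y R" and YX: "Y \<subseteq> X"
    and max: "\<And>J. \<lbrakk>right_ideal J R; Y \<subseteq> J; J \<subseteq> X\<rbrakk> \<Longrightarrow> J = Y \<or> J = X"
    and x: "x \<in> X" and m: "m \<in> jacobson_radical R"
  shows "x \<otimes> m \<in> Y"
proof (cases "x \<in> Y")
  case True
  then show ?thesis using right_idealD(2)[OF Y] m unfolding jacobson_radical_def by blast
next
  case False
  note X' = right_idealD[OF X] and Y' = right_idealD[OF Y]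
  have xc: "x \<in> carrier R" using X'(1) x subspace_mem by blast
  define N where "N = {r \<in> carrier R. x \<otimes> r \<in> Y}"
  have N: "right_ideal N R"
  proof (rule right_idealI)
    show "subspace N" unfolding N_def by (rule linear_vimage[OF linear_mult_left[OF xc] Y'(1)])
    fix r a assume "r \<in> N" "a \<in> carrier R"
    then show "r \<otimes> a \<in> N" unfolding N_def using Y'(2) xc by (auto simp: m_assoc[symmetric])
  qed
  have "maximal_right_ideal N R"
    unfolding maximal_right_ideal_def
  proof (intro conjI N allI impI)
    have "\<one> \<notin> N" using False xc unfolding N_def by simp
    then show "N \<noteq> carrier R" by auto
    fix J assume J: "right_ideal J R" and NJ: "N \<subseteq> J"
    note J' = right_idealD[OF J]
    let ?Z = "Y <+>\<^bsub>R\<^esub> (\<otimes>) x ` J"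
    have Z: "right_ideal ?Z R" by (intro right_ideal_set_add Y right_ideal_image_mult xc J)
    have xJ: "subspace ((\<otimes>) x ` J)" by (rule right_idealD(1)[OF right_ideal_image_mult[OF xc J]])
    have ZX: "?Z \<subseteq> X"
      using YX X'(2)[OF x] subspace_mem[OF J'(1)] by (intro set_add_least[OF X'(1)]) auto
    from max[OF Z set_add_upper1[OF Y'(1) xJ] ZX] show "J = N \<or> J = carrier R"
    proof
      assume "?Z = Y"
      then have "(\<otimes>) x ` J \<subseteq> Y" using set_add_upper2[OF Y'(1) xJ] by simp
      then have "J \<subseteq> N" unfolding N_def using subspace_mem[OF J'(1)] by auto
      then show ?thesis using NJ by blast
    next
      assume "?Z = X"
      then have "x \<in> ?Z" using x by simp
      then obtain y j where yj: "y \<in> Y" "j \<in> J" "x = y \<oplus> x \<otimes> j" unfolding set_add_mem by blast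
      have c: "y \<in> carrier R" "j \<in> carrier R" using yj subspace_mem J'(1) Y'(1) by blast+
      have "x \<otimes> (\<one> \<ominus> j) = x \<ominus> x \<otimes> j"
        using xc c by (simp add: M.minus_eq r_distr r_minus)
      also have "\<dots> = (y \<oplus> x \<otimes> j) \<ominus> x \<otimes> j" using yj(3) by simp
      also have "\<dots> = y" using xc c by (simp add: M.minus_eq M.a_assoc M.r_neg)
      finally have "\<one> \<ominus> j \<in> N" unfolding N_def using yj c by simp
      then have "(\<one> \<ominus> j) \<oplus> j \<in> J" using NJ yj(2) J'(1) subspace_add by blast
      moreover have "(\<one> \<ominus> j) \<oplus> j = \<one>" using c by (simp add: M.minus_eq M.a_assoc M.l_neg)
      ultimately have "\<one> \<in> J" by simp
      then have "carrier R \<subseteq> J" using J'(2)[of \<one>] by auto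
      then show ?thesis using subspace_mem[OF J'(1)] by blast
    qed
  qed
  then have "m \<in> N" using m unfolding jacobson_radical_def by blast
  then show ?thesis unfolding N_def by blast
qed

end

locale noetherian_alg = algebra_over K R
  for K :: "('k, 'c) ring_scheme" and R :: "('k, 'a, 'd) module_scheme" (structure) +
  assumes noeth: "right_noetherian R"
begin

lemma noetherian_maximal:
  assumes ri: "\<And>J. J \<in> \<S> \<Longrightarrow> right_ideal J R" and ne: "\<S> \<noteq> {}"
  shows "\<exists>M\<in>\<S>. \<forall>J\<in>\<S>. M \<subseteq> J \<longrightarrow> J = M"
proof (rule ccontr)
  assume "\<not> ?thesis"
  then have step: "\<exists>J\<in>\<S>. M \<subset> J" if "M \<in> \<S>" for M using that by blast
  have "\<exists>f. \<forall>n. f n \<in> \<S> \<and> f n \<subset> f (Suc n)"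
    by (rule dependent_nat_choice) (use step ne in auto)
  then obtain f where f: "\<And>n. f n \<in> \<S>" "\<And>n. f n \<subset> f (Suc n)" by blast
  have "\<forall>n. right_ideal (f n) R \<and> f n \<subseteq> f (Suc n)" using f ri by (simp add: less_imp_le)
  then obtain N where "\<forall>n\<ge>N. f n = f N"
    using noeth[unfolded right_noetherian_def, rule_format, of f] by auto
  then have "f (Suc N) = f N" using le_SucI by blast
  then show False using f(2)[of N] by simp
qed

lemma proper_right_ideal_le_maximal:
  assumes "right_ideal I R" "I \<noteq> carrier R"
  shows "\<exists>M. maximal_right_ideal M R \<and> I \<subseteq> M"
proof -
  let ?S = "{J. right_ideal J R \<and> I \<subseteq> J \<and> J \<noteq> carrier R}"
  have "\<exists>M\<in>?S. \<forall>J\<in>?S. M \<subseteq> J \<longrightarrow> J = M"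
    by (rule noetherian_maximal) (use assms in auto)
  then obtain M where M: "right_ideal M R" "I \<subseteq> M" "M \<noteq> carrier R"
    and max: "\<forall>J\<in>?S. M \<subseteq> J \<longrightarrow> J = M" by auto
  have "J = M \<or> J = carrier R" if "right_ideal J R" "M \<subseteq> J" for J
    using max[rule_format, of J] M(2) that by auto
  then show ?thesis
    unfolding maximal_right_ideal_def using M by (intro exI[of _ M]) simp
qed

text \<open>If \<open>X\<close> were strictly larger than \<open>Z\<close>, the ascending chain condition would give \<open>Y\<close> maximal
  among the right ideals with \<open>Z \<subseteq> Y \<subset> X\<close>. Then \<open>X/Y\<close> is simple, so \<open>X \<mm> \<subseteq> Y\<close> for the radical
  \<open>\<mm>\<close>, contrary to \<open>le\<close>. Quantifying over \<open>Y\<close> in the premise avoids speaking of the right ideal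
  \<open>Z + X \<mm>\<close>.\<close>

lemma nakayama:
  assumes X: "right_ideal X R" and Z: "right_ideal Z R" and ZX: "Z \<subseteq> X"
    and le: "\<And>Y. \<lbrakk>right_ideal Y R; Z \<subseteq> Y; Y \<subseteq> X;
      \<And>x m. \<lbrakk>x \<in> X; m \<in> jacobson_radical R\<rbrakk> \<Longrightarrow> x \<otimes> m \<in> Y\<rbrakk> \<Longrightarrow> X \<subseteq> Y"
  shows "X = Z"
proof (rule ccontr)
  assume ne: "X \<noteq> Z"
  let ?S = "{Y. right_ideal Y R \<and> Z \<subseteq> Y \<and> Y \<subset> X}"
  have "\<exists>M\<in>?S. \<forall>J\<in>?S. M \<subseteq> J \<longrightarrow> J = M"
    by (rule noetherian_maximal) (use Z ZX ne in auto)
  then obtain Y where Y: "right_ideal Y R" "Z \<subseteq> Y" "Y \<subset> X"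
    and max: "\<forall>J\<in>?S. Y \<subseteq> J \<longrightarrow> J = Y" by auto
  have "J = Y \<or> J = X" if "right_ideal J R" "Y \<subseteq> J" "J \<subseteq> X" for J
    using max[rule_format, of J] Y(2) that by auto
  then have "x \<otimes> m \<in> Y" if "x \<in> X" "m \<in> jacobson_radical R" for x m
    using jacobson_kills_simple[OF X Y(1) _ _ that] Y(3) by simp
  then have "X \<subseteq> Y" using le[OF Y(1,2)] psubset_imp_subset[OF Y(3)] by blast
  then show False using Y(3) by simp
qed

text \<open>A maximal member among the right ideals with finitely many generators from \<open>X\<close> contains each
  element of \<open>X\<close>.\<close>

lemma right_ideal_finitely_generated:
  assumes X: "right_ideal X R"
  shows "\<exists>B. finite B \<and> B \<subseteq> X \<and> X \<subseteq> lspan (\<Union>b\<in>B. (\<otimes>) b ` carrier R)"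
proof -
  define g where "g B = lspan (\<Union>b\<in>B. (\<otimes>) b ` carrier R)" for B
  have XR: "X \<subseteq> carrier R" using right_idealD(1)[OF X] subspace_mem by blast
  have g: "right_ideal (g B) R" if "B \<subseteq> X" for B
    unfolding g_def
  proof (rule right_ideal_lspan)
    show "(\<Union>b\<in>B. (\<otimes>) b ` carrier R) \<subseteq> carrier R" using that XR by auto
    fix x a assume "x \<in> (\<Union>b\<in>B. (\<otimes>) b ` carrier R)" "a \<in> carrier R"
    then obtain b r where "b \<in> B" "r \<in> carrier R" "x = b \<otimes> r" "a \<in> carrier R" by blast
    moreover from this have "x \<otimes> a = b \<otimes> (r \<otimes> a)" using that XR by (simp add: m_assoc subset_iff)
    ultimately have "x \<otimes> a \<in> (\<Union>b\<in>B. (\<otimes>) b ` carrier R)" by blast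
    then show "x \<otimes> a \<in> lspan (\<Union>b\<in>B. (\<otimes>) b ` carrier R)" by (rule hull_inc)
  qed
  have "\<exists>M\<in>g ` {B. finite B \<and> B \<subseteq> X}. \<forall>J\<in>g ` {B. finite B \<and> B \<subseteq> X}. M \<subseteq> J \<longrightarrow> J = M"
    by (rule noetherian_maximal) (use g in auto)
  then obtain B where B: "finite B" "B \<subseteq> X"
    and max: "\<forall>C. finite C \<and> C \<subseteq> X \<longrightarrow> g B \<subseteq> g C \<longrightarrow> g C = g B" by auto
  have "x \<in> g B" if x: "x \<in> X" for x
  proof -
    have "g B \<subseteq> g (insert x B)" unfolding g_def by (rule hull_mono) blast
    then have "g (insert x B) = g B" using max[rule_format, of "insert x B"] B x by simp
    moreover have "x \<otimes> \<one> \<in> g (insert x B)" unfolding g_def by (rule hull_inc) blast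
    ultimately show ?thesis using x XR by auto
  qed
  then show ?thesis using B unfolding g_def by blast
qed

end


section \<open>The radical-adic topology\<close>

locale complete_alg = noetherian_alg K R
  for K :: "('k, 'c) ring_scheme" and R :: "('k, 'a, 'd) module_scheme" (structure) +
  assumes complete: "adically_complete R (jacobson_radical R)"
    and residue_finite: "finite_over (jacobson_radical R) (carrier R)"
begin

abbreviation mpow :: "nat \<Rightarrow> 'a set"
  where "mpow \<equiv> ideal_power R (jacobson_radical R)"

text \<open>Stated for right ideals, since the powers of the radical are treated as right ideals throughout.\<close>

lemma right_ideal_ideal_prod:
  assumes X: "right_ideal X R" and Y: "right_ideal Y R"
  shows "right_ideal (ideal_prod R X Y) R" "ideal_prod R X Y \<subseteq> X"
proof -
  note X' = right_idealD[OF X] and Y' = right_idealD[OF Y]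
  have Xc: "x \<in> X \<Longrightarrow> x \<in> carrier R" for x using subspace_mem[OF X'(1)] .
  have Yc: "x \<in> Y \<Longrightarrow> x \<in> carrier R" for x using subspace_mem[OF Y'(1)] .
  show sub: "ideal_prod R X Y \<subseteq> X"
  proof
    fix z assume "z \<in> ideal_prod R X Y"
    then show "z \<in> X"
      by induction (use X'(2) Yc subspace_add[OF X'(1)] in auto)
  qed
  show "right_ideal (ideal_prod R X Y) R"
  proof (rule right_idealI)
    have mult: "z \<otimes> a \<in> ideal_prod R X Y" if "z \<in> ideal_prod R X Y" "a \<in> carrier R" for z a
      using that(1)
    proof induction
      case (prod x y)
      then have "x \<otimes> y \<otimes> a = x \<otimes> (y \<otimes> a)" using Xc Yc that(2) by (simp add: m_assoc)
      then show ?case using prod Y'(2) that(2) by (simp add: ideal_prod.prod)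
    next
      case (sum z w)
      then have "(z \<oplus> w) \<otimes> a = z \<otimes> a \<oplus> w \<otimes> a" using sub Xc that(2) by (simp add: l_distr subset_iff)
      then show ?case using sum by (simp add: ideal_prod.sum)
    qed
    then show "z \<otimes> a \<in> ideal_prod R X Y" if "z \<in> ideal_prod R X Y" "a \<in> carrier R" for z a
      using that .
    show "subspace (ideal_prod R X Y)"
    proof (rule subspaceI)
      show "ideal_prod R X Y \<subseteq> carrier R" using sub Xc by blast
      have "\<zero> \<otimes> \<zero> \<in> ideal_prod R X Y"
        by (rule ideal_prod.prod) (use X'(1) Y'(1) subspace_zero in auto)
      then show "\<zero> \<in> ideal_prod R X Y" by simp
      fix c z assume "c \<in> carrier K" "z \<in> ideal_prod R X Y"
      moreover from this have "z \<otimes> (c \<odot> \<one>) = c \<odot> z" using sub Xc by (simp add: smult_mult_right subset_iff)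
      ultimately show "c \<odot> z \<in> ideal_prod R X Y" using mult[of z "c \<odot> \<one>"] by simp
    qed (rule ideal_prod.sum)
  qed
qed

lemma right_ideal_mpow: "right_ideal (mpow n) R"
  by (induction n) (simp_all add: right_ideal_carrier right_ideal_ideal_prod right_ideal_jacobson)

lemma subspace_mpow: "subspace (mpow n)"
  using right_idealD(1)[OF right_ideal_mpow] .

lemma mpow_Suc_le: "mpow (Suc n) \<subseteq> mpow n"
  using right_ideal_ideal_prod(2)[OF right_ideal_mpow right_ideal_jacobson] by simp

lemma mpow_antimono: "m \<le> n \<Longrightarrow> mpow n \<subseteq> mpow m"
  using lift_Suc_antimono_le[of mpow, OF mpow_Suc_le] .

lemma mult_mem_mpow_Suc: "\<lbrakk>x \<in> mpow n; y \<in> jacobson_radical R\<rbrakk> \<Longrightarrow> x \<otimes> y \<in> mpow (Suc n)"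
  by (simp add: ideal_prod.prod)

text \<open>\<open>R/\<mm>\<^sup>n\<close> has finite dimension: \<open>\<mm>\<^sup>n\<close> is generated by finitely many \<open>b\<close>, and
  \<open>b\<close> times a finite spanning set of \<open>R\<close> modulo \<open>\<mm>\<close> spans \<open>b R\<close> modulo \<open>\<mm>\<^sup>n\<^sup>+\<^sup>1\<close>.\<close>

lemma finite_over_mpow: "finite_over (mpow n) (carrier R)"
proof (induction n)
  case 0
  have "generated_over (carrier R) (carrier R) 0" using generated_over_0[OF subspace_carrier] by simp
  then show ?case unfolding finite_over_def by auto
next
  case (Suc n)
  obtain B where B: "finite B" "B \<subseteq> mpow n" "mpow n \<subseteq> lspan (\<Union>b\<in>B. (\<otimes>) b ` carrier R)"
    using right_ideal_finitely_generated[OF right_ideal_mpow[of n]] by (elim exE conjE) (rule that)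
  have bR: "b \<in> carrier R" if "b \<in> B" for b using B(2) that subspace_mem[OF subspace_mpow] by auto
  have "generated_over (mpow (Suc n)) (mpow n)
      (\<Sum>b\<in>B. rdim (jacobson_radical R) (carrier R))"
  proof (rule generated_over_UN_image[OF B(1)])
    show "linear ((\<otimes>) b)" if "b \<in> B" for b using linear_mult_left[OF bR[OF that]] .
    show "generated_over (jacobson_radical R) (carrier R) (rdim (jacobson_radical R) (carrier R))"
      by (rule generated_over_rdim[OF residue_finite])
    show "(\<otimes>) b ` jacobson_radical R \<subseteq> mpow (Suc n)" if "b \<in> B" for b
      using mult_mem_mpow_Suc B(2) that by blast
    show "jacobson_radical R \<subseteq> carrier R" unfolding jacobson_radical_def by blast
    show "subspace (mpow (Suc n))" by (rule subspace_mpow)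
    have "lspan (\<Union>b\<in>B. (\<otimes>) b ` carrier R) \<subseteq> lspan (mpow (Suc n) \<union> (\<Union>b\<in>B. (\<otimes>) b ` carrier R))"
      by (rule hull_mono) blast
    then show "mpow n \<subseteq> lspan (mpow (Suc n) \<union> (\<Union>b\<in>B. (\<otimes>) b ` carrier R))" using B(3) by blast
  qed
  moreover have "mpow (Suc n) \<subseteq> carrier R" using subspace_mem[OF subspace_mpow] by blast
  ultimately show ?case
    using Suc generated_over_trans[of "mpow (Suc n)" "mpow n"] unfolding finite_over_def by metis
qed

text \<open>Nilpotency of the radical modulo \<open>Z\<close>: the chain \<open>\<mm>\<^sup>n + Z\<close> becomes stationary because \<open>R/Z\<close> has finite
  dimension, and Nakayama's lemma identifies its last term with \<open>Z\<close>. So right ideals of finite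
  codimension are open in the radical-adic topology.\<close>

lemma mpow_le_right_ideal:
  assumes Z: "right_ideal Z R" and fin: "finite_over Z (carrier R)"
  shows "\<exists>n. mpow n \<subseteq> Z"
proof -
  let ?C = "\<lambda>n. mpow n <+>\<^bsub>R\<^esub> Z"
  note Zs = right_idealD(1)[OF Z]
  have "\<exists>N. \<forall>n\<ge>N. ?C n = ?C N"
  proof (rule finite_over_decseq_stable[OF Zs])
    show "subspace (?C n)" for n by (rule subspace_set_add[OF subspace_mpow Zs])
    show "Z \<subseteq> ?C n" for n by (rule set_add_upper2[OF subspace_mpow Zs])
    show "?C (Suc n) \<subseteq> ?C n" for n
      using mpow_Suc_le[of n] unfolding set_add_mem subset_iff by blast
  qed (rule fin)
  then obtain N where "\<forall>n\<ge>N. ?C n = ?C N" ..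
  then have N: "?C (Suc N) = ?C N" using le_SucI by blast
  have "?C N = Z"
  proof (rule nakayama[OF right_ideal_set_add[OF right_ideal_mpow Z] Z])
    show "Z \<subseteq> ?C N" by (rule set_add_upper2[OF subspace_mpow Zs])
    fix Y assume Y: "right_ideal Y R" "Z \<subseteq> Y"
      and m: "\<And>x m. \<lbrakk>x \<in> ?C N; m \<in> jacobson_radical R\<rbrakk> \<Longrightarrow> x \<otimes> m \<in> Y"
    note Ys = right_idealD(1)[OF Y(1)]
    have "z \<in> Y" if "z \<in> ideal_prod R (mpow N) (jacobson_radical R)" for z
      using that
    proof induction
      case (prod i j)
      then show ?case using m set_add_upper1[OF subspace_mpow[of N] Zs] by blast
    qed (rule subspace_add[OF Ys])
    then have "?C (Suc N) \<subseteq> Y" using Y(2) by (intro set_add_least[OF Ys]) auto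
    then show "?C N \<subseteq> Y" using N by simp
  qed
  then show ?thesis using set_add_upper1[OF subspace_mpow[of N] Zs] by blast
qed

text \<open>Linear compactness: a descending sequence of cosets \<open>r k + G k\<close> of open subspaces has a common
  element. Modulo \<open>\<mm>\<^sup>j\<close> the sequence becomes stationary, as \<open>R/\<mm>\<^sup>j\<close> has finite dimension. Hence an
  element of all the cosets modulo \<open>\<mm>\<^sup>j\<close> can be corrected by an element of \<open>\<mm>\<^sup>j\<close> so that it lies
  in all of them modulo \<open>\<mm>\<^sup>j\<^sup>+\<^sup>1\<close>; the corrections converge by completeness, and the limit
  lies in each coset because \<open>G k\<close> is open. For \<open>G k = \<Gamma> (b - k)\<close> this is convergence
  in the topology of the filtration.\<close>

lemma nested_cosets_meet:
  assumes G: "\<And>k. subspace (G k)" and dec: "\<And>k. G (Suc k) \<subseteq> G k"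
    and op: "\<And>k. \<exists>j. mpow j \<subseteq> G k"
    and r: "\<And>k. r k \<in> carrier R" and step: "\<And>k. r (Suc k) \<ominus> r k \<in> G k"
  shows "\<exists>l\<in>carrier R. \<forall>k. l \<ominus> r k \<in> G k"
proof -
  have anti: "G n \<subseteq> G m" if "m \<le> n" for m n
    using lift_Suc_antimono_le[of G, OF dec that] .
  note rG = subspace_mem[OF G]
  have tele: "x \<ominus> z = (x \<ominus> y) \<oplus> (y \<ominus> z)" if "x \<in> carrier R" "y \<in> carrier R" "z \<in> carrier R" for x y z
  proof -
    have "(x \<ominus> y) \<oplus> (y \<ominus> z) = x \<oplus> ((\<ominus> y \<oplus> y) \<ominus> z)"
      using that by (simp add: M.minus_eq M.a_assoc del: M.l_neg)
    then show ?thesis using that by (simp add: M.l_neg M.minus_eq)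
  qed
  have neg: "x \<ominus> y = \<ominus> (y \<ominus> x)" if "x \<in> carrier R" "y \<in> carrier R" for x y
    using that by (simp add: M.minus_eq M.minus_add M.a_comm)
  have diff: "r n \<ominus> r m \<in> G m" if "m \<le> n" for m n
    using that
  proof (induction n rule: dec_induct)
    case base
    then show ?case using r subspace_zero[OF G] by (simp add: M.minus_eq M.r_neg)
  next
    case (step n)
    have "r (Suc n) \<ominus> r m = (r (Suc n) \<ominus> r n) \<oplus> (r n \<ominus> r m)" using r tele by simp
    then show ?case
      using step assms(5)[of n] anti[OF step(1)] subspace_add[OF G, of "r (Suc n) \<ominus> r n" m] by auto
  qed
  let ?A = "\<lambda>j k. G k <+>\<^bsub>R\<^esub> mpow j"
  have A: "subspace (?A j k)" for j k by (rule subspace_set_add[OF G subspace_mpow])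
  have GA: "G k \<subseteq> ?A j k" for j k by (rule set_add_upper1[OF G subspace_mpow])
  have mA: "mpow j \<subseteq> ?A j k" for j k by (rule set_add_upper2[OF G subspace_mpow])
  have stable: "\<exists>N. \<forall>k\<ge>N. ?A j k = ?A j N" for j
  proof (rule finite_over_decseq_stable[OF subspace_mpow[of j]])
    show "?A j (Suc k) \<subseteq> ?A j k" for k
      using dec[of k] unfolding set_add_mem subset_iff by blast
  qed (use A mA finite_over_mpow in auto)
  have "\<exists>y. \<forall>j. (y j \<in> carrier R \<and> (\<forall>k. y j \<ominus> r k \<in> ?A j k)) \<and> y (Suc j) \<ominus> y j \<in> mpow j"
  proof (rule dependent_nat_choice)
    have "r 0 \<ominus> r k \<in> ?A 0 k" for k
      using mA[of 0 k] r by auto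
    then show "\<exists>x. x \<in> carrier R \<and> (\<forall>k. x \<ominus> r k \<in> ?A 0 k)" using r by blast
  next
    fix y j assume y: "y \<in> carrier R \<and> (\<forall>k. y \<ominus> r k \<in> ?A j k)"
    \<comment> \<open>the part of \<open>y - r N\<close> in \<open>\<mm>\<^sup>j\<close> is discarded, where \<open>N\<close> is so large that
      \<open>G N\<close> and all later \<open>G k\<close> agree modulo \<open>\<mm>\<^sup>j\<^sup>+\<^sup>1\<close>\<close>
    obtain N where N: "\<forall>k\<ge>N. ?A (Suc j) k = ?A (Suc j) N" using stable ..
    have "y \<ominus> r N \<in> ?A j N" using y by blast
    then obtain g u where gu: "g \<in> G N" "u \<in> mpow j" "y \<ominus> r N = g \<oplus> u"
      unfolding set_add_mem by blast
    have c: "g \<in> carrier R" "u \<in> carrier R" "y \<in> carrier R" "r N \<in> carrier R"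
      using gu rG subspace_mem[OF subspace_mpow] y r by auto
    let ?y = "r N \<oplus> g"
    have "y = (y \<ominus> r N) \<oplus> r N" using c by (simp add: M.minus_eq M.a_assoc M.l_neg)
    then have "y = ?y \<oplus> u" using gu(3) c by (simp add: M.add.m_ac)
    then have "?y \<ominus> y = ?y \<ominus> (?y \<oplus> u)" by simp
    also have "\<dots> = \<ominus> u"
    proof -
      have "?y \<ominus> (?y \<oplus> u) = (?y \<oplus> \<ominus> ?y) \<oplus> \<ominus> u"
        using c by (simp add: M.minus_eq M.minus_add M.a_assoc del: M.r_neg)
      then show ?thesis using c by (simp add: M.r_neg)
    qed
    finally have 1: "?y \<ominus> y \<in> mpow j" using submoduleE(3)[OF subspace_mpow gu(2)] by simp
    have "?y \<ominus> r k \<in> ?A (Suc j) k" for k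
    proof -
      have yk: "?y \<ominus> r k = g \<oplus> (r N \<ominus> r k)"
        using c r by (simp add: M.minus_eq M.add.m_ac)
      show ?thesis
      proof (cases "k \<le> N")
        case True
        have "g \<oplus> (r N \<ominus> r k) \<in> G k"
          by (rule subspace_add[OF G subsetD[OF anti[OF True] gu(1)] diff[OF True]])
        then show ?thesis unfolding yk by (rule subsetD[OF GA])
      next
        case False
        then have k0: "N \<le> k" by simp
        note k = k0 N[rule_format, OF k0]
        have "r N \<ominus> r k \<in> G N"
          using neg[of "r N" "r k"] r diff[OF k(1)] submoduleE(3)[OF G] by auto
        then have "g \<oplus> (r N \<ominus> r k) \<in> G N" by (rule subspace_add[OF G gu(1)])
        then show ?thesis unfolding yk k(2) by (rule subsetD[OF GA])
      qed
    qed
    then show "\<exists>z. (z \<in> carrier R \<and> (\<forall>k. z \<ominus> r k \<in> ?A (Suc j) k)) \<and> z \<ominus> y \<in> mpow j"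
      using 1 c by (intro exI[of _ ?y]) simp
  qed
  then obtain y where y: "\<And>j. y j \<in> carrier R" "\<And>j k. y j \<ominus> r k \<in> ?A j k"
    "\<And>j. y (Suc j) \<ominus> y j \<in> mpow j" by auto
  have ydiff: "y n \<ominus> y m \<in> mpow m" if "m \<le> n" for m n
    using that
  proof (induction n rule: dec_induct)
    case base
    then show ?case using y(1) subspace_zero[OF subspace_mpow] by (simp add: M.minus_eq M.r_neg)
  next
    case (step n)
    have "y (Suc n) \<ominus> y m = (y (Suc n) \<ominus> y n) \<oplus> (y n \<ominus> y m)" using y(1) tele by simp
    then show ?case
      using step y(3)[of n] mpow_antimono[OF step(1)]
        subspace_add[OF subspace_mpow, of "y (Suc n) \<ominus> y n" m] by auto
  qed
  have "adic_Cauchy R (jacobson_radical R) y"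
    unfolding adic_Cauchy_def
  proof (intro allI exI impI)
    fix n i j :: nat assume "n \<le> i" "n \<le> j"
    then have "y i \<ominus> y n \<in> mpow n" "y n \<ominus> y j \<in> mpow n"
      using ydiff neg[of "y n" "y j"] y(1) submoduleE(3)[OF subspace_mpow] by auto
    then show "y i \<ominus> y j \<in> mpow n"
      using tele[of "y i" "y n" "y j"] y(1) subspace_add[OF subspace_mpow] by simp
  qed
  moreover have "y \<in> UNIV \<rightarrow> carrier R" using y(1) by blast
  ultimately have "\<exists>l\<in>carrier R. adic_limit R (jacobson_radical R) y l"
    using complete unfolding adically_complete_def by simp
  then obtain l where l: "l \<in> carrier R" "adic_limit R (jacobson_radical R) y l" ..
  have "l \<ominus> r k \<in> G k" for k
  proof -
    obtain j where j: "mpow j \<subseteq> G k" using op by auto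
    obtain N where N: "\<forall>i\<ge>N. y i \<ominus> l \<in> mpow j"
      using l(2) unfolding adic_limit_def by auto
    define i where "i = max N j"
    have "y i \<ominus> l \<in> G k" using N j unfolding i_def by auto
    then have 1: "l \<ominus> y i \<in> G k" using neg[of l "y i"] l(1) y(1) submoduleE(3)[OF G] by auto
    have "?A i k \<subseteq> G k"
      using mpow_antimono[of j i] j unfolding i_def by (intro set_add_least[OF G]) auto
    then have "y i \<ominus> r k \<in> G k" using y(2) by blast
    then show ?thesis using 1 tele[of l "y i" "r k"] l(1) y(1) r subspace_add[OF G] by simp
  qed
  then show ?thesis using l(1) by blast
qed

end


section \<open>Weak adic filtrations\<close>

locale weak_adic_alg = complete_alg K R + weak_adic_filtration K R \<Gamma>
  for K :: "('k, 'c) ring_scheme" and R :: "('k, 'a, 'd) module_scheme" (structure)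
    and \<Gamma> :: "int \<Rightarrow> 'a set"
begin

lemma filt_le: "i \<le> j \<Longrightarrow> \<Gamma> i \<subseteq> \<Gamma> j"
proof (induction j rule: int_ge_induct)
  case (step j)
  then show ?case using filt_mono by blast
qed simp

lemma filt_carrier: "x \<in> \<Gamma> i \<Longrightarrow> x \<in> carrier R"
  using subspace_mem[OF filt_subspace] .

lemma right_ideal_filt: "right_ideal (\<Gamma> i) R"
proof (rule right_idealI[OF filt_subspace])
  show "x \<otimes> a \<in> \<Gamma> i" if "x \<in> \<Gamma> i" "a \<in> carrier R" for x a
    using filt_mult[of x i a 0] that filt_nonneg[of 0] by simp
qed

lemma filt_mult_left: "a \<in> carrier R \<Longrightarrow> x \<in> \<Gamma> i \<Longrightarrow> a \<otimes> x \<in> \<Gamma> i"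
  using filt_mult[of a 0 x i] filt_nonneg[of 0] by simp

lemma finite_over_filt_step: "finite_over (\<Gamma> (i - 1)) (\<Gamma> i)"
  by (rule finite_over_if_finite_dimensional[OF filt_finite filt_subspace filt_subspace])
    (simp add: filt_le)

lemma generated_over_filt:
  "generated_over (\<Gamma> (- int n)) (carrier R) (\<Sum>i<n. rdim (\<Gamma> (- int i - 1)) (\<Gamma> (- int i)))"
proof (induction n)
  case 0
  have "generated_over (\<Gamma> 0) (\<Gamma> 0) 0" using generated_over_0[OF filt_subspace] by simp
  then show ?case using filt_nonneg[of 0] by simp
next
  case (Suc n)
  have 1: "- int (Suc n) = - int n - 1" by simp
  have "\<Gamma> (- int n - 1) \<subseteq> carrier R" using filt_carrier by blast
  from generated_over_trans[OF generated_over_rdim[OF finite_over_filt_step] Suc this]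
  show ?case unfolding 1 by (simp add: add.commute)
qed

lemma finite_over_filt: "finite_over (\<Gamma> (- int n)) (carrier R)"
  using generated_over_filt unfolding finite_over_def by blast

lemma mpow_le_filt: "\<exists>j. mpow j \<subseteq> \<Gamma> i"
proof -
  have *: "\<Gamma> (- int (nat (- i))) \<subseteq> \<Gamma> i"
    using filt_nonneg[of i] filt_carrier by (cases "i \<le> 0") auto
  have "\<exists>j. mpow j \<subseteq> \<Gamma> (- int (nat (- i)))"
    by (rule mpow_le_right_ideal[OF right_ideal_filt finite_over_filt])
  then show ?thesis using * by (meson order_trans)
qed

lemma filt_complete:
  assumes "\<And>k. r k \<in> carrier R" and "\<And>k. r (Suc k) \<ominus> r k \<in> \<Gamma> (b - int k)"
  shows "\<exists>l\<in>carrier R. \<forall>k. l \<ominus> r k \<in> \<Gamma> (b - int k)"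
  by (rule nested_cosets_meet) (use filt_subspace mpow_le_filt assms in \<open>auto intro: filt_le[THEN subsetD, rotated]\<close>)

end


section \<open>Right ideals of the associated graded ring\<close>

context weak_adic_alg
begin

text \<open>A graded right ideal of \<open>gr R\<close>, given by the preimages \<open>V n\<close> of its components
  in \<open>\<Gamma> n\<close>. In this form containments can be discussed inside \<open>R\<close>.\<close>

definition graded_right_ideal :: "(int \<Rightarrow> 'a set) \<Rightarrow> bool"
  where "graded_right_ideal V \<longleftrightarrow>
    (\<forall>n. subspace (V n) \<and> \<Gamma> (n - 1) \<subseteq> V n \<and> V n \<subseteq> \<Gamma> n) \<and>
    (\<forall>n j. \<forall>x\<in>V n. \<forall>y\<in>\<Gamma> j. x \<otimes> y \<in> V (n + j))"

definition gr_ideal :: "(int \<Rightarrow> 'a set) \<Rightarrow> (int \<Rightarrow> 'a set) set"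
  where "gr_ideal V = {f \<in> carrier (gr R \<Gamma>). \<forall>i. f i \<subseteq> V i}"

abbreviation piece :: "int \<Rightarrow> (unit, 'a set) module"
  where "piece \<equiv> gr_piece R \<Gamma>"

lemma piece_simps:
  "carrier (piece i) = (\<lambda>x. \<Gamma> (i - 1) +> x) ` \<Gamma> i"
  "X \<oplus>\<^bsub>piece i\<^esub> Y = X <+>\<^bsub>R\<^esub> Y" "\<zero>\<^bsub>piece i\<^esub> = \<Gamma> (i - 1)"
  by (simp_all add: gr_piece_def subquotient_def)

lemma abelian_group_piece: "abelian_group (piece i)"
  unfolding gr_piece_def
  by (rule M.subquotient_abelian_group)
    (use filt_subspace subspace_additive_subgroup filt_le in auto)

lemma gr_simps:
  "carrier (gr R \<Gamma>) = {f. (\<forall>i. f i \<in> carrier (piece i)) \<and> finite {i. f i \<noteq> \<zero>\<^bsub>piece i\<^esub>}}"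
  "f \<oplus>\<^bsub>gr R \<Gamma>\<^esub> g = (\<lambda>i. f i \<oplus>\<^bsub>piece i\<^esub> g i)"
  "\<zero>\<^bsub>gr R \<Gamma>\<^esub> = (\<lambda>i. \<zero>\<^bsub>piece i\<^esub>)"
  "f \<otimes>\<^bsub>gr R \<Gamma>\<^esub> g = (\<lambda>n. \<Oplus>\<^bsub>piece n\<^esub>
     i \<in> {i. f i \<noteq> \<zero>\<^bsub>piece i\<^esub> \<and> g (n - i) \<noteq> \<zero>\<^bsub>piece (n - i)\<^esub>}.
       rcoset_mult R (\<Gamma> (n - 1)) (f i) (g (n - i)))"
  by (simp_all add: gr_def)

lemma piece_inverse:
  assumes V: "graded_right_ideal V" and X: "X \<in> carrier (piece i)" "X \<subseteq> V i"
  shows "\<exists>Y\<in>carrier (piece i). Y \<subseteq> V i \<and> Y \<oplus>\<^bsub>piece i\<^esub> X = \<zero>\<^bsub>piece i\<^esub>"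
proof -
  interpret W: abelian_subgroup "\<Gamma> (i - 1)" R
    by (rule abelian_subgroupI3[OF subspace_additive_subgroup[OF filt_subspace]]) (rule M.abelian_group_axioms)
  have sV: "subspace (V i)" "\<Gamma> (i - 1) \<subseteq> V i" using V unfolding graded_right_ideal_def by auto
  obtain x where x: "x \<in> \<Gamma> i" "X = \<Gamma> (i - 1) +> x" using X(1) unfolding piece_simps by blast
  have xc: "x \<in> carrier R" using x filt_carrier by blast
  have "x \<in> V i" using coset_self[OF filt_subspace xc] X(2) x(2) by blast
  then have "\<Gamma> (i - 1) +> \<ominus> x \<subseteq> V i"
    by (intro coset_subset sV submoduleE(3))
  moreover have "\<Gamma> (i - 1) +> \<ominus> x \<in> carrier (piece i)"
    unfolding piece_simps using submoduleE(3)[OF filt_subspace x(1)] by blast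
  moreover have "(\<Gamma> (i - 1) +> \<ominus> x) \<oplus>\<^bsub>piece i\<^esub> X = \<zero>\<^bsub>piece i\<^esub>"
    unfolding piece_simps x(2) using W.a_rcos_sum[of "\<ominus> x" x] xc W.a_subset by (simp add: M.l_neg)
  ultimately show ?thesis by blast
qed

lemma graded_right_ideal_filt: "graded_right_ideal \<Gamma>"
  unfolding graded_right_ideal_def using filt_subspace filt_le filt_mult by auto

text \<open>Applied to \<open>\<Gamma>\<close> itself this gives the additive inverses of \<open>gr R\<close>; applied to a smaller family
  it shows that the corresponding subset of \<open>gr R\<close> is closed under them.\<close>

lemma gr_ideal_inverse:
  assumes V: "graded_right_ideal V" and f: "f \<in> gr_ideal V"
  shows "\<exists>g\<in>gr_ideal V. g \<oplus>\<^bsub>gr R \<Gamma>\<^esub> f = \<zero>\<^bsub>gr R \<Gamma>\<^esub>"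
proof -
  have f': "\<And>i. f i \<in> carrier (piece i)" "finite {i. f i \<noteq> \<zero>\<^bsub>piece i\<^esub>}" "\<And>i. f i \<subseteq> V i"
    using f unfolding gr_ideal_def gr_simps by auto
  have "\<forall>i. \<exists>Y. Y \<in> carrier (piece i) \<and> Y \<subseteq> V i \<and> Y \<oplus>\<^bsub>piece i\<^esub> f i = \<zero>\<^bsub>piece i\<^esub>"
    using piece_inverse[OF V f'(1,3)] by blast
  from choice[OF this] obtain g where g: "\<And>i. g i \<in> carrier (piece i)" "\<And>i. g i \<subseteq> V i"
    "\<And>i. g i \<oplus>\<^bsub>piece i\<^esub> f i = \<zero>\<^bsub>piece i\<^esub>" by auto
  have "g i = \<zero>\<^bsub>piece i\<^esub>" if "f i = \<zero>\<^bsub>piece i\<^esub>" for i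
  proof -
    interpret P: abelian_group "piece i" by (rule abelian_group_piece)
    show ?thesis using g(3)[of i] that g(1)[of i] by simp
  qed
  then have "{i. g i \<noteq> \<zero>\<^bsub>piece i\<^esub>} \<subseteq> {i. f i \<noteq> \<zero>\<^bsub>piece i\<^esub>}" by blast
  then have "g \<in> gr_ideal V"
    unfolding gr_ideal_def gr_simps using g f'(2) finite_subset by auto
  moreover have "g \<oplus>\<^bsub>gr R \<Gamma>\<^esub> f = \<zero>\<^bsub>gr R \<Gamma>\<^esub>" unfolding gr_simps using g(3) by simp
  ultimately show ?thesis by blast
qed

lemma gr_ideal_filt: "gr_ideal \<Gamma> = carrier (gr R \<Gamma>)"
proof -
  have "f i \<subseteq> \<Gamma> i" if "f \<in> carrier (gr R \<Gamma>)" for f i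
  proof -
    have "f i \<in> carrier (piece i)" using that unfolding gr_simps by simp
    then obtain x where "x \<in> \<Gamma> i" "f i = \<Gamma> (i - 1) +> x" unfolding piece_simps by blast
    then show ?thesis using coset_subset[OF filt_subspace filt_le[of "i - 1" i]] by simp
  qed
  then show ?thesis unfolding gr_ideal_def by blast
qed

lemma gr_ideal_add:
  assumes V: "graded_right_ideal V" and f: "f \<in> gr_ideal V" and g: "g \<in> gr_ideal V"
  shows "f \<oplus>\<^bsub>gr R \<Gamma>\<^esub> g \<in> gr_ideal V"
proof -
  have f': "\<And>i. f i \<in> carrier (piece i)" "finite {i. f i \<noteq> \<zero>\<^bsub>piece i\<^esub>}" "\<And>i. f i \<subseteq> V i"
    using f unfolding gr_ideal_def gr_simps by auto
  have g': "\<And>i. g i \<in> carrier (piece i)" "finite {i. g i \<noteq> \<zero>\<^bsub>piece i\<^esub>}" "\<And>i. g i \<subseteq> V i"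
    using g unfolding gr_ideal_def gr_simps by auto
  have sV: "subspace (V i)" for i using V unfolding graded_right_ideal_def by auto
  have cl: "f i \<oplus>\<^bsub>piece i\<^esub> g i \<in> carrier (piece i)" for i
    using abelian_group.axioms(1)[OF abelian_group_piece, THEN abelian_monoid.a_closed] f'(1) g'(1) .
  have z: "f i \<oplus>\<^bsub>piece i\<^esub> g i = \<zero>\<^bsub>piece i\<^esub>" if "f i = \<zero>\<^bsub>piece i\<^esub>" "g i = \<zero>\<^bsub>piece i\<^esub>" for i
  proof -
    interpret P: abelian_group "piece i" by (rule abelian_group_piece)
    show ?thesis using that by simp
  qed
  have "{i. f i \<oplus>\<^bsub>piece i\<^esub> g i \<noteq> \<zero>\<^bsub>piece i\<^esub>} \<subseteq> {i. f i \<noteq> \<zero>\<^bsub>piece i\<^esub>} \<union> {i. g i \<noteq> \<zero>\<^bsub>piece i\<^esub>}"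
    using z by blast
  then have "finite {i. f i \<oplus>\<^bsub>piece i\<^esub> g i \<noteq> \<zero>\<^bsub>piece i\<^esub>}"
    using f'(2) g'(2) by (rule finite_subset[OF _ finite_UnI])
  moreover have "f i \<oplus>\<^bsub>piece i\<^esub> g i \<subseteq> V i" for i
    unfolding piece_simps by (rule set_add_least[OF sV f'(3) g'(3)])
  ultimately show ?thesis using cl unfolding gr_ideal_def gr_simps by simp
qed

lemma zero_in_gr_ideal: "graded_right_ideal V \<Longrightarrow> \<zero>\<^bsub>gr R \<Gamma>\<^esub> \<in> gr_ideal V"
  unfolding gr_ideal_def gr_simps
  using abelian_group.axioms(1)[OF abelian_group_piece, THEN abelian_monoid.zero_closed]
  by (auto simp: graded_right_ideal_def piece_simps)

lemma abelian_group_gr: "abelian_group (gr R \<Gamma>)"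
proof (rule abelian_groupI)
  note P = abelian_group_piece
  fix f g h assume f: "f \<in> carrier (gr R \<Gamma>)"
  have f': "f i \<in> carrier (piece i)" for i using f unfolding gr_simps by auto
  show "\<exists>g\<in>carrier (gr R \<Gamma>). g \<oplus>\<^bsub>gr R \<Gamma>\<^esub> f = \<zero>\<^bsub>gr R \<Gamma>\<^esub>"
    using gr_ideal_inverse[OF graded_right_ideal_filt] f unfolding gr_ideal_filt by blast
  show "\<zero>\<^bsub>gr R \<Gamma>\<^esub> \<oplus>\<^bsub>gr R \<Gamma>\<^esub> f = f"
    unfolding gr_simps using abelian_monoid.l_zero[OF abelian_group.axioms(1)[OF P] f'] by auto
  assume g: "g \<in> carrier (gr R \<Gamma>)"
  have g': "g i \<in> carrier (piece i)" for i using g unfolding gr_simps by auto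
  show "f \<oplus>\<^bsub>gr R \<Gamma>\<^esub> g \<in> carrier (gr R \<Gamma>)"
    using gr_ideal_add[OF graded_right_ideal_filt] f g unfolding gr_ideal_filt by blast
  show "f \<oplus>\<^bsub>gr R \<Gamma>\<^esub> g = g \<oplus>\<^bsub>gr R \<Gamma>\<^esub> f"
    unfolding gr_simps using abelian_monoid.a_comm[OF abelian_group.axioms(1)[OF P] f' g'] by auto
  assume h: "h \<in> carrier (gr R \<Gamma>)"
  have h': "h i \<in> carrier (piece i)" for i using h unfolding gr_simps by auto
  show "f \<oplus>\<^bsub>gr R \<Gamma>\<^esub> g \<oplus>\<^bsub>gr R \<Gamma>\<^esub> h = f \<oplus>\<^bsub>gr R \<Gamma>\<^esub> (g \<oplus>\<^bsub>gr R \<Gamma>\<^esub> h)"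
    unfolding gr_simps using abelian_monoid.a_assoc[OF abelian_group.axioms(1)[OF P] f' g' h'] by auto
next
  show "\<zero>\<^bsub>gr R \<Gamma>\<^esub> \<in> carrier (gr R \<Gamma>)"
    using zero_in_gr_ideal[OF graded_right_ideal_filt] unfolding gr_ideal_filt .
qed

lemma rcoset_mult_piece:
  assumes x: "x \<in> \<Gamma> i" and y: "y \<in> \<Gamma> (n - i)"
  shows "rcoset_mult R (\<Gamma> (n - 1)) (\<Gamma> (i - 1) +> x) (\<Gamma> (n - i - 1) +> y) = \<Gamma> (n - 1) +> (x \<otimes> y)"
proof (rule rcoset_mult_cosets[OF filt_subspace filt_subspace filt_subspace filt_carrier[OF x] filt_carrier[OF y]])
  fix a v assume a: "a \<in> \<Gamma> (i - 1)" and "v \<in> \<Gamma> (n - i - 1) +> y"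
  then have "v \<in> \<Gamma> (n - i)"
    using coset_subset[OF filt_subspace filt_le[of "n - i - 1" "n - i"] y] by auto
  from filt_mult[OF a this] show "a \<otimes> v \<in> \<Gamma> (n - 1)" by (simp add: algebra_simps)
next
  fix b assume "b \<in> \<Gamma> (n - i - 1)"
  from filt_mult[OF x this] show "x \<otimes> b \<in> \<Gamma> (n - 1)" by (simp add: algebra_simps)
qed

text \<open>Each summand of a component of a product is the coset of a product of representatives, and
  hence is contained in \<open>V n\<close>.\<close>

lemma right_ideal_gr_ideal:
  assumes V: "graded_right_ideal V"
  shows "right_ideal (gr_ideal V) (gr R \<Gamma>)"
proof -
  interpret G: abelian_group "gr R \<Gamma>" by (rule abelian_group_gr)
  have sV: "subspace (V i)" "\<Gamma> (i - 1) \<subseteq> V i" for i using V unfolding graded_right_ideal_def by auto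
  have sub: "gr_ideal V \<subseteq> carrier (gr R \<Gamma>)" unfolding gr_ideal_def by blast
  have "additive_subgroup (gr_ideal V) (gr R \<Gamma>)"
  proof (rule additive_subgroupI, rule group.subgroupI[OF G.a_group])
    show "gr_ideal V \<subseteq> carrier (add_monoid (gr R \<Gamma>))" using sub by simp
    show "gr_ideal V \<noteq> {}" using zero_in_gr_ideal[OF V] by blast
    fix f assume f: "f \<in> gr_ideal V"
    show "inv\<^bsub>add_monoid (gr R \<Gamma>)\<^esub> f \<in> gr_ideal V"
    proof -
      obtain g where g: "g \<in> gr_ideal V" "g \<oplus>\<^bsub>gr R \<Gamma>\<^esub> f = \<zero>\<^bsub>gr R \<Gamma>\<^esub>" using gr_ideal_inverse[OF V f] ..
      then have "\<ominus>\<^bsub>gr R \<Gamma>\<^esub> f = g" using G.minus_equality sub f by blast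
      then show ?thesis using g(1) unfolding a_inv_def by simp
    qed
    fix g assume "g \<in> gr_ideal V"
    then show "f \<otimes>\<^bsub>add_monoid (gr R \<Gamma>)\<^esub> g \<in> gr_ideal V" using gr_ideal_add[OF V f] by simp
  qed
  moreover have "f \<otimes>\<^bsub>gr R \<Gamma>\<^esub> g \<in> gr_ideal V" if f: "f \<in> gr_ideal V" and g: "g \<in> carrier (gr R \<Gamma>)" for f g
  proof -
    have f': "\<And>i. f i \<in> carrier (piece i)" "finite {i. f i \<noteq> \<zero>\<^bsub>piece i\<^esub>}" "\<And>i. f i \<subseteq> V i"
      using f unfolding gr_ideal_def gr_simps by auto
    have g': "\<And>i. g i \<in> carrier (piece i)" "finite {i. g i \<noteq> \<zero>\<^bsub>piece i\<^esub>}"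
      using g unfolding gr_simps by auto
    let ?H = "\<lambda>n. {X \<in> carrier (piece n). X \<subseteq> V n}"
    have H: "(f \<otimes>\<^bsub>gr R \<Gamma>\<^esub> g) n \<in> ?H n" for n
    proof -
      interpret P: abelian_group "piece n" by (rule abelian_group_piece)
      show ?thesis unfolding gr_simps
      proof (rule P.finsum_mem)
        show "(\<lambda>i. rcoset_mult R (\<Gamma> (n - 1)) (f i) (g (n - i))) \<in>
          {i. f i \<noteq> \<zero>\<^bsub>piece i\<^esub> \<and> g (n - i) \<noteq> \<zero>\<^bsub>piece (n - i)\<^esub>} \<rightarrow> ?H n"
        proof
          fix i
          obtain x where x: "x \<in> \<Gamma> i" "f i = \<Gamma> (i - 1) +> x"
            using f'(1)[of i] unfolding piece_simps by blast
          obtain y where y: "y \<in> \<Gamma> (n - i)" "g (n - i) = \<Gamma> (n - i - 1) +> y"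
            using g'(1)[of "n - i"] unfolding piece_simps by blast
          have "x \<in> V i" using coset_self[OF filt_subspace filt_carrier[OF x(1)]] f'(3)[of i] x(2) by blast
          then have "x \<otimes> y \<in> V (i + (n - i))" using V y(1) unfolding graded_right_ideal_def by blast
          then have "x \<otimes> y \<in> V n" by simp
          moreover have "x \<otimes> y \<in> \<Gamma> n" using filt_mult[OF x(1) y(1)] by simp
          ultimately show "rcoset_mult R (\<Gamma> (n - 1)) (f i) (g (n - i)) \<in> ?H n"
            unfolding x(2) y(2) rcoset_mult_piece[OF x(1) y(1)]
            using coset_subset[OF sV] piece_simps(1) by blast
        qed
        show "\<zero>\<^bsub>piece n\<^esub> \<in> ?H n" using P.zero_closed sV(2) by (simp add: piece_simps)
        show "?H n \<subseteq> carrier (piece n)" by blast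
        fix X Y assume "X \<in> ?H n" "Y \<in> ?H n"
        then show "X \<oplus>\<^bsub>piece n\<^esub> Y \<in> ?H n"
          using P.a_closed set_add_least[OF sV(1)] by (auto simp: piece_simps(2))
      qed
    qed
    have "{n. (f \<otimes>\<^bsub>gr R \<Gamma>\<^esub> g) n \<noteq> \<zero>\<^bsub>piece n\<^esub>} \<subseteq>
      (\<lambda>(i, j). i + j) ` ({i. f i \<noteq> \<zero>\<^bsub>piece i\<^esub>} \<times> {i. g i \<noteq> \<zero>\<^bsub>piece i\<^esub>})"
    proof
      fix n assume n: "n \<in> {n. (f \<otimes>\<^bsub>gr R \<Gamma>\<^esub> g) n \<noteq> \<zero>\<^bsub>piece n\<^esub>}"
      interpret P: abelian_group "piece n" by (rule abelian_group_piece)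
      have "{i. f i \<noteq> \<zero>\<^bsub>piece i\<^esub> \<and> g (n - i) \<noteq> \<zero>\<^bsub>piece (n - i)\<^esub>} \<noteq> {}"
      proof
        assume "{i. f i \<noteq> \<zero>\<^bsub>piece i\<^esub> \<and> g (n - i) \<noteq> \<zero>\<^bsub>piece (n - i)\<^esub>} = {}"
        then have "(f \<otimes>\<^bsub>gr R \<Gamma>\<^esub> g) n = \<zero>\<^bsub>piece n\<^esub>" unfolding gr_simps by (simp only: P.finsum_empty)
        then show False using n by simp
      qed
      then obtain i where "f i \<noteq> \<zero>\<^bsub>piece i\<^esub>" "g (n - i) \<noteq> \<zero>\<^bsub>piece (n - i)\<^esub>" by blast
      then show "n \<in> (\<lambda>(i, j). i + j) ` ({i. f i \<noteq> \<zero>\<^bsub>piece i\<^esub>} \<times> {i. g i \<noteq> \<zero>\<^bsub>piece i\<^esub>})"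
        by (intro image_eqI[of _ _ "(i, n - i)"]) auto
    qed
    then have "finite {n. (f \<otimes>\<^bsub>gr R \<Gamma>\<^esub> g) n \<noteq> \<zero>\<^bsub>piece n\<^esub>}"
      using f'(2) g'(2) by (rule finite_subset[OF _ finite_imageI[OF finite_cartesian_product]])
    then show ?thesis using H unfolding gr_ideal_def gr_simps(1) by simp
  qed
  ultimately show ?thesis unfolding right_ideal_def by blast
qed

text \<open>The ascending chain condition of \<open>gr R\<close>, transported to families of subspaces of \<open>R\<close>: a family
  can be recovered from its right ideal by testing elements of \<open>gr R\<close> with a single nonzero component.\<close>

lemma gr_noetherian_stable:
  assumes noeth: "right_noetherian (gr R \<Gamma>)"
    and V: "\<And>m. graded_right_ideal (V m)" and inc: "\<And>m n. V m n \<subseteq> V (Suc m) n"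
  shows "\<exists>N. \<forall>m\<ge>N. V m = V N"
proof -
  have "\<forall>m. right_ideal (gr_ideal (V m)) (gr R \<Gamma>) \<and> gr_ideal (V m) \<subseteq> gr_ideal (V (Suc m))"
  proof
    fix m
    have "gr_ideal (V m) \<subseteq> gr_ideal (V (Suc m))" using inc[of m] unfolding gr_ideal_def by blast
    then show "right_ideal (gr_ideal (V m)) (gr R \<Gamma>) \<and> gr_ideal (V m) \<subseteq> gr_ideal (V (Suc m))"
      using right_ideal_gr_ideal[OF V] by simp
  qed
  then obtain N where N: "\<forall>m\<ge>N. gr_ideal (V m) = gr_ideal (V N)"
    using noeth[unfolded right_noetherian_def, rule_format, of "\<lambda>m. gr_ideal (V m)"] by auto
  have le: "V m n \<subseteq> V N n" if m: "m \<ge> N" for m n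
  proof
    fix x assume x: "x \<in> V m n"
    then have xn: "x \<in> \<Gamma> n" using V unfolding graded_right_ideal_def by blast
    have sV: "subspace (V m i)" "\<Gamma> (i - 1) \<subseteq> V m i" for i
      using V unfolding graded_right_ideal_def by auto
    define f where "f i = (if i = n then \<Gamma> (n - 1) +> x else \<Gamma> (i - 1))" for i
    have "{i. f i \<noteq> \<Gamma> (i - 1)} \<subseteq> {n}" unfolding f_def by auto
    then have "finite {i. f i \<noteq> \<zero>\<^bsub>piece i\<^esub>}" unfolding piece_simps(3) by (rule finite_subset) simp
    moreover have "f i \<in> carrier (piece i)" for i
    proof (cases "i = n")
      case True
      then show ?thesis using xn unfolding f_def piece_simps by simp
    next
      case False
      then have "f i = \<zero>\<^bsub>piece i\<^esub>" unfolding f_def piece_simps by simp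
      then show ?thesis
        using abelian_group.axioms(1)[OF abelian_group_piece, THEN abelian_monoid.zero_closed] by simp
    qed
    moreover have "f i \<subseteq> V m i" for i
      using coset_subset[OF sV x] sV(2)[of i] unfolding f_def by auto
    ultimately have "f \<in> gr_ideal (V m)" unfolding gr_ideal_def gr_simps(1) by simp
    then have "f \<in> gr_ideal (V N)" using N[rule_format, OF m] by simp
    then have "f n \<subseteq> V N n" unfolding gr_ideal_def by blast
    then have "\<Gamma> (n - 1) +> x \<subseteq> V N n" unfolding f_def by simp
    then show "x \<in> V N n" using coset_self[OF filt_subspace filt_carrier[OF xn]] by blast
  qed
  have ge: "V N n \<subseteq> V m n" if m: "m \<ge> N" for m n
    using lift_Suc_mono_le[of "\<lambda>m. V m n", OF inc m] .
  have "V m = V N" if "m \<ge> N" for m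
    by (rule ext, rule equalityI[OF le[OF that] ge[OF that]])
  then show ?thesis by blast
qed

text \<open>The graded right ideal generated by the symbols of the pairs \<open>(y, d)\<close> in \<open>Y\<close>, where \<open>y \<in> \<Gamma> d\<close>
  has its symbol taken in degree \<open>d\<close>.\<close>

definition symbol_ideal :: "('a \<times> int) set \<Rightarrow> int \<Rightarrow> 'a set"
  where "symbol_ideal Y n = lspan (\<Gamma> (n - 1) \<union> (\<Union>p\<in>Y. (\<otimes>) (fst p) ` \<Gamma> (n - snd p)))"

definition degree_pairs :: "('a \<times> int) set"
  where "degree_pairs = {(y, d). y \<in> \<Gamma> d}"

lemma symbol_ideal_gens:
  assumes "Y \<subseteq> degree_pairs"
  shows "\<Gamma> (n - 1) \<union> (\<Union>p\<in>Y. (\<otimes>) (fst p) ` \<Gamma> (n - snd p)) \<subseteq> \<Gamma> n"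
proof -
  have "y \<otimes> r \<in> \<Gamma> n" if "(y, d) \<in> Y" "r \<in> \<Gamma> (n - d)" for y d r
    using filt_mult[of y d r "n - d"] that assms unfolding degree_pairs_def by auto
  then show ?thesis using filt_le[of "n - 1" n] by auto
qed

lemma graded_symbol_ideal:
  assumes Y: "Y \<subseteq> degree_pairs"
  shows "graded_right_ideal (symbol_ideal Y)"
proof -
  let ?S = "\<lambda>n. \<Gamma> (n - 1) \<union> (\<Union>p\<in>Y. (\<otimes>) (fst p) ` \<Gamma> (n - snd p))"
  have gens: "?S n \<subseteq> \<Gamma> n" for n by (rule symbol_ideal_gens[OF Y])
  have car: "?S n \<subseteq> carrier R" for n using gens filt_carrier by blast
  have sub: "subspace (symbol_ideal Y n)" for n
    unfolding symbol_ideal_def by (rule subspace_lspan[OF car])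
  have mult: "x \<otimes> a \<in> symbol_ideal Y (n + j)" if x: "x \<in> symbol_ideal Y n" and a: "a \<in> \<Gamma> j" for x a n j
  proof -
    have ac: "a \<in> carrier R" using a filt_carrier by blast
    have "x \<otimes> a \<in> ?S (n + j)" if "x \<in> ?S n" for x
      using that
    proof
      assume "x \<in> \<Gamma> (n - 1)"
      then have "x \<otimes> a \<in> \<Gamma> (n + j - 1)" using filt_mult[OF _ a, of x "n - 1"] by (simp add: algebra_simps)
      then show ?thesis by blast
    next
      assume "x \<in> (\<Union>p\<in>Y. (\<otimes>) (fst p) ` \<Gamma> (n - snd p))"
      then obtain p r where p: "p \<in> Y" "r \<in> \<Gamma> (n - snd p)" "x = fst p \<otimes> r" by blast
      have "fst p \<in> carrier R" using p(1) Y filt_carrier unfolding degree_pairs_def by auto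
      then have "x \<otimes> a = fst p \<otimes> (r \<otimes> a)" using p filt_carrier ac by (simp add: m_assoc)
      moreover have "r \<otimes> a \<in> \<Gamma> (n + j - snd p)" using filt_mult[OF p(2) a] by (simp add: algebra_simps)
      ultimately show ?thesis using p(1) by blast
    qed
    then have "x \<otimes> a \<in> symbol_ideal Y (n + j)" if "x \<in> ?S n" for x
      unfolding symbol_ideal_def using that by (blast intro: hull_inc)
    then have "?S n \<subseteq> {x \<in> carrier R. x \<otimes> a \<in> symbol_ideal Y (n + j)}"
      using car[of n] by blast
    then have "symbol_ideal Y n \<subseteq> {x \<in> carrier R. x \<otimes> a \<in> symbol_ideal Y (n + j)}"
      unfolding symbol_ideal_def[of Y n] by (rule lspan_minimal[OF _ linear_vimage[OF linear_mult_right[OF ac] sub]])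
    then show ?thesis using x by blast
  qed
  have "\<Gamma> (n - 1) \<subseteq> symbol_ideal Y n" for n
    unfolding symbol_ideal_def by (auto intro: hull_inc)
  moreover have "symbol_ideal Y n \<subseteq> \<Gamma> n" for n
    unfolding symbol_ideal_def by (rule lspan_minimal[OF gens filt_subspace])
  ultimately show ?thesis unfolding graded_right_ideal_def using sub mult by simp
qed

text \<open>All that is used of the noetherian hypothesis on \<open>gr R\<close>: a finite set of symbols can be enlarged,
  subject to a property \<open>P\<close>, until no further admissible symbol is new. Otherwise the ideals of the
  successive sets would form a strictly ascending chain. With \<open>P\<close> restricting the symbols to a
  right ideal this yields finite generation; with \<open>P\<close> bounding the total weight of the symbols
  it limits the growth of \<open>gr R\<close>.\<close>

lemma gr_noetherian_maximal_symbols: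
  assumes noeth: "right_noetherian (gr R \<Gamma>)" and P: "P {}"
  shows "\<exists>Y. finite Y \<and> Y \<subseteq> degree_pairs \<and> P Y \<and>
    (\<forall>x d. x \<in> \<Gamma> d \<longrightarrow> P (insert (x, d) Y) \<longrightarrow> x \<in> symbol_ideal Y d)"
proof (rule ccontr)
  assume contr: "\<not> ?thesis"
  have "\<exists>Y. \<forall>k::nat. (finite (Y k) \<and> Y k \<subseteq> degree_pairs \<and> P (Y k)) \<and>
    (\<exists>x d. x \<in> \<Gamma> d \<and> x \<notin> symbol_ideal (Y k) d \<and> Y (Suc k) = insert (x, d) (Y k))"
  proof (rule dependent_nat_choice)
    show "\<exists>Y. finite Y \<and> Y \<subseteq> degree_pairs \<and> P Y" using P by (intro exI[of _ "{}"]) simp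
    fix Y and k :: nat assume Y: "finite Y \<and> Y \<subseteq> degree_pairs \<and> P Y"
    then obtain x d where xd: "x \<in> \<Gamma> d" "P (insert (x, d) Y)" "x \<notin> symbol_ideal Y d"
      using contr by blast
    then have "insert (x, d) Y \<subseteq> degree_pairs" using Y unfolding degree_pairs_def by simp
    then show "\<exists>Z. (finite Z \<and> Z \<subseteq> degree_pairs \<and> P Z) \<and>
      (\<exists>x d. x \<in> \<Gamma> d \<and> x \<notin> symbol_ideal Y d \<and> Z = insert (x, d) Y)"
      using xd Y by (intro exI[of _ "insert (x, d) Y"]) auto
  qed
  then obtain Y where Y: "\<forall>k::nat. (finite (Y k) \<and> Y k \<subseteq> degree_pairs \<and> P (Y k)) \<and>
    (\<exists>x d. x \<in> \<Gamma> d \<and> x \<notin> symbol_ideal (Y k) d \<and> Y (Suc k) = insert (x, d) (Y k))" ..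
  have "\<exists>N. \<forall>m\<ge>N. symbol_ideal (Y m) = symbol_ideal (Y N)"
  proof (rule gr_noetherian_stable[OF noeth])
    show "graded_right_ideal (symbol_ideal (Y m))" for m using Y graded_symbol_ideal by simp
    fix m n
    have "Y m \<subseteq> Y (Suc m)" using Y[rule_format, of m] by auto
    then show "symbol_ideal (Y m) n \<subseteq> symbol_ideal (Y (Suc m)) n"
      unfolding symbol_ideal_def by (intro hull_mono) blast
  qed
  then obtain N where "\<forall>m\<ge>N. symbol_ideal (Y m) = symbol_ideal (Y N)" ..
  then have N: "symbol_ideal (Y (Suc N)) = symbol_ideal (Y N)" using le_SucI by blast
  obtain x d where xd: "x \<in> \<Gamma> d" "x \<notin> symbol_ideal (Y N) d" "Y (Suc N) = insert (x, d) (Y N)"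
    using Y by blast
  have "x \<otimes> \<one> \<in> symbol_ideal (Y (Suc N)) d"
    unfolding symbol_ideal_def xd(3)
  proof (rule hull_inc, rule UnI2, rule UN_I)
    show "(x, d) \<in> insert (x, d) (Y N)" by simp
    show "x \<otimes> \<one> \<in> (\<otimes>) (fst (x, d)) ` \<Gamma> (d - snd (x, d))" using filt_one by simp
  qed
  then show False using N xd(2) filt_carrier[OF xd(1)] by simp
qed

end


section \<open>The Artin--Rees property\<close>

context algebra_over
begin

text \<open>Unlike membership in a span, the explicit coefficients \<open>r i\<close> can be added up in a convergent
  series, or compared with the coefficients of a relation between basis elements.\<close>

lemma lspan_UN_decomp:
  assumes Y: "finite Y" and W: "subspace W" and A: "\<And>i. i \<in> Y \<Longrightarrow> subspace (A i)"
    and e: "\<And>i. i \<in> Y \<Longrightarrow> e i \<in> carrier R"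
    and z: "z \<in> lspan (W \<union> (\<Union>i\<in>Y. (\<otimes>) (e i) ` A i))"
  shows "\<exists>w\<in>W. \<exists>r. (\<forall>i\<in>Y. r i \<in> A i) \<and> z = w \<oplus> (\<Oplus>i\<in>Y. e i \<otimes> r i)"
  using Y A e z
proof (induction Y arbitrary: z rule: finite_induct)
  case empty
  then have "z \<in> W" using lspan_self[OF W] by simp
  then show ?case using subspace_mem[OF W] by (intro bexI[of _ z]) auto
next
  case (insert i Y)
  let ?S = "W \<union> (\<Union>i\<in>Y. (\<otimes>) (e i) ` A i)"
  have Ac: "x \<in> carrier R" if "j \<in> insert i Y" "x \<in> A j" for j x
    using insert.prems(1)[OF that(1)] that(2) by (rule subspace_mem)
  have "e j \<otimes> x \<in> carrier R" if "j \<in> Y" "x \<in> A j" for j x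
    using insert.prems(2)[of j] Ac[of j x] that by simp
  then have "?S \<subseteq> carrier R" using subspace_mem[OF W] by auto
  then have L: "subspace (lspan ?S)" by (rule subspace_lspan)
  have E: "subspace ((\<otimes>) (e i) ` A i)"
    by (rule linear_image[OF linear_mult_left]) (use insert.prems in auto)
  have S: "?S \<subseteq> lspan ?S" by (rule hull_subset)
  have 1: "lspan ?S \<subseteq> lspan ?S <+>\<^bsub>R\<^esub> (\<otimes>) (e i) ` A i" by (rule set_add_upper1[OF L E])
  have 2: "(\<otimes>) (e i) ` A i \<subseteq> lspan ?S <+>\<^bsub>R\<^esub> (\<otimes>) (e i) ` A i" by (rule set_add_upper2[OF L E])
  have "W \<union> (\<Union>j\<in>insert i Y. (\<otimes>) (e j) ` A j) = ?S \<union> (\<otimes>) (e i) ` A i" by auto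
  also have "\<dots> \<subseteq> lspan ?S <+>\<^bsub>R\<^esub> (\<otimes>) (e i) ` A i"
    by (rule Un_least[OF subset_trans[OF S 1] 2])
  finally have "z \<in> lspan ?S <+>\<^bsub>R\<^esub> (\<otimes>) (e i) ` A i"
    using insert.prems(3) lspan_minimal[OF _ subspace_set_add[OF L E]] by blast
  then obtain l a where la: "l \<in> lspan ?S" "a \<in> A i" "z = l \<oplus> e i \<otimes> a"
    unfolding set_add_mem by blast
  obtain w r where wr: "w \<in> W" "\<forall>j\<in>Y. r j \<in> A j" "l = w \<oplus> (\<Oplus>j\<in>Y. e j \<otimes> r j)"
    using insert.IH[OF _ _ la(1)] insert.prems(1,2) by auto
  let ?r = "r(i := a)"
  have er: "e j \<otimes> r j \<in> carrier R" if "j \<in> Y" for j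
    using insert.prems(2)[of j] Ac[of j "r j"] wr(2) that by simp
  have eq: "(\<Oplus>j\<in>Y. e j \<otimes> ?r j) = (\<Oplus>j\<in>Y. e j \<otimes> r j)"
    by (rule M.finsum_cong') (use insert.hyps er in auto)
  have f: "(\<lambda>j. e j \<otimes> ?r j) \<in> Y \<rightarrow> carrier R" "(\<lambda>j. e j \<otimes> r j) \<in> Y \<rightarrow> carrier R"
    using insert.hyps er by auto
  have ea: "e i \<otimes> a \<in> carrier R" using insert.prems(2)[of i] Ac[of i a] la(2) by simp
  have "(\<Oplus>j\<in>insert i Y. e j \<otimes> ?r j) = e i \<otimes> a \<oplus> (\<Oplus>j\<in>Y. e j \<otimes> r j)"
    using M.finsum_insert[OF insert.hyps f(1)] ea eq by simp
  then have "z = w \<oplus> (\<Oplus>j\<in>insert i Y. e j \<otimes> ?r j)"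
    unfolding la(3) wr(3) using ea subspace_mem[OF W wr(1)] M.finsum_closed[OF f(2)]
    by (simp add: M.a_ac)
  then show ?case using wr(1,2) la(2) insert.hyps
    by (intro bexI[OF _ wr(1)] exI[of _ ?r]) auto
qed

lemma finsum_mult_add:
  assumes "\<And>i. i \<in> Y \<Longrightarrow> e i \<in> carrier R" "\<And>i. i \<in> Y \<Longrightarrow> r i \<in> carrier R" "\<And>i. i \<in> Y \<Longrightarrow> s i \<in> carrier R"
  shows "(\<Oplus>i\<in>Y. e i \<otimes> (r i \<oplus> s i)) = (\<Oplus>i\<in>Y. e i \<otimes> r i) \<oplus> (\<Oplus>i\<in>Y. e i \<otimes> s i)"
proof -
  have "(\<Oplus>i\<in>Y. e i \<otimes> (r i \<oplus> s i)) = (\<Oplus>i\<in>Y. e i \<otimes> r i \<oplus> e i \<otimes> s i)"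
    by (rule M.finsum_cong') (use assms in \<open>auto simp: r_distr\<close>)
  also have "\<dots> = (\<Oplus>i\<in>Y. e i \<otimes> r i) \<oplus> (\<Oplus>i\<in>Y. e i \<otimes> s i)"
    by (rule M.finsum_addf) (use assms in auto)
  finally show ?thesis .
qed

lemma finsum_mult_mem:
  assumes "subspace U" "\<And>i. i \<in> Y \<Longrightarrow> e i \<otimes> r i \<in> U"
  shows "(\<Oplus>i\<in>Y. e i \<otimes> r i) \<in> U"
  by (rule M.finsum_mem) (use assms subspace_zero subspace_add subspace_mem in auto)

lemma diff_add_cancel_right:
  assumes "a \<in> carrier R" "b \<in> carrier R" "c \<in> carrier R"
  shows "(a \<oplus> c) \<ominus> (b \<oplus> c) = a \<ominus> b"
proof -
  have "(a \<oplus> c) \<ominus> (b \<oplus> c) = a \<oplus> (c \<oplus> \<ominus> c) \<oplus> \<ominus> b"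
    using assms by (simp add: M.minus_eq M.minus_add M.a_ac del: M.r_neg)
  then show ?thesis using assms by (simp add: M.r_neg M.minus_eq)
qed

lemma diff_add_cancel:
  assumes "a \<in> carrier R" "b \<in> carrier R"
  shows "(a \<ominus> b) \<oplus> b = a" "(a \<oplus> b) \<ominus> b = a"
  using assms by (simp_all add: M.minus_eq M.a_assoc M.l_neg M.r_neg)

end

context weak_adic_alg
begin

text \<open>If the symbols of \<open>Y\<close> generate the graded right ideal of \<open>J\<close>, then \<open>Y\<close> generates \<open>J\<close> with
  control of the degrees. Successive approximation: a remainder \<open>x \<in> J\<close> of degree \<open>n - k\<close> is a
  combination of \<open>Y\<close> up to a remainder of degree \<open>n - k - 1\<close>, the coefficients found along the way
  form Cauchy sequences, and the difference between \<open>z\<close> and the combination with the limit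
  coefficients lies in every \<open>\<Gamma> i\<close>.\<close>

lemma symbol_generators_generate:
  assumes J: "right_ideal J R" and Y: "finite Y" "Y \<subseteq> degree_pairs" "\<And>p. p \<in> Y \<Longrightarrow> fst p \<in> J"
    and gen: "\<And>x n. \<lbrakk>x \<in> J; x \<in> \<Gamma> n\<rbrakk> \<Longrightarrow> x \<in> symbol_ideal Y n"
    and z: "z \<in> J" "z \<in> \<Gamma> n"
  shows "\<exists>r. (\<forall>p\<in>Y. r p \<in> \<Gamma> (n - snd p)) \<and> z = (\<Oplus>p\<in>Y. fst p \<otimes> r p)"
proof -
  note J' = right_idealD[OF J]
  have e: "fst p \<in> carrier R" if "p \<in> Y" for p using subspace_mem[OF J'(1) Y(3)[OF that]] .
  have eG: "fst p \<in> \<Gamma> (snd p)" if "p \<in> Y" for p using that Y(2) unfolding degree_pairs_def by auto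
  note c = filt_carrier
  let ?comb = "\<lambda>r. \<Oplus>p\<in>Y. fst p \<otimes> r p"
  have combJ: "?comb r \<in> J" if "\<And>p. p \<in> Y \<Longrightarrow> r p \<in> carrier R" for r
    by (rule finsum_mult_mem[OF J'(1)]) (use that J'(2) Y(3) in auto)
  have combG: "?comb r \<in> \<Gamma> m" if "\<And>p. p \<in> Y \<Longrightarrow> r p \<in> \<Gamma> (m - snd p)" for r m
  proof (rule finsum_mult_mem[OF filt_subspace])
    fix p assume p: "p \<in> Y"
    then show "fst p \<otimes> r p \<in> \<Gamma> m" using filt_mult[OF eG[OF p] that[OF p]] by simp
  qed
  \<comment> \<open>states are pairs of a remainder and the coefficients accumulated so far\<close>
  let ?P = "\<lambda>(k::nat) (x, r). x \<in> J \<and> x \<in> \<Gamma> (n - int k) \<and>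
    (\<forall>p\<in>Y. r p \<in> \<Gamma> (n - snd p)) \<and> z = x \<oplus> ?comb r"
  let ?Q = "\<lambda>(k::nat) (x, r) (x', r'). \<forall>p\<in>Y. r' p \<ominus> r p \<in> \<Gamma> (n - snd p - int k)"
  have "\<exists>f. \<forall>k. ?P k (f k) \<and> ?Q k (f k) (f (Suc k))"
  proof (rule dependent_nat_choice)
    have "?comb (\<lambda>_. \<zero>) = (\<Oplus>p\<in>Y. \<zero>)"
      by (rule M.finsum_cong') (use e in auto)
    then have "?comb (\<lambda>_. \<zero>) = \<zero>" by (simp add: M.finsum_zero)
    then have "?P 0 (z, \<lambda>_. \<zero>)"
      using z subspace_zero[OF filt_subspace] c by simp
    then show "\<exists>x. ?P 0 x" ..
  next
    fix a and k :: nat assume a: "?P k a"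
    obtain x r where xr: "a = (x, r)" by (cases a)
    from a have x: "x \<in> J" "x \<in> \<Gamma> (n - int k)" and r: "\<And>p. p \<in> Y \<Longrightarrow> r p \<in> \<Gamma> (n - snd p)"
      and zx: "z = x \<oplus> ?comb r" unfolding xr by auto
    have "x \<in> symbol_ideal Y (n - int k)" by (rule gen[OF x])
    then have "\<exists>w\<in>\<Gamma> (n - int k - 1). \<exists>s. (\<forall>p\<in>Y. s p \<in> \<Gamma> (n - int k - snd p)) \<and> x = w \<oplus> ?comb s"
      unfolding symbol_ideal_def
      by (intro lspan_UN_decomp Y(1) filt_subspace) (use e in auto)
    then obtain w s where ws: "w \<in> \<Gamma> (n - int k - 1)" "\<forall>p\<in>Y. s p \<in> \<Gamma> (n - int k - snd p)"
      "x = w \<oplus> ?comb s" by blast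
    let ?r = "\<lambda>p. s p \<oplus> r p"
    have rc: "r p \<in> carrier R" if "p \<in> Y" for p using c r[OF that] .
    have sc: "s p \<in> carrier R" if "p \<in> Y" for p using c ws(2) that by blast
    have Jc: "y \<in> J \<Longrightarrow> y \<in> carrier R" for y using subspace_mem[OF J'(1)] .
    have car: "?comb s \<in> carrier R" "?comb r \<in> carrier R" "w \<in> carrier R"
      using combJ[of s] combJ[of r] rc sc Jc c[OF ws(1)] by auto
    have "w = x \<ominus> ?comb s" unfolding ws(3) using car diff_add_cancel(2) by simp
    then have "w \<in> J" using x(1) combJ[of s] sc subspace_minus[OF J'(1)] by simp
    moreover have "z = w \<oplus> ?comb ?r"
    proof -
      have "?comb ?r = ?comb s \<oplus> ?comb r" by (rule finsum_mult_add) (use e rc sc in auto)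
      then show ?thesis unfolding zx ws(3) using car by (simp add: M.a_assoc)
    qed
    moreover have "?r p \<in> \<Gamma> (n - snd p)" if "p \<in> Y" for p
    proof -
      have "s p \<in> \<Gamma> (n - snd p)"
        using ws(2) that filt_le[of "n - int k - snd p" "n - snd p"] by auto
      then show ?thesis using r[OF that] subspace_add[OF filt_subspace] by simp
    qed
    moreover have "?r p \<ominus> r p \<in> \<Gamma> (n - snd p - int k)" if "p \<in> Y" for p
    proof -
      have "?r p \<ominus> r p = s p" using diff_add_cancel(2) rc sc that by simp
      then show ?thesis using ws(2) that by (simp add: algebra_simps)
    qed
    moreover have "w \<in> \<Gamma> (n - int (Suc k))" using ws(1) by (simp add: algebra_simps)
    ultimately have "?P (Suc k) (w, ?r) \<and> ?Q k a (w, ?r)" unfolding xr by simp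
    then show "\<exists>b. ?P (Suc k) b \<and> ?Q k a b" ..
  qed
  then obtain f where f: "\<forall>k. ?P k (f k) \<and> ?Q k (f k) (f (Suc k))" ..
  define x where "x k = fst (f k)" for k
  define r where "r k = snd (f k)" for k
  have x: "x k \<in> \<Gamma> (n - int k)" "z = x k \<oplus> ?comb (r k)" for k
    using f[rule_format, of k] unfolding x_def r_def by (auto simp: case_prod_unfold)
  have r: "r k p \<in> \<Gamma> (n - snd p)" "r (Suc k) p \<ominus> r k p \<in> \<Gamma> (n - snd p - int k)" if "p \<in> Y" for k p
    using f[rule_format, of k] that unfolding x_def r_def by (auto simp: case_prod_unfold)
  have "\<forall>p\<in>Y. \<exists>l. l \<in> carrier R \<and> (\<forall>k. l \<ominus> r k p \<in> \<Gamma> (n - snd p - int k))"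
  proof
    fix p assume p: "p \<in> Y"
    have "\<exists>l\<in>carrier R. \<forall>k. l \<ominus> r k p \<in> \<Gamma> (n - snd p - int k)"
      by (rule filt_complete) (use c[OF r(1)[OF p]] r(2)[OF p] in auto)
    then show "\<exists>l. l \<in> carrier R \<and> (\<forall>k. l \<ominus> r k p \<in> \<Gamma> (n - snd p - int k))" by blast
  qed
  from bchoice[OF this] obtain l where l: "\<And>p. p \<in> Y \<Longrightarrow> l p \<in> carrier R"
    "\<And>p k. p \<in> Y \<Longrightarrow> l p \<ominus> r k p \<in> \<Gamma> (n - snd p - int k)" by auto
  have lG: "l p \<in> \<Gamma> (n - snd p)" if p: "p \<in> Y" for p
  proof -
    have "(l p \<ominus> r 0 p) \<oplus> r 0 p \<in> \<Gamma> (n - snd p)"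
      using l(2)[OF p, of 0] r(1)[OF p, of 0] subspace_add[OF filt_subspace] by simp
    then show ?thesis using diff_add_cancel(1) l(1)[OF p] c[OF r(1)[OF p]] by simp
  qed
  have diff: "z \<ominus> ?comb l \<in> \<Gamma> (n - int k)" for k
  proof -
    let ?d = "\<lambda>p. l p \<ominus> r k p"
    have rc: "r k p \<in> carrier R" if "p \<in> Y" for p using c[OF r(1)[OF that]] .
    have dc: "?d p \<in> carrier R" if "p \<in> Y" for p using c[OF l(2)[OF that]] .
    have cc: "?comb s \<in> carrier R" if "\<And>p. p \<in> Y \<Longrightarrow> s p \<in> carrier R" for s
      using combJ[of s] that subspace_mem[OF J'(1)] by simp
    have "?comb l = ?comb (\<lambda>p. ?d p \<oplus> r k p)"
      by (rule M.finsum_cong') (use e l(1) rc diff_add_cancel(1) in auto)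
    also have "\<dots> = ?comb ?d \<oplus> ?comb (r k)"
      by (rule finsum_mult_add) (use e dc rc in auto)
    finally have "z \<ominus> ?comb l = (x k \<oplus> ?comb (r k)) \<ominus> (?comb ?d \<oplus> ?comb (r k))"
      using x(2)[of k] by simp
    also have "\<dots> = x k \<ominus> ?comb ?d"
      by (rule diff_add_cancel_right[OF c[OF x(1)] cc cc]) (use dc rc in auto)
    also have "\<dots> \<in> \<Gamma> (n - int k)"
      by (rule subspace_minus[OF filt_subspace x(1) combG]) (use l(2) in \<open>simp add: algebra_simps\<close>)
    finally show ?thesis .
  qed
  have "z \<ominus> ?comb l \<in> \<Gamma> i" for i
  proof -
    have "\<Gamma> (n - int (nat (n - i))) \<subseteq> \<Gamma> i" by (rule filt_le) linarith
    then show ?thesis using diff[of "nat (n - i)"] by blast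
  qed
  then have "z \<ominus> ?comb l = \<zero>" using filt_separated by blast
  moreover have "?comb l \<in> carrier R" using combJ[of l] l(1) subspace_mem[OF J'(1)] by simp
  ultimately have "z = ?comb l" using diff_add_cancel(1)[of z "?comb l"] c[OF z(2)] by simp
  then show ?thesis using lG by blast
qed

text \<open>Choose finitely many elements of \<open>J\<close> whose symbols generate all symbols of elements of \<open>J\<close>.
  Their degrees are bounded below, which gives the constant \<open>c\<close>.\<close>

lemma artin_rees:
  assumes noeth: "right_noetherian (gr R \<Gamma>)" and J: "right_ideal J R"
  shows "\<exists>c::nat. \<forall>n. J \<inter> \<Gamma> (- int (n + c)) \<subseteq> lspan (\<Union>y\<in>J. (\<otimes>) y ` \<Gamma> (- int n))"
proof -
  obtain Y where Y: "finite Y" "Y \<subseteq> degree_pairs" "\<forall>p\<in>Y. fst p \<in> J"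
    and gen: "\<forall>x d. x \<in> \<Gamma> d \<longrightarrow> (\<forall>p\<in>insert (x, d) Y. fst p \<in> J) \<longrightarrow> x \<in> symbol_ideal Y d"
    using gr_noetherian_maximal_symbols[OF noeth, of "\<lambda>Y. \<forall>p\<in>Y. fst p \<in> J"] by auto
  define c where "c = (\<Sum>p\<in>Y. nat (- snd p))"
  have cp: "- snd p \<le> int c" if "p \<in> Y" for p
  proof -
    have "nat (- snd p) \<le> c" unfolding c_def by (rule member_le_sum[OF that]) (use Y(1) in auto)
    then show ?thesis by linarith
  qed
  have Jc: "y \<in> carrier R" if "y \<in> J" for y
    using subspace_mem[OF right_idealD(1)[OF J] that] .
  have "z \<in> lspan (\<Union>y\<in>J. (\<otimes>) y ` \<Gamma> (- int n))" if z: "z \<in> J" "z \<in> \<Gamma> (- int (n + c))" for z n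
  proof -
    obtain r where r: "\<forall>p\<in>Y. r p \<in> \<Gamma> (- int (n + c) - snd p)" "z = (\<Oplus>p\<in>Y. fst p \<otimes> r p)"
      using symbol_generators_generate[OF J Y(1,2) _ _ z] Y(3) gen by auto
    have car: "(\<Union>y\<in>J. (\<otimes>) y ` \<Gamma> (- int n)) \<subseteq> carrier R"
      using Jc filt_carrier by auto
    show ?thesis unfolding r(2)
    proof (rule finsum_mult_mem[OF subspace_lspan[OF car]])
      fix p assume p: "p \<in> Y"
      then have "r p \<in> \<Gamma> (- int n)"
        using r(1) filt_le[of "- int (n + c) - snd p" "- int n"] cp[OF p] by auto
      then show "fst p \<otimes> r p \<in> lspan (\<Union>y\<in>J. (\<otimes>) y ` \<Gamma> (- int n))"
        using Y(3) p by (intro hull_inc) blast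
    qed
  qed
  then show ?thesis by blast
qed


section \<open>Growth\<close>

abbreviation hilbert :: "int \<Rightarrow> nat"
  where "hilbert i \<equiv> rdim (\<Gamma> (i - 1)) (\<Gamma> i)"

lemma hilbert_pos_degree: "i > 0 \<Longrightarrow> hilbert i = 0"
  using rdim_le[of "\<Gamma> (i - 1)" "\<Gamma> i" 0] generated_over_0[OF filt_subspace[of "i - 1"], of "\<Gamma> i"]
    filt_nonneg[of i] filt_nonneg[of "i - 1"]
  by simp

text \<open>The argument of Stephenson and Zhang: a right noetherian graded algebra has subexponential growth.
  Choose symbols as long as the weights \<open>\<rho>\<^sup>d\<close> of their (negative) degrees \<open>d\<close> sum up to less than \<open>1\<close>.
  In degrees far from \<open>0\<close> the weight of a further symbol is negligible, so when the process
  stops, all elements of such degrees lie in the ideal of the chosen symbols. This bounds the Hilbert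
  function by the sum of its translates by the degrees of the chosen symbols, and
  \<open>C \<rho>\<^sup>n\<close> satisfies the resulting recursive inequality precisely because the weights sum up to less than \<open>1\<close>.\<close>

lemma subexponential_hilbert:
  assumes noeth: "right_noetherian (gr R \<Gamma>)" and \<rho>: "(\<rho>::real) > 1"
  shows "\<exists>C. \<forall>n::nat. real (hilbert (- int n)) \<le> C * \<rho> ^ n"
proof -
  have \<rho>0: "\<rho> > 0" using \<rho> by simp
  obtain Y where Y: "finite Y" "Y \<subseteq> degree_pairs" "(\<Sum>p\<in>Y. \<rho> powi snd p) < 1"
    and gen: "\<forall>x d. x \<in> \<Gamma> d \<longrightarrow> (\<Sum>p\<in>insert (x, d) Y. \<rho> powi snd p) < 1 \<longrightarrow> x \<in> symbol_ideal Y d"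
    using gr_noetherian_maximal_symbols[OF noeth, of "\<lambda>Y. (\<Sum>p\<in>Y. \<rho> powi snd p) < 1"] by auto
  have neg: "snd p < 0" if p: "p \<in> Y" for p
  proof (rule ccontr)
    assume "\<not> snd p < 0"
    then have "1 \<le> \<rho> powi snd p" using \<rho> one_le_power[of \<rho> "nat (snd p)"] by (simp add: power_int_def)
    also have "\<dots> \<le> (\<Sum>p\<in>Y. \<rho> powi snd p)"
      by (rule member_le_sum[OF p]) (use \<rho>0 Y(1) in auto)
    finally show False using Y(3) by simp
  qed
  have "(\<lambda>n. (1 / \<rho>) ^ n) \<longlonglongrightarrow> 0" using \<rho> by (intro LIMSEQ_realpow_zero) auto
  then have "eventually (\<lambda>n. (1 / \<rho>) ^ n < 1 - (\<Sum>p\<in>Y. \<rho> powi snd p)) sequentially"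
    using Y(3) by (intro order_tendstoD) auto
  then obtain n0 where n0: "\<And>n. n \<ge> n0 \<Longrightarrow> (1 / \<rho>) ^ n < 1 - (\<Sum>p\<in>Y. \<rho> powi snd p)"
    unfolding eventually_sequentially by blast
  have rec: "hilbert (- int n) \<le> (\<Sum>p\<in>Y. hilbert (- int n - snd p))" if n: "n \<ge> n0" for n
  proof (rule rdim_le, rule generated_over_UN_image[OF Y(1)])
    show "linear ((\<otimes>) (fst p))" if "p \<in> Y" for p
      using that Y(2) filt_carrier unfolding degree_pairs_def by (intro linear_mult_left) auto
    show "generated_over (\<Gamma> (- int n - snd p - 1)) (\<Gamma> (- int n - snd p)) (hilbert (- int n - snd p))" for p
      by (rule generated_over_rdim[OF finite_over_filt_step])
    show "\<Gamma> (- int n - snd p - 1) \<subseteq> carrier R" for p using filt_carrier by blast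
    show "subspace (\<Gamma> (- int n - 1))" by (rule filt_subspace)
    show "(\<otimes>) (fst p) ` \<Gamma> (- int n - snd p - 1) \<subseteq> \<Gamma> (- int n - 1)" if p: "p \<in> Y" for p
    proof
      fix y assume "y \<in> (\<otimes>) (fst p) ` \<Gamma> (- int n - snd p - 1)"
      then obtain r where r: "r \<in> \<Gamma> (- int n - snd p - 1)" "y = fst p \<otimes> r" by blast
      have "fst p \<in> \<Gamma> (snd p)" using p Y(2) unfolding degree_pairs_def by auto
      from filt_mult[OF this r(1)] show "y \<in> \<Gamma> (- int n - 1)" unfolding r(2) by simp
    qed
    have "x \<in> symbol_ideal Y (- int n)" if x: "x \<in> \<Gamma> (- int n)" for x
    proof -
      have "(\<Sum>p\<in>insert (x, - int n) Y. \<rho> powi snd p) \<le> \<rho> powi (- int n) + (\<Sum>p\<in>Y. \<rho> powi snd p)"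
        using Y(1) \<rho>0 by (cases "(x, - int n) \<in> Y") (auto simp: insert_absorb)
      also have "\<rho> powi (- int n) = (1 / \<rho>) ^ n" by (simp add: power_int_minus field_simps)
      finally show ?thesis using gen x n0[OF n] by auto
    qed
    then show "\<Gamma> (- int n) \<subseteq> lspan (\<Gamma> (- int n - 1) \<union> (\<Union>p\<in>Y. (\<otimes>) (fst p) ` \<Gamma> (- int n - snd p)))"
      unfolding symbol_ideal_def by blast
  qed
  define C where "C = (\<Sum>i<n0. real (hilbert (- int i)))"
  have C0: "C \<ge> 0" unfolding C_def by (simp add: sum_nonneg)
  have "real (hilbert (- int n)) \<le> C * \<rho> ^ n" for n
  proof (induction n rule: less_induct)
    case (less n)
    show ?case
    proof (cases "n < n0")
      case True
      then have "real (hilbert (- int n)) \<le> C"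
        unfolding C_def using member_le_sum[of n "{..<n0}" "\<lambda>i. real (hilbert (- int i))"] by simp
      also have "C \<le> C * \<rho> ^ n" using C0 \<rho> by (simp add: mult_le_cancel_left1 one_le_power)
      finally show ?thesis .
    next
      case False
      have "real (hilbert (- int n)) \<le> (\<Sum>p\<in>Y. real (hilbert (- int n - snd p)))"
        using rec[of n] False by (simp flip: of_nat_sum)
      also have "\<dots> \<le> (\<Sum>p\<in>Y. C * \<rho> ^ n * \<rho> powi snd p)"
      proof (rule sum_mono)
        fix p assume p: "p \<in> Y"
        show "real (hilbert (- int n - snd p)) \<le> C * \<rho> ^ n * \<rho> powi snd p"
        proof (cases "- int n - snd p > 0")
          case True
          then show ?thesis using hilbert_pos_degree C0 \<rho>0 by simp
        next
          case le: False
          define m where "m = nat (int n + snd p)"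
          have m: "int m = int n + snd p" "m < n" unfolding m_def using le neg[OF p] by auto
          have "- int n - snd p = - int m" using m(1) by simp
          then have "real (hilbert (- int n - snd p)) \<le> C * \<rho> ^ m" using less[OF m(2)] by simp
          also have "\<rho> ^ m = \<rho> powi (int n + snd p)" by (simp flip: m(1))
          also have "\<dots> = \<rho> ^ n * \<rho> powi snd p" using \<rho>0 by (simp add: power_int_add)
          finally show ?thesis by (simp add: mult.assoc)
        qed
      qed
      also have "\<dots> = C * \<rho> ^ n * (\<Sum>p\<in>Y. \<rho> powi snd p)" by (simp add: sum_distrib_left)
      also have "\<dots> \<le> C * \<rho> ^ n * 1"
        using Y(3) C0 \<rho>0 by (intro mult_left_mono) auto
      finally show ?thesis by simp
    qed
  qed
  then show ?thesis by blast
qed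

lemma subexponential_growth:
  assumes noeth: "right_noetherian (gr R \<Gamma>)" and \<rho>: "(\<rho>::real) > 1"
  shows "\<exists>C. \<forall>n::nat. real (rdim (\<Gamma> (- int n)) (carrier R)) \<le> C * \<rho> ^ n"
proof -
  obtain C where C: "\<And>n::nat. real (hilbert (- int n)) \<le> C * \<rho> ^ n"
    using subexponential_hilbert[OF assms] by blast
  have "0 \<le> real (hilbert (- int 0))" by simp
  also have "\<dots> \<le> C" using C[of 0] by simp
  finally have C0: "C \<ge> 0" .
  have "real (rdim (\<Gamma> (- int n)) (carrier R)) \<le> C / (\<rho> - 1) * \<rho> ^ n" for n
  proof -
    have "real (rdim (\<Gamma> (- int n)) (carrier R)) \<le> (\<Sum>i<n. real (hilbert (- int i)))"
      using rdim_le[OF generated_over_filt[of n]] by (simp flip: of_nat_sum)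
    also have "\<dots> \<le> (\<Sum>i<n. C * \<rho> ^ i)" by (intro sum_mono C)
    also have "\<dots> = C * ((\<rho> ^ n - 1) / (\<rho> - 1))"
      using \<rho> by (simp add: sum_distrib_left[symmetric] geometric_sum)
    also have "\<dots> \<le> C * (\<rho> ^ n / (\<rho> - 1))"
      using \<rho> C0 by (intro mult_left_mono divide_right_mono) auto
    finally show ?thesis by simp
  qed
  then show ?thesis by blast
qed

end


section \<open>Comparing the two ranks\<close>

text \<open>With \<open>q = t/s > 1\<close> the first premise makes \<open>d\<close> grow at least like \<open>q\<^sup>k\<close> along a progression of
  step \<open>c\<close>. The rate \<open>\<rho>\<close> with \<open>\<rho>\<^sup>2\<^sup>c = q\<close> is too small for this, yet exceeds \<open>1\<close>.\<close>

lemma no_exponential_growth: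
  fixes d :: "nat \<Rightarrow> nat"
  assumes rec: "\<And>n. t * d n \<le> s * d (n + c)" and st: "s < t" and pos: "d n0 > 0"
    and sub: "\<And>\<rho>::real. \<rho> > 1 \<Longrightarrow> \<exists>C. \<forall>n. real (d n) \<le> C * \<rho> ^ n"
  shows False
proof -
  have s: "s > 0" using rec[of n0] st pos by (cases "s = 0") auto
  have c: "c > 0"
  proof (rule ccontr)
    assume "\<not> c > 0"
    then have "t * d n0 \<le> s * d n0" using rec[of n0] by simp
    then show False using st pos by simp
  qed
  define q where "q = real t / real s"
  have q: "q > 1" unfolding q_def using s st by simp
  have step: "q * real (d n) \<le> real (d (n + c))" for n
  proof -
    have "real t * real (d n) \<le> real s * real (d (n + c))"
      using rec[of n] by (metis of_nat_le_iff of_nat_mult)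
    then show ?thesis unfolding q_def using s by (simp add: field_simps)
  qed
  have grow: "q ^ k \<le> real (d (n0 + k * c))" for k
  proof (induction k)
    case 0
    then show ?case using pos by simp
  next
    case (Suc k)
    have "q ^ Suc k \<le> q * real (d (n0 + k * c))" using Suc q by simp
    also have "\<dots> \<le> real (d (n0 + Suc k * c))" using step[of "n0 + k * c"] by (simp add: add_ac)
    finally show ?case .
  qed
  define \<rho> where "\<rho> = root (2 * c) q"
  have \<rho>: "\<rho> > 1" "\<rho> ^ (2 * c) = q"
    unfolding \<rho>_def using q c by (simp_all add: real_root_pow_pos2)
  obtain C where C: "\<And>n. real (d n) \<le> C * \<rho> ^ n" using sub[OF \<rho>(1)] by blast
  have "(\<rho> ^ c) ^ k \<le> C * \<rho> ^ n0" for k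
  proof -
    have "\<rho> ^ c * \<rho> ^ c = q" using \<rho>(2) by (simp add: mult_2 power_add)
    then have "(\<rho> ^ c) ^ k * (\<rho> ^ c) ^ k = q ^ k" by (simp flip: power_mult_distrib)
    also have "\<dots> \<le> C * \<rho> ^ (n0 + k * c)" using grow C order_trans by blast
    also have "\<dots> = (C * \<rho> ^ n0) * (\<rho> ^ c) ^ k" by (simp add: power_add power_mult mult.commute)
    finally show ?thesis using \<rho>(1) by simp
  qed
  moreover have "\<rho> ^ c > 1" using \<rho>(1) c by (simp add: one_less_power)
  ultimately show False using real_arch_pow[of "\<rho> ^ c" "C * \<rho> ^ n0"] by (meson not_le)
qed

locale ideal_subquotient = algebra_over K R
  for K :: "('k, 'c) ring_scheme" and R :: "('k, 'a, 'd) module_scheme" (structure) +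
  fixes I J1 J2 :: "'a set"
  assumes I: "ideal I R" and J1: "ideal J1 R" and J2: "ideal J2 R" and J12: "J1 \<subseteq> J2"
    and left_annihilates: "\<And>a x. \<lbrakk>a \<in> I; x \<in> J2\<rbrakk> \<Longrightarrow> a \<otimes> x \<in> J1"
    and right_annihilates: "\<And>a x. \<lbrakk>a \<in> I; x \<in> J2\<rbrakk> \<Longrightarrow> x \<otimes> a \<in> J1"
begin

lemma right_ideal_if_ideal: "ideal J R \<Longrightarrow> right_ideal J R"
  unfolding right_ideal_def by (simp add: ideal.axioms(1) ideal.I_r_closed)

lemmas sI = right_idealD(1)[OF right_ideal_if_ideal[OF I]]
  and sJ1 = right_idealD(1)[OF right_ideal_if_ideal[OF J1]]
  and sJ2 = right_idealD(1)[OF right_ideal_if_ideal[OF J2]]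

lemma quot_carrier: "carrier (R Quot I) = (\<lambda>r. I +> r) ` carrier R"
  by (auto simp: FactRing_def A_RCOSETS_def')

lemma left_action:
  assumes r: "r \<in> carrier R" and x: "x \<in> J2"
  shows "rcoset_mult R J1 (I +> r) (J1 +> x) = J1 +> (r \<otimes> x)"
proof (rule rcoset_mult_cosets[OF sI sJ1 sJ1 r subspace_mem[OF sJ2 x]])
  fix p v assume p: "p \<in> I" and v: "v \<in> J1 +> x"
  have "J1 +> x \<subseteq> J2" by (rule coset_subset[OF sJ2 J12 x])
  then show "p \<otimes> v \<in> J1" using left_annihilates p v by blast
qed (rule ideal.I_l_closed[OF J1 _ r])

lemma right_action:
  assumes r: "r \<in> carrier R" and x: "x \<in> J2"
  shows "rcoset_mult R J1 (J1 +> x) (I +> r) = J1 +> (x \<otimes> r)"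
proof (rule rcoset_mult_cosets[OF sJ1 sI sJ1 subspace_mem[OF sJ2 x] r])
  fix p v assume p: "p \<in> J1" and v: "v \<in> I +> r"
  have "I +> r \<subseteq> carrier R"
    by (rule coset_subset[OF subspace_carrier _ r]) (use subspace_mem[OF sI] in blast)
  then show "p \<otimes> v \<in> J1" using ideal.I_r_closed[OF J1 p] v by blast
qed (rule right_annihilates[OF _ x])

lemma basis_representatives:
  assumes "is_basis A (subquotient R J2 J1 act) n e"
  shows "\<exists>g. \<forall>i<n. g i \<in> J2 \<and> e i = J1 +> g i"
proof -
  have "e \<in> {..<n} \<rightarrow> (\<lambda>x. J1 +> x) ` J2"
    using assms unfolding is_basis_def by (simp add: subquotient_def)
  then have "\<forall>i\<in>{..<n}. \<exists>x. x \<in> J2 \<and> e i = J1 +> x" by blast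
  from bchoice[OF this] show ?thesis by (simp add: lessThan_def)
qed

lemma left_basis_generates:
  assumes "is_basis (R Quot I) (left_quotient R J2 J1) s e"
  shows "\<exists>g. (\<forall>i<s. g i \<in> J2) \<and> J2 \<subseteq> lspan (J1 \<union> (\<Union>i<s. (\<lambda>r. r \<otimes> g i) ` carrier R))"
proof -
  note b = assms[unfolded left_quotient_def]
  obtain g where g: "\<forall>i<s. g i \<in> J2 \<and> e i = J1 +> g i" using basis_representatives[OF b] ..
  have "J2 \<subseteq> lspan (J1 \<union> (\<Union>i<s. (\<lambda>r. r \<otimes> g i) ` carrier R))"
  proof (rule basis_spans[OF sJ1 sJ2 J12 b])
    fix i a assume i: "i < s" and "a \<in> carrier (R Quot I)"
    then obtain r where r: "r \<in> carrier R" "a = I +> r" unfolding quot_carrier by blast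
    show "\<exists>r\<in>carrier R. rcoset_mult R J1 a (e i) = J1 +> (r \<otimes> g i)"
      using left_action[OF r(1)] g i r by (intro bexI[OF _ r(1)]) simp
  qed (use g ideal.I_l_closed[OF J2] in auto)
  then show ?thesis using g by blast
qed

lemma right_basis_generates:
  assumes "is_basis (R Quot I) (right_quotient R J2 J1) t e"
  shows "\<exists>g. (\<forall>i<t. g i \<in> J2) \<and> J2 \<subseteq> lspan (J1 \<union> (\<Union>i<t. (\<otimes>) (g i) ` carrier R)) \<and>
    (\<forall>r. (\<forall>i<t. r i \<in> carrier R) \<longrightarrow> (\<Oplus>i\<in>{..<t}. g i \<otimes> r i) \<in> J1 \<longrightarrow> (\<forall>i<t. r i \<in> I))"
proof -
  note b = assms[unfolded right_quotient_def]
  obtain g where g: "\<forall>i<t. g i \<in> J2 \<and> e i = J1 +> g i" using basis_representatives[OF b] ..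
  have span: "J2 \<subseteq> lspan (J1 \<union> (\<Union>i<t. (\<otimes>) (g i) ` carrier R))"
  proof (rule basis_spans[OF sJ1 sJ2 J12 b])
    fix i a assume i: "i < t" and "a \<in> carrier (R Quot I)"
    then obtain r where r: "r \<in> carrier R" "a = I +> r" unfolding quot_carrier by blast
    show "\<exists>r\<in>carrier R. rcoset_mult R J1 (e i) a = J1 +> (g i \<otimes> r)"
      using right_action[OF r(1)] g i r by (intro bexI[OF _ r(1)]) simp
  qed (use g ideal.I_r_closed[OF J2] in auto)
  let ?Q = "subquotient R J2 J1 (\<lambda>A X. rcoset_mult R J1 X A)"
  interpret Q: abelian_group ?Q
    by (rule M.subquotient_abelian_group) (use sJ1 sJ2 J12 subspace_additive_subgroup in auto)
  have sm: "a \<odot>\<^bsub>?Q\<^esub> X = rcoset_mult R J1 X a" "\<zero>\<^bsub>?Q\<^esub> = J1" for a X by (simp_all add: subquotient_def)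
  define coef where "coef r = (\<lambda>i\<in>{..<t}. I +> r i)" for r
  have comb: "(\<Oplus>\<^bsub>?Q\<^esub>i\<in>{..<t}. coef r i \<odot>\<^bsub>?Q\<^esub> e i) = J1"
    if r: "\<forall>i<t. r i \<in> carrier R" and z: "(\<Oplus>i\<in>{..<t}. g i \<otimes> r i) \<in> J1" for r
  proof -
    have gr: "g i \<otimes> r i \<in> J2" if "i \<in> {..<t}" for i using g r that ideal.I_r_closed[OF J2] by simp
    have "(\<Oplus>\<^bsub>?Q\<^esub>i\<in>{..<t}. coef r i \<odot>\<^bsub>?Q\<^esub> e i) = (\<Oplus>\<^bsub>?Q\<^esub>i\<in>{..<t}. J1 +> (g i \<otimes> r i))"
    proof (rule Q.finsum_cong')
      show "(\<lambda>i. J1 +> (g i \<otimes> r i)) \<in> {..<t} \<rightarrow> carrier ?Q" using gr by (auto simp: subquotient_def)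
      fix i assume i: "i \<in> {..<t}"
      then show "coef r i \<odot>\<^bsub>?Q\<^esub> e i = J1 +> (g i \<otimes> r i)"
        unfolding sm coef_def using g r right_action[of "r i" "g i"] by simp
    qed simp
    also have "\<dots> = J1 +> (\<Oplus>i\<in>{..<t}. g i \<otimes> r i)"
      by (rule finsum_cosets[OF sJ1 sJ2 J12]) (use gr in auto)
    also have "\<dots> = J1"
      using z abelian_subgroup.a_rcos_const[OF abelian_subgroupI3[OF subspace_additive_subgroup[OF sJ1]
            M.abelian_group_axioms]] by simp
    finally show ?thesis .
  qed
  have indep: "\<forall>i<t. r i \<in> I"
    if r: "\<forall>i<t. r i \<in> carrier R" and z: "(\<Oplus>i\<in>{..<t}. g i \<otimes> r i) \<in> J1" for r
  proof -
    have coefE: "coef r' \<in> {..<t} \<rightarrow>\<^sub>E carrier (R Quot I)" if "\<forall>i<t. r' i \<in> carrier R" for r'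
      unfolding coef_def quot_carrier using that by auto
    have "(\<Oplus>i\<in>{..<t}. g i \<otimes> \<zero>) = (\<Oplus>i\<in>{..<t}. \<zero>)"
      by (rule M.finsum_cong') (use g subspace_mem[OF sJ2] in auto)
    then have z0: "(\<Oplus>i\<in>{..<t}. g i \<otimes> \<zero>) \<in> J1" using subspace_zero[OF sJ1] by (simp add: M.finsum_zero)
    have "J1 \<in> carrier ?Q" using Q.zero_closed unfolding sm .
    then have "\<exists>!c. c \<in> {..<t} \<rightarrow>\<^sub>E carrier (R Quot I) \<and> J1 = (\<Oplus>\<^bsub>?Q\<^esub>i\<in>{..<t}. c i \<odot>\<^bsub>?Q\<^esub> e i)"
      using b unfolding is_basis_def by simp
    moreover have "coef r \<in> {..<t} \<rightarrow>\<^sub>E carrier (R Quot I) \<and> J1 = (\<Oplus>\<^bsub>?Q\<^esub>i\<in>{..<t}. coef r i \<odot>\<^bsub>?Q\<^esub> e i)"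
      using coefE[OF r] comb[OF r z] by simp
    moreover have "coef (\<lambda>_. \<zero>) \<in> {..<t} \<rightarrow>\<^sub>E carrier (R Quot I) \<and>
        J1 = (\<Oplus>\<^bsub>?Q\<^esub>i\<in>{..<t}. coef (\<lambda>_. \<zero>) i \<odot>\<^bsub>?Q\<^esub> e i)"
      using coefE[of "\<lambda>_. \<zero>"] comb[of "\<lambda>_. \<zero>"] z0 by simp
    ultimately have eq: "coef r = coef (\<lambda>_. \<zero>)" by (metis (no_types))
    show ?thesis
    proof (intro allI impI)
      fix i assume i: "i < t"
      have "I +> r i = I +> \<zero>" using fun_cong[OF eq, of i] i unfolding coef_def by simp
      also have "\<dots> = I" using M.a_coset_add_zero subspace_mem[OF sI] by blast
      finally show "r i \<in> I" using coset_self[OF sI, of "r i"] r i by simp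
    qed
  qed
  show ?thesis using g span indep by blast
qed

text \<open>The upper bound: \<open>J2/J1\<close> is the sum of the \<open>s\<close> images of \<open>R\<close> under \<open>r \<mapsto> r g\<^sub>i\<close>, and these maps
  send \<open>I\<close> into \<open>J1\<close> and \<open>F\<close> into \<open>J2 \<inter> F\<close>.\<close>

lemma left_rank_bound:
  assumes g: "\<forall>i<s. g i \<in> J2" and span: "J2 \<subseteq> lspan (J1 \<union> (\<Union>i<s. (\<lambda>r. r \<otimes> g i) ` carrier R))"
    and F: "right_ideal F R" and fin: "finite_over F (carrier R)"
  shows "generated_over (J1 <+>\<^bsub>R\<^esub> (J2 \<inter> F)) J2 (s * rdim (I <+>\<^bsub>R\<^esub> F) (carrier R))"
proof -
  note sF = right_idealD(1)[OF F]
  have sIF: "subspace (I <+>\<^bsub>R\<^esub> F)" by (rule subspace_set_add[OF sI sF])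
  have sT: "subspace (J1 <+>\<^bsub>R\<^esub> (J2 \<inter> F))" by (rule subspace_set_add[OF sJ1 subspace_Int[OF sJ2 sF]])
  have "generated_over (J1 <+>\<^bsub>R\<^esub> (J2 \<inter> F)) J2 (\<Sum>i<s. rdim (I <+>\<^bsub>R\<^esub> F) (carrier R))"
  proof (rule generated_over_UN_image)
    show "linear (\<lambda>r. r \<otimes> g i)" if "i \<in> {..<s}" for i
      using that g subspace_mem[OF sJ2] by (intro linear_mult_right) simp
    show "generated_over (I <+>\<^bsub>R\<^esub> F) (carrier R) (rdim (I <+>\<^bsub>R\<^esub> F) (carrier R))"
      by (rule generated_over_rdim[OF rdim_antimono(1)[OF fin set_add_upper2[OF sI sF]]])
    show "I <+>\<^bsub>R\<^esub> F \<subseteq> carrier R" using subspace_mem[OF sIF] by blast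
    show "(\<lambda>r. r \<otimes> g i) ` (I <+>\<^bsub>R\<^esub> F) \<subseteq> J1 <+>\<^bsub>R\<^esub> (J2 \<inter> F)" if "i \<in> {..<s}" for i
    proof (rule image_subsetI)
      have gi: "g i \<in> J2" "g i \<in> carrier R" using that g subspace_mem[OF sJ2] by auto
      fix x assume "x \<in> I <+>\<^bsub>R\<^esub> F"
      then obtain a b where ab: "a \<in> I" "b \<in> F" "x = a \<oplus> b" unfolding set_add_mem by blast
      have c: "a \<in> carrier R" "b \<in> carrier R" using ab subspace_mem[OF sI] subspace_mem[OF sF] by auto
      have "x \<otimes> g i = a \<otimes> g i \<oplus> b \<otimes> g i" unfolding ab(3) by (rule l_distr[OF c gi(2)])
      moreover have "a \<otimes> g i \<in> J1" by (rule left_annihilates[OF ab(1) gi(1)])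
      moreover have "b \<otimes> g i \<in> J2 \<inter> F"
        using ideal.I_l_closed[OF J2 gi(1) c(2)] right_idealD(2)[OF F ab(2) gi(2)] by simp
      ultimately show "x \<otimes> g i \<in> J1 <+>\<^bsub>R\<^esub> (J2 \<inter> F)" unfolding set_add_mem by blast
    qed
    have "J1 \<subseteq> J1 <+>\<^bsub>R\<^esub> (J2 \<inter> F)" by (rule set_add_upper1[OF sJ1 subspace_Int[OF sJ2 sF]])
    then have "lspan (J1 \<union> (\<Union>i<s. (\<lambda>r. r \<otimes> g i) ` carrier R)) \<subseteq>
      lspan ((J1 <+>\<^bsub>R\<^esub> (J2 \<inter> F)) \<union> (\<Union>i\<in>{..<s}. (\<lambda>r. r \<otimes> g i) ` carrier R))"
      by (intro hull_mono Un_mono order_refl)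
    then show "J2 \<subseteq> lspan ((J1 <+>\<^bsub>R\<^esub> (J2 \<inter> F)) \<union> (\<Union>i\<in>{..<s}. (\<lambda>r. r \<otimes> g i) ` carrier R))"
      using span by blast
  qed (use sT in auto)
  then show ?thesis by simp
qed

text \<open>The lower bound: since the \<open>g\<^sub>i\<close> are independent modulo \<open>J1\<close>, the quotient of \<open>J2\<close> by
  \<open>P = J1 + \<Sum> g\<^sub>i F\<close> is a direct sum of \<open>t\<close> copies of \<open>R/(I + F)\<close>. The copies appear as the successive
  quotients of the chain \<open>L 0 = P \<subseteq> \<dots> \<subseteq> L t = J2\<close>, in which \<open>F\<close> is replaced by \<open>R\<close> in one
  coordinate after the other.\<close>

lemma right_rank_bound:
  assumes g: "\<forall>i<t. g i \<in> J2" and span: "J2 \<subseteq> lspan (J1 \<union> (\<Union>i<t. (\<otimes>) (g i) ` carrier R))"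
    and indep: "\<And>r. \<lbrakk>\<forall>i<t. r i \<in> carrier R; (\<Oplus>i\<in>{..<t}. g i \<otimes> r i) \<in> J1\<rbrakk> \<Longrightarrow> \<forall>i<t. r i \<in> I"
    and sF: "subspace F" and fin: "finite_over F (carrier R)"
  defines "P \<equiv> lspan (J1 \<union> (\<Union>i<t. (\<otimes>) (g i) ` F))"
  shows "finite_over P J2" "t * rdim (I <+>\<^bsub>R\<^esub> F) (carrier R) \<le> rdim P J2"
proof -
  define A where "A k i = (if i < k then carrier R else F)" for k i :: nat
  define L where "L k = lspan (J1 \<union> (\<Union>i<t. (\<otimes>) (g i) ` A k i))" for k
  let ?d = "rdim (I <+>\<^bsub>R\<^esub> F) (carrier R)"
  have FR: "F \<subseteq> carrier R" using subspace_mem[OF sF] by blast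
  have sA: "subspace (A k i)" for k i unfolding A_def using sF subspace_carrier by simp
  have AR: "A k i \<subseteq> carrier R" for k i using subspace_mem[OF sA] by blast
  have gR: "g i \<in> carrier R" if "i < t" for i using g that subspace_mem[OF sJ2] by simp
  have gens: "J1 \<union> (\<Union>i<t. (\<otimes>) (g i) ` A k i) \<subseteq> J2" for k
  proof -
    have "g i \<otimes> a \<in> J2" if "i < t" "a \<in> A k i" for i a
      using ideal.I_r_closed[OF J2, of "g i" a] g that AR by blast
    then show ?thesis using J12 by auto
  qed
  then have sL: "subspace (L k)" for k
    unfolding L_def using subspace_mem[OF sJ2] by (intro subspace_lspan) blast
  have LJ2: "L k \<subseteq> J2" for k unfolding L_def by (rule lspan_minimal[OF gens sJ2])
  have L0: "L 0 = P" unfolding L_def P_def A_def by simp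
  have "(\<Union>i<t. (\<otimes>) (g i) ` A t i) = (\<Union>i<t. (\<otimes>) (g i) ` carrier R)"
    by (rule SUP_cong) (auto simp: A_def)
  then have Lt: "L t = J2" using LJ2[of t] span unfolding L_def by auto
  have Lmono: "L k \<subseteq> L l" if "k \<le> l" for k l
  proof -
    have "A k i \<subseteq> A l i" for i unfolding A_def using that FR by auto
    then show ?thesis unfolding L_def by (intro hull_mono Un_mono UN_mono image_mono order_refl)
  qed
  have "generated_over P J2 (\<Sum>i<t. rdim F (carrier R))"
  proof (rule generated_over_UN_image)
    show "linear ((\<otimes>) (g i))" if "i \<in> {..<t}" for i using that gR by (intro linear_mult_left) simp
    show "generated_over F (carrier R) (rdim F (carrier R))" by (rule generated_over_rdim[OF fin])
    show "(\<otimes>) (g i) ` F \<subseteq> P" if "i \<in> {..<t}" for i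
      unfolding P_def using that by (auto intro: hull_inc)
    show "subspace P" using sL[of 0] L0 by simp
    have "lspan (J1 \<union> (\<Union>i<t. (\<otimes>) (g i) ` carrier R)) \<subseteq> lspan (P \<union> (\<Union>i\<in>{..<t}. (\<otimes>) (g i) ` carrier R))"
      by (intro hull_mono Un_mono order_refl) (simp add: P_def hull_inc subset_iff)
    then show "J2 \<subseteq> lspan (P \<union> (\<Union>i\<in>{..<t}. (\<otimes>) (g i) ` carrier R))" using span by blast
  qed (use FR in auto)
  then show fin': "finite_over P J2" unfolding finite_over_def by blast
  have finL: "finite_over (L 0) (L k)" if "k \<le> t" for k
    using rdim_additive(1)[OF sL sL sJ2 Lmono LJ2, of 0 k] fin' L0 by simp
  have step: "?d \<le> rdim (L k) (L (Suc k))" if k: "k < t" for k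
  proof -
    have gk: "(\<otimes>) (g k) ` carrier R \<subseteq> L (Suc k)"
      unfolding L_def by (rule order_trans[OF _ hull_subset]) (use k in \<open>auto simp: A_def\<close>)
    have "finite_over (L k) (L (Suc k))"
      by (rule rdim_additive(2)[OF sL sL sL Lmono Lmono finL]) (use k in auto)
    then have gen: "generated_over (L k) (L k <+>\<^bsub>R\<^esub> (\<otimes>) (g k) ` carrier R) (rdim (L k) (L (Suc k)))"
      by (intro generated_over_mono[OF generated_over_rdim order_refl set_add_least[OF sL Lmono gk]]) auto
    have "generated_over (I <+>\<^bsub>R\<^esub> F) (carrier R) (rdim (L k) (L (Suc k)))"
    proof (rule generated_over_vimage[OF linear_mult_left[OF gR[OF k]] gen])
      show sIF: "subspace (I <+>\<^bsub>R\<^esub> F)" by (rule subspace_set_add[OF sI sF])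
      show "I <+>\<^bsub>R\<^esub> F \<subseteq> carrier R" using subspace_mem[OF sIF] by blast
      show "subspace (carrier R)" by (rule subspace_carrier)
      show "subspace (L k)" by (rule sL)
      fix x assume x: "x \<in> carrier R" and "g k \<otimes> x \<in> L k"
      then have "\<exists>j\<in>J1. \<exists>r. (\<forall>i\<in>{..<t}. r i \<in> A k i) \<and> g k \<otimes> x = j \<oplus> (\<Oplus>i\<in>{..<t}. g i \<otimes> r i)"
        unfolding L_def by (intro lspan_UN_decomp sJ1 sA) (use gR in auto)
      then obtain j r where jr: "j \<in> J1" "\<forall>i\<in>{..<t}. r i \<in> A k i"
        "g k \<otimes> x = j \<oplus> (\<Oplus>i\<in>{..<t}. g i \<otimes> r i)" by blast
      \<comment> \<open>subtracting \<open>g\<^sub>k x\<close> from the combination turns it into a relation modulo \<open>J1\<close>\<close>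
      define s where "s i = (if k = i then \<ominus> x else \<zero>)" for i
      have rc: "r i \<in> carrier R" if "i < t" for i using jr(2) AR that by blast
      have sc: "s i \<in> carrier R" for i unfolding s_def using x by simp
      have jc: "j \<in> carrier R" using jr(1) subspace_mem[OF sJ1] by simp
      have rsum: "(\<Oplus>i\<in>{..<t}. g i \<otimes> r i) \<in> carrier R" using gR rc by (intro M.finsum_closed) auto
      have "(\<Oplus>i\<in>{..<t}. g i \<otimes> s i) = (\<Oplus>i\<in>{..<t}. if k = i then g i \<otimes> \<ominus> x else \<zero>)"
        by (rule M.finsum_cong') (use gR x in \<open>auto simp: s_def\<close>)
      also have "\<dots> = g k \<otimes> \<ominus> x"
        by (rule M.finsum_singleton) (use k gR x in auto)
      finally have ssum: "(\<Oplus>i\<in>{..<t}. g i \<otimes> s i) = \<ominus> (g k \<otimes> x)" using gR[OF k] x by (simp add: r_minus)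
      have "(\<Oplus>i\<in>{..<t}. g i \<otimes> (r i \<oplus> s i)) = (\<Oplus>i\<in>{..<t}. g i \<otimes> r i) \<oplus> (\<Oplus>i\<in>{..<t}. g i \<otimes> s i)"
        by (rule finsum_mult_add) (use gR rc sc in auto)
      also have "\<dots> = (\<Oplus>i\<in>{..<t}. g i \<otimes> r i) \<ominus> (j \<oplus> (\<Oplus>i\<in>{..<t}. g i \<otimes> r i))"
        unfolding ssum jr(3) by (simp add: M.minus_eq)
      also have "\<dots> = \<ominus> j"
        using diff_add_cancel_right[OF M.zero_closed jc rsum] rsum jc by (simp add: M.minus_eq)
      finally have "(\<Oplus>i\<in>{..<t}. g i \<otimes> (r i \<oplus> s i)) \<in> J1" using submoduleE(3)[OF sJ1 jr(1)] by simp
      then have "r k \<oplus> s k \<in> I" using indep[of "\<lambda>i. r i \<oplus> s i"] rc sc k by simp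
      then have rI: "r k \<ominus> x \<in> I" by (simp add: s_def M.minus_eq)
      have rF: "r k \<in> F" using bspec[OF jr(2), of k] k by (simp add: A_def)
      have "\<ominus> (r k \<ominus> x) \<oplus> r k = x"
        using rc[OF k] x by (simp add: M.minus_eq M.minus_add M.a_ac M.r_neg2 M.r_neg1 M.l_neg M.r_neg)
      then show "x \<in> I <+>\<^bsub>R\<^esub> F" unfolding set_add_mem using submoduleE(3)[OF sI rI] rF by metis
    qed
    then show ?thesis by (rule rdim_le)
  qed
  have "k * ?d \<le> rdim (L 0) (L k)" if "k \<le> t" for k
    using that
  proof (induction k)
    case (Suc k)
    have "rdim (L 0) (L (Suc k)) = rdim (L 0) (L k) + rdim (L k) (L (Suc k))"
      by (rule rdim_additive(3)[OF sL sL sL Lmono Lmono finL]) (use Suc.prems in auto)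
    then show ?case using Suc step[of k] by simp
  qed simp
  then show "t * ?d \<le> rdim P J2" using L0 Lt by force
qed

end

locale weak_adic_subquotient = weak_adic_alg K R \<Gamma> + ideal_subquotient K R I J1 J2
  for K :: "('k, 'c) ring_scheme" and R :: "('k, 'a, 'd) module_scheme" (structure)
    and \<Gamma> :: "int \<Rightarrow> 'a set" and I J1 J2 :: "'a set"
begin

text \<open>The two bounds meet in the Artin--Rees inclusion \<open>J2 \<inter> F (n + c) \<subseteq> J2 F n \<subseteq> P\<close>, where \<open>F n\<close> is \<open>\<Gamma> (- n)\<close>,
  and give \<open>t d(n) \<le> s d(n + c)\<close> for \<open>d(n) = dim R/(I + F n)\<close>.\<close>

lemma right_rank_le_left_rank:
  assumes noeth: "right_noetherian (gr R \<Gamma>)" and ne: "J1 \<noteq> J2"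
    and left: "is_basis (R Quot I) (left_quotient R J2 J1) s e"
    and right: "is_basis (R Quot I) (right_quotient R J2 J1) t e'"
  shows "t \<le> s"
proof (rule ccontr)
  assume st: "\<not> t \<le> s"
  from left_basis_generates[OF left] obtain g where g: "\<forall>i<s. g i \<in> J2"
    "J2 \<subseteq> lspan (J1 \<union> (\<Union>i<s. (\<lambda>r. r \<otimes> g i) ` carrier R))" by blast
  from right_basis_generates[OF right] obtain h where h: "\<forall>i<t. h i \<in> J2"
    "J2 \<subseteq> lspan (J1 \<union> (\<Union>i<t. (\<otimes>) (h i) ` carrier R))"
    "\<And>r. \<lbrakk>\<forall>i<t. r i \<in> carrier R; (\<Oplus>i\<in>{..<t}. h i \<otimes> r i) \<in> J1\<rbrakk> \<Longrightarrow> \<forall>i<t. r i \<in> I" by blast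
  define F where "F n = \<Gamma> (- int n)" for n
  define d where "d n = rdim (I <+>\<^bsub>R\<^esub> F n) (carrier R)" for n
  note sF = filt_subspace[of "- int n" for n, folded F_def]
  have riJ2: "right_ideal J2 R" by (rule right_ideal_if_ideal[OF J2])
  obtain c where c: "\<And>n. J2 \<inter> F (n + c) \<subseteq> lspan (\<Union>y\<in>J2. (\<otimes>) y ` F n)"
    using artin_rees[OF noeth riJ2] unfolding F_def by blast
  have rec: "t * d n \<le> s * d (n + c)" for n
  proof -
    let ?P = "lspan (J1 \<union> (\<Union>i<t. (\<otimes>) (h i) ` F n))"
    have finP: "finite_over ?P J2" and tP: "t * d n \<le> rdim ?P J2"
      unfolding d_def by (rule right_rank_bound[OF h sF finite_over_filt[folded F_def]]; assumption)+
    have Fc: "x \<in> carrier R" if "x \<in> F m" for x m using subspace_mem[OF sF that] .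
    have hc: "h i \<in> carrier R" if "i < t" for i using h(1) that subspace_mem[OF sJ2] by simp
    have "J1 \<union> (\<Union>i<t. (\<otimes>) (h i) ` F n) \<subseteq> carrier R"
      using subspace_mem[OF sJ1] hc Fc by auto
    then have sP: "subspace ?P" by (rule subspace_lspan)
    have "y \<otimes> a \<in> ?P" if y: "y \<in> J2" and a: "a \<in> F n" for y a
    proof -
      let ?T = "{x \<in> carrier R. x \<otimes> a \<in> ?P}"
      have "J1 \<subseteq> ?T"
        using subspace_mem[OF sJ1] ideal.I_r_closed[OF J1 _ Fc[OF a]] by (auto intro: hull_inc)
      moreover have "h i \<otimes> r \<in> ?T" if "i < t" "r \<in> carrier R" for i r
      proof -
        have "h i \<otimes> r \<otimes> a = h i \<otimes> (r \<otimes> a)"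
          using hc[OF that(1)] that(2) Fc[OF a] by (simp add: m_assoc)
        moreover have "r \<otimes> a \<in> F n" using filt_mult_left[OF that(2)] a unfolding F_def by blast
        ultimately have "h i \<otimes> r \<otimes> a \<in> ?P" using that(1) by (intro hull_inc) auto
        then show ?thesis using hc[OF that(1)] that(2) by simp
      qed
      ultimately have "J1 \<union> (\<Union>i<t. (\<otimes>) (h i) ` carrier R) \<subseteq> ?T" by blast
      then have "lspan (J1 \<union> (\<Union>i<t. (\<otimes>) (h i) ` carrier R)) \<subseteq> ?T"
        by (rule lspan_minimal[OF _ linear_vimage[OF linear_mult_right[OF Fc[OF a]] sP]])
      then show ?thesis using h(2) y by blast
    qed
    then have "(\<Union>y\<in>J2. (\<otimes>) y ` F n) \<subseteq> ?P" by blast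
    then have "J2 \<inter> F (n + c) \<subseteq> ?P" using c lspan_minimal[OF _ sP] by blast
    moreover have "J1 \<subseteq> ?P" by (auto intro: hull_inc)
    ultimately have "J1 <+>\<^bsub>R\<^esub> (J2 \<inter> F (n + c)) \<subseteq> ?P" by (intro set_add_least[OF sP])
    moreover have gen: "generated_over (J1 <+>\<^bsub>R\<^esub> (J2 \<inter> F (n + c))) J2 (s * d (n + c))"
      unfolding d_def F_def by (rule left_rank_bound[OF g right_ideal_filt finite_over_filt])
    ultimately have "rdim ?P J2 \<le> s * d (n + c)"
      using generated_over_mono[OF gen _ order_refl order_refl] rdim_le by blast
    then show ?thesis using tP by linarith
  qed
  have "d 1 > 0"
  proof (rule ccontr)
    assume "\<not> d 1 > 0"
    have "\<one> \<notin> I"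
    proof
      assume "\<one> \<in> I"
      then have "x \<in> J1" if "x \<in> J2" for x
        using right_annihilates[of "\<one>" x] that subspace_mem[OF sJ2 that] by simp
      then show False using ne J12 by blast
    qed
    then have "I \<noteq> carrier R" by auto
    then obtain M where M: "maximal_right_ideal M R" "I \<subseteq> M"
      using proper_right_ideal_le_maximal[OF right_ideal_if_ideal[OF I]] by blast
    have sM: "subspace M" "M \<noteq> carrier R"
      using M(1) right_idealD(1) unfolding maximal_right_ideal_def by auto
    have "F 1 \<subseteq> M" using M(1) filt_radical unfolding F_def jacobson_radical_def by auto
    then have "I <+>\<^bsub>R\<^esub> F 1 \<subseteq> M" by (rule set_add_least[OF sM(1) M(2)])
    moreover have "finite_over (I <+>\<^bsub>R\<^esub> F 1) (carrier R)"
      by (rule rdim_antimono(1)[OF finite_over_filt[folded F_def] set_add_upper2[OF sI sF]])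
    from generated_over_rdim[OF this] have "carrier R \<subseteq> I <+>\<^bsub>R\<^esub> F 1"
      using \<open>\<not> d 1 > 0\<close> generated_over_0[OF subspace_set_add[OF sI sF]] unfolding d_def by simp
    ultimately show False using sM subspace_mem[OF sM(1)] by blast
  qed
  moreover have "\<exists>C. \<forall>n. real (d n) \<le> C * \<rho> ^ n" if \<rho>: "\<rho> > 1" for \<rho> :: real
  proof -
    obtain C where C: "\<And>n. real (rdim (F n) (carrier R)) \<le> C * \<rho> ^ n"
      using subexponential_growth[OF noeth \<rho>] unfolding F_def by blast
    have "d n \<le> rdim (F n) (carrier R)" for n
      unfolding d_def
      by (rule rdim_antimono(2)[OF finite_over_filt[folded F_def] set_add_upper2[OF sI sF]])
    then show ?thesis using C by (meson of_nat_le_iff order_trans)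
  qed
  ultimately show False
    using no_exponential_growth[of t d s c 1] rec st by simp
qed

end

theorem corollary2p6:
  fixes K :: "('k, 'c) ring_scheme" and R :: "('k, 'a, 'd) module_scheme"
    and I J1 J2 :: "'a set" and s t :: nat
  assumes "assoc_algebra K R"
    and "semilocal R"
    and "adically_complete R (jacobson_radical R)"
    and "right_noetherian R"
    and "finite_dimensional K (quotient_space R (carrier R) (jacobson_radical R))"
    and "ideal I R" and "ideal J1 R" and "ideal J2 R" and "J1 \<subset> J2"
    and "\<forall>a \<in> I. \<forall>x \<in> J2. a \<otimes>\<^bsub>R\<^esub> x \<in> J1"
    and "\<forall>a \<in> I. \<forall>x \<in> J2. x \<otimes>\<^bsub>R\<^esub> a \<in> J1"
    and "free_left_module (R Quot I) (left_quotient R J2 J1) s"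
    and "free_right_module (R Quot I) (right_quotient R J2 J1) t"
    and "s < t"
  shows "\<not> (\<exists>\<Gamma>. weak_adic_filtration K R \<Gamma> \<and> right_noetherian (gr R \<Gamma>))"
proof
  assume "\<exists>\<Gamma>. weak_adic_filtration K R \<Gamma> \<and> right_noetherian (gr R \<Gamma>)"
  then obtain \<Gamma> where \<Gamma>: "weak_adic_filtration K R \<Gamma>" and noeth: "right_noetherian (gr R \<Gamma>)" by blast
  have vector_space_over: "vector_space_over K R"
    using assms(1) unfolding assoc_algebra_def vector_space_over_def by simp
  then have algebra_over: "algebra_over K R" using assms(1) by (rule algebra_over.intro)
  interpret algebra_over K R by fact
  have fin: "finite_over (jacobson_radical R) (carrier R)"
    by (rule finite_over_if_finite_dimensional[OF assms(5) right_idealD(1)[OF right_ideal_jacobson] subspace_carrier])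
      (auto simp: jacobson_radical_def)
  have "noetherian_alg K R" using algebra_over assms(4) by (simp add: noetherian_alg_def noetherian_alg_axioms_def)
  then have "complete_alg K R"
    using assms(3) fin by (simp add: complete_alg_def complete_alg_axioms_def)
  then have weak: "weak_adic_alg K R \<Gamma>" using \<Gamma> by (rule weak_adic_alg.intro)
  have "ideal_subquotient K R I J1 J2"
    using algebra_over assms(6-11) by (simp add: ideal_subquotient_def ideal_subquotient_axioms_def psubset_imp_subset)
  with weak have S: "weak_adic_subquotient K R \<Gamma> I J1 J2" by (rule weak_adic_subquotient.intro)
  obtain e where e: "is_basis (R Quot I) (left_quotient R J2 J1) s e"
    using assms(12) unfolding free_left_module_def by blast
  obtain e' where e': "is_basis (R Quot I) (right_quotient R J2 J1) t e'"
    using assms(13) unfolding free_right_module_def by blast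
  have "J1 \<noteq> J2" using assms(9) by blast
  from weak_adic_subquotient.right_rank_le_left_rank[OF S noeth this e e'] show False
    using assms(14) by simp
qed

end
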